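(* Let $n>p\ge1$ and consider the family $f_{a,B}(x;\theta)=\frac{1}{|\det B|}f(B^{-1}(x-a);\theta)$, $x\in\mathbb{R}^p$, $\theta\ge0$, with $a\in\mathbb{R}^p$, $B\in GL(p)$ and $f(x;0)=(2\pi)^{-p/2}\exp(-\|x\|^2/2)$, where $\log f(x;\theta)$ is continuously differentiable in $\theta\ge0$ including $\theta=0$. Assume: (i) there are constants $p_0>0$, $p_1,p_2\in\mathbb{R}$ such that for all $x\in\mathbb{R}^p$ $$\frac{\frac{\partial}{\partial\theta}f(x;\theta)\big|_{\theta=0}}{f(x;0)}=p_0\|x\|^4+p_1\|x\|^2+p_2;$$ (ii) for some $\epsilon>0$ $$\int_{GL(p)}\int_{\mathbb{R}^p}g(a,B;\epsilon)^n\exp\Big(-\frac n2\|a\|^2-\frac n2\mathrm{tr}(B'B)\Big)|\det B|^{n-p-1}\,da\,dB<\infty,$$ where $$g(a,B;\epsilon)=\sup_{\|z\|\le\sqrt n,\;0\le\theta\le\epsilon}\frac{\left|\frac{\partial}{\partial\theta}f(a+Bz;\theta)\right|}{f(a+Bz;0)} .$$ Let $z_1,\dots,z_n\in\mathbb{R}^p$ be the standardized observations defined in the context and let $z_{ij}$ be the $j$th element of $z_i$. Then the rejection region of the locally best invariant test for testing normality $H_0:\theta=0$ against $H_1:\theta>0$ under the action of $\mathbb{R}^p\times GL(p)$ is given by $$\sum_{i=1}^n\|z_i\|^4>k .$$ The rejection region of the locally best invariant test under the action of $\mathbb{R}^p\times LT(p)$ is given by $$(n+p+2)(n+p)\sum_{i=1}^n\|z_i\|^4-2(n+p+2)\sum_{i=1}^n\sum_{j,k=1}^p\max(j,k)z_{ij}^2z_{ik}^2-2(n+p)\sum_{i=1}^n\sum_{j,k=1}^p\min(j,k)z_{ij}^2z_{ik}^2+4\sum_{i=1}^n\Big(\sum_{j=1}^pj\,z_{ij}^2\Big)^2>k'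 .$$
   Context: $\|\cdot\|$ is the Euclidean norm, a prime denotes transpose, $da$ and $dB$ are Lebesgue measures on $\mathbb{R}^p$ and $\mathbb{R}^{p\times p}$. $GL(p)$ is the group of nonsingular $p\times p$ real matrices and $LT(p)$ the group of $p\times p$ lower triangular matrices with positive diagonal elements. The observations $x_1,\dots,x_n\in\mathbb{R}^p$ are i.i.d. from $f_{a,B}(x;\theta)$ ($a,B,\theta$ unknown); for each $\theta$, $f(\cdot;\theta)$ is a probability density on $\mathbb{R}^p$. Put $\bar x=\frac1n\sum_ix_i$, $S=\frac1n\sum_i(x_i-\bar x)(x_i-\bar x)'$ (almost surely positive definite since $n>p$), let $T\in LT(p)$ be the Cholesky root, $S=TT'$, and $z_i=T^{-1}(x_i-\bar x)$. For $G=GL(p)$ or $G=LT(p)$, $(a,B)\in\mathbb{R}^p\times G$ acts on samples by $x_i\mapsto a+Bx_i$, $i=1,\dots,n$. A rejection region $R\subset(\mathbb{R}^p)^n$ is invariant under $\mathbb{R}^p\times G$ if it is preserved by this action. Write $P_{\theta,a,B}$ for probabilities when the density is $f_{a,B}(\cdot;\theta)$; for invariant regions the null probability $P_0(R)$ does not depend on $(a,B)$. An invariant region $R$ is the rejection region of a locally best invariant (LBI) test under $\mathbb{R}^p\times G$ (of size $P_0(R)$) if for every invariant region $R'$ with $P_0(R')\le P_0(R)$ and every $(a,B)\in\mathbb{R}^p\times GL(p)$ there is $\theta_0>0$ such that $P_{\theta,a,B}(R)\ge P_{\theta,a,B}(R')$ for all $0<\theta<\theta_0$. *)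

theory Defs
  imports "HOL-Probability.Probability"
begin

text \<open>
  The dimension \<open>p\<close> is the cardinality of the index type \<open>'p\<close>, the sample size \<open>n\<close> that of \<open>'n\<close>.
  The linear order on \<open>'p\<close> makes sense of ``lower triangular''; \<open>pos\<close> turns an index into its number
  in \<open>{1..p}\<close>.
\<close>

definition pos :: "'p::{finite,linorder} \<Rightarrow> nat" where
  "pos j = card {i. i \<le> j}"

definition GLp :: "(real^'p^'p) set" where
  "GLp = {B. invertible B}"

definition LTp :: "(real^'p::{finite,linorder}^'p::{finite,linorder}) set" where
  "LTp = {T. (\<forall>i j. i < j \<longrightarrow> T $ i $ j = 0) \<and> (\<forall>i. 0 < T $ i $ i)}"

definition positive_definite :: "real^'p^'p \<Rightarrow> bool" where
  "positive_definite A \<longleftrightarrow> transpose A = A \<and> (\<forall>v. v \<noteq> 0 \<longrightarrow> 0 < v \<bullet> (A *v v))"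

definition is_density :: "(real^'p \<Rightarrow> real) \<Rightarrow> bool" where
  "is_density h \<longleftrightarrow> h \<in> borel_measurable borel \<and> (\<forall>x. 0 \<le> h x) \<and>
     (\<integral>\<^sup>+x. ennreal (h x) \<partial>lborel) = 1"


subsection \<open>The location-scale family\<close>

definition affine_density ::
  "(real^'p \<Rightarrow> real \<Rightarrow> real) \<Rightarrow> real^'p \<Rightarrow> real^'p^'p \<Rightarrow> real \<Rightarrow> real^'p \<Rightarrow> real" where
  "affine_density f a B \<theta> x = 1 / \<bar>det B\<bar> * f (matrix_inv B *v (x - a)) \<theta>"

text \<open>The law of an i.i.d. sample indexed by \<open>'n\<close>.\<close>

definition sample_law ::
  "(real^'p \<Rightarrow> real \<Rightarrow> real) \<Rightarrow> real \<Rightarrow> real^'p \<Rightarrow> real^'p^'p \<Rightarrow> ('n \<Rightarrow> real^'p) measure" where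
  "sample_law f \<theta> a B =
     (\<Pi>\<^sub>M i\<in>UNIV. density lborel (\<lambda>x. ennreal (affine_density f a B \<theta> x)))"

text \<open>The parameter space is \<open>\<theta> \<ge> 0\<close>, so derivatives in \<open>\<theta>\<close> are one-sided at \<open>0\<close>.\<close>

definition d_theta :: "('x \<Rightarrow> real \<Rightarrow> real) \<Rightarrow> 'x \<Rightarrow> real \<Rightarrow> real" where
  "d_theta f x \<theta> = vector_derivative (f x) (at \<theta> within {0..})"

definition log_C1 :: "('x \<Rightarrow> real \<Rightarrow> real) \<Rightarrow> bool" where
  "log_C1 f \<longleftrightarrow> (\<forall>x.
     (\<forall>\<theta>\<ge>0. 0 < f x \<theta>) \<and>
     (\<lambda>\<theta>. ln (f x \<theta>)) differentiable_on {0..} \<and>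
     continuous_on {0..} (d_theta (\<lambda>y \<theta>. ln (f y \<theta>)) x))"

text \<open>
  The supremum may be infinite, and it need not be Borel measurable in \<open>(a, B)\<close>. It is
  universally measurable, because \<open>d_theta f\<close> is jointly Borel measurable when \<open>f\<close> is Borel in \<open>x\<close>
  and continuously differentiable in \<open>\<theta>\<close>; hence the nonnegative integrals with respect to
  \<open>lborel\<close> below are the Lebesgue integrals.
\<close>

definition g_sup ::
  "'n itself \<Rightarrow> (real^'p \<Rightarrow> real \<Rightarrow> real) \<Rightarrow> real^'p \<Rightarrow> real^'p^'p \<Rightarrow> real \<Rightarrow> ennreal" where
  "g_sup _ f a B \<epsilon> =
     (SUP (z, \<theta>) \<in> {z. norm z \<le> sqrt CARD('n)} \<times> {0..\<epsilon>}.
        ennreal (\<bar>d_theta f (a + B *v z) \<theta>\<bar> / f (a + B *v z) 0))"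


subsection \<open>Standardized observations\<close>

definition sample_mean :: "('n \<Rightarrow> real^'p) \<Rightarrow> real^'p" where
  "sample_mean x = (1 / CARD('n)) *\<^sub>R (\<Sum>i\<in>UNIV. x i)"

definition sample_cov :: "('n \<Rightarrow> real^'p) \<Rightarrow> real^'p^'p" where
  "sample_cov x = (\<chi> j k. 1 / CARD('n) *
     (\<Sum>i\<in>UNIV. (x i - sample_mean x) $ j * (x i - sample_mean x) $ k))"

definition cholesky :: "real^'p::{finite,linorder}^'p::{finite,linorder} \<Rightarrow> real^'p::{finite,linorder}^'p::{finite,linorder}" where
  "cholesky S = (THE T. T \<in> LTp \<and> S = T ** transpose T)"

definition standardized :: "('n \<Rightarrow> real^'p::{finite,linorder}) \<Rightarrow> 'n \<Rightarrow> real^'p::{finite,linorder}" where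
  "standardized x i = matrix_inv (cholesky (sample_cov x)) *v (x i - sample_mean x)"


subsection \<open>Invariant regions and locally best invariant tests\<close>

definition invariant_region :: "(real^'p^'p) set \<Rightarrow> ('n \<Rightarrow> real^'p) set \<Rightarrow> bool" where
  "invariant_region G R \<longleftrightarrow> R \<in> sets (\<Pi>\<^sub>M i\<in>UNIV. borel) \<and>
     (\<forall>a. \<forall>B\<in>G. (\<lambda>x i. a + B *v x i) ` R = R)"

text \<open>
  Sizes are evaluated at \<open>a = 0\<close> and \<open>B = I\<close>: the null probability of an invariant region does not
  depend on \<open>(a, B)\<close>. The alternatives range over all of \<open>GLp\<close>, whatever the group \<open>G\<close>.
\<close>

definition LBI_region ::
  "(real^'p \<Rightarrow> real \<Rightarrow> real) \<Rightarrow> (real^'p^'p) set \<Rightarrow> ('n \<Rightarrow> real^'p) set \<Rightarrow> bool" where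
  "LBI_region f G R \<longleftrightarrow> invariant_region G R \<and>
     (\<forall>R' :: ('n \<Rightarrow> real^'p) set. invariant_region G R' \<and>
           measure (sample_law f 0 0 (mat 1)) R' \<le> measure (sample_law f 0 0 (mat 1)) R \<longrightarrow>
        (\<forall>a. \<forall>B\<in>GLp. \<exists>\<theta>\<^sub>0>0. \<forall>\<theta>. 0 < \<theta> \<and> \<theta> < \<theta>\<^sub>0 \<longrightarrow>
           measure (sample_law f \<theta> a B) R \<ge> measure (sample_law f \<theta> a B) R'))"

text \<open>
  The standardized observations exist only where the sample covariance is positive definite, an
  invariant set of full measure; samples outside it are not rejected.
\<close>

definition rejection_region ::
  "(('n \<Rightarrow> real^'p::{finite,linorder}) \<Rightarrow> real) \<Rightarrow> real \<Rightarrow> ('n \<Rightarrow> real^'p::{finite,linorder}) set" where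
  "rejection_region t k =
     {x. positive_definite (sample_cov x) \<and> t (standardized x) > k}"

definition GL_stat :: "('n \<Rightarrow> real^'p) \<Rightarrow> real" where
  "GL_stat z = (\<Sum>i\<in>UNIV. norm (z i) ^ 4)"

definition LT_stat :: "('n \<Rightarrow> real^'p::{finite,linorder}) \<Rightarrow> real" where
  "LT_stat z =
     (let n = real CARD('n); p = real CARD('p) in
      (n + p + 2) * (n + p) * (\<Sum>i\<in>UNIV. norm (z i) ^ 4)
      - 2 * (n + p + 2) *
          (\<Sum>i\<in>UNIV. \<Sum>j\<in>UNIV. \<Sum>k\<in>UNIV. real (max (pos j) (pos k)) * (z i $ j)\<^sup>2 * (z i $ k)\<^sup>2)
      - 2 * (n + p) *
          (\<Sum>i\<in>UNIV. \<Sum>j\<in>UNIV. \<Sum>k\<in>UNIV. real (min (pos j) (pos k)) * (z i $ j)\<^sup>2 * (z i $ k)\<^sup>2)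
      + 4 * (\<Sum>i\<in>UNIV. (\<Sum>j\<in>UNIV. real (pos j) * (z i $ j)\<^sup>2)\<^sup>2))"

end

theory Submission
  imports Defs
begin

text \<open>
  The proof rests on the generalized Neyman--Pearson lemma, applied to the derivative at \<open>\<theta> = 0\<close> of the
  power function, which for an invariant region depends only on the conditional mean of the score given
  the standardized sample.

  The substitution \<open>x = a + B y\<close> expresses every power as a power at \<open>a = 0\<close>, \<open>B = I\<close>
  (\<open>measure_sample_law\<close>).  There the likelihood has derivative \<open>c (p\<^sub>0 \<Sum>\<parallel>x\<^sub>i\<parallel>\<^sup>4 + p\<^sub>1 \<Sum>\<parallel>x\<^sub>i\<parallel>\<^sup>2 + n p\<^sub>2) exp(- \<Sum>\<parallel>x\<^sub>i\<parallel>\<^sup>2 / 2)\<close> at \<open>0\<close>,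
  with a constant \<open>c > 0\<close>,
  and the integrability condition on \<open>g_sup\<close> allows differentiation under the integral
  (\<open>power_fun_derivative\<close>).

  The conditional mean comes from a disintegration (\<open>matrix_group.disintegration\<close>): Lebesgue measure on samples
  is a mixture of measures on the orbits \<open>{a + B z}\<close> of standardized samples \<open>z\<close>, each the image of the
  measure \<open>d(B) \<bar>det B\<bar>\<^sup>n\<^sup>-\<^sup>1 da dB\<close> on the affine group.  Since \<open>\<Sum>z\<^sub>i = 0\<close> and \<open>\<Sum>z\<^sub>i z\<^sub>i' = n I\<close>, the normal density at
  \<open>a + B z\<close> is a function of \<open>a\<close> and \<open>B\<close> alone.  The average of \<open>\<Sum>\<parallel>x\<^sub>i\<parallel>\<^sup>2\<close> over an orbit is therefore the same
  for all orbits, and that of \<open>\<Sum>\<parallel>x\<^sub>i\<parallel>\<^sup>4\<close> is a constant plus a positive multiple of \<open>\<Sum>E\<parallel>B z\<^sub>i\<parallel>\<^sup>4\<close>, where \<open>E\<close> is the mean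
  under a measure on matrices (\<open>matrix_group.conditional_means\<close>).  For the general linear group orthogonal
  invariance gives that \<open>E\<parallel>B v\<parallel>\<^sup>4\<close> is proportional to \<open>\<parallel>v\<parallel>\<^sup>4\<close>.  For the lower triangular group the entries of \<open>B\<close>
  are independent, with scaled chi distributions on the diagonal and normal distributions below it, and
  expanding the fourth power gives the second statistic.

  Both times the conditional score is an increasing affine function of the statistic \<open>T\<close>, so among the
  invariant regions of the same size \<open>{T > k}\<close> maximizes the slope of the power at \<open>B = I\<close>
  (\<open>invariant_statistic.slope_rejection_region\<close>).  Local optimality has to hold also in two cases that the
  slopes do not cover.  If the slopes are equal, the regions agree almost everywhere, so their powers
  coincide for all \<open>\<theta>\<close>; and if the competing region has smaller size, continuity of the power at \<open>0\<close> suffices.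
  Finally, a general \<open>B\<close> is the product of a lower triangular and an orthogonal matrix.  The first factor
  is absorbed by invariance, and the second leaves size and slope unchanged, because the null density and
  the score depend only on norms.
\<close>

section \<open>Measurability of vectors and matrices\<close>

lemma borel_measurable_vec_nth [measurable (raw)]:
  fixes f :: "'x \<Rightarrow> ('a::euclidean_space)^'n"
  assumes "f \<in> borel_measurable M"
  shows "(\<lambda>x. f x $ i) \<in> borel_measurable M"
  using borel_measurable_continuous_onI[of "\<lambda>v::'a^'n. v $ i"] assms
  by (simp add: measurable_compose continuous_on_component continuous_on_id)

lemma borel_measurable_vec_lambda [measurable (raw)]:
  fixes f :: "'x \<Rightarrow> 'n::finite \<Rightarrow> ('a::euclidean_space)"
  assumes "\<And>i. (\<lambda>x. f x i) \<in> borel_measurable M"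
  shows "(\<lambda>x. \<chi> i. f x i) \<in> borel_measurable M"
proof (subst borel_measurable_euclidean_space, intro ballI)
  fix b :: "'a^'n" assume "b \<in> Basis"
  then obtain i u where b: "b = axis i u" "u \<in> Basis" by (auto simp: Basis_vec_def)
  have "(\<lambda>x. (\<chi> i. f x i) \<bullet> b) = (\<lambda>x. f x i \<bullet> u)" by (simp add: b inner_axis)
  then show "(\<lambda>x. (\<chi> i. f x i) \<bullet> b) \<in> borel_measurable M" using assms by simp
qed

lemma borel_measurable_matrix_vector_mult [measurable (raw)]:
  fixes A :: "'x \<Rightarrow> real^'n^'m"
  assumes [measurable]: "A \<in> borel_measurable M" "v \<in> borel_measurable M"
  shows "(\<lambda>x. A x *v v x) \<in> borel_measurable M"
  unfolding matrix_vector_mult_def by measurable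

lemma borel_measurable_matrix_mult [measurable (raw)]:
  fixes A :: "'x \<Rightarrow> real^'n^'m" and B :: "'x \<Rightarrow> real^'k^'n"
  assumes [measurable]: "A \<in> borel_measurable M" "B \<in> borel_measurable M"
  shows "(\<lambda>x. A x ** B x) \<in> borel_measurable M"
  unfolding matrix_matrix_mult_def by measurable

lemma borel_measurable_transpose [measurable (raw)]:
  fixes A :: "'x \<Rightarrow> real^'n^'m"
  assumes [measurable]: "A \<in> borel_measurable M"
  shows "(\<lambda>x. transpose (A x)) \<in> borel_measurable M"
  unfolding transpose_def by measurable

lemma borel_measurable_det [measurable (raw)]:
  fixes A :: "'x \<Rightarrow> real^'n^'n"
  assumes [measurable]: "A \<in> borel_measurable M"
  shows "(\<lambda>x. det (A x)) \<in> borel_measurable M"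
  unfolding det_def by measurable

lemma borel_measurable_trace [measurable (raw)]:
  fixes A :: "'x \<Rightarrow> real^'n^'n"
  assumes [measurable]: "A \<in> borel_measurable M"
  shows "(\<lambda>x. trace (A x)) \<in> borel_measurable M"
  unfolding trace_def by measurable

lemma matrix_inv_mult:
  fixes A :: "real^'n^'n"
  assumes "invertible A"
  shows "A ** matrix_inv A = mat 1" "matrix_inv A ** A = mat 1"
  using assms someI_ex[of "\<lambda>B. A ** B = mat 1 \<and> B ** A = mat 1"]
  unfolding invertible_def matrix_inv_def by auto

lemma matrix_inv_eqI:
  fixes A B :: "real^'n^'n"
  assumes "A ** B = mat 1"
  shows "matrix_inv A = B"
proof -
  have "invertible A" using assms invertible_right_inverse by blast
  then have "matrix_inv A ** (A ** B) = B" 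
    by (simp add: matrix_mul_assoc matrix_inv_mult)
  then show ?thesis by (simp add: assms)
qed

lemma invertible_matrix_inv:
  fixes A :: "real^'n^'n"
  assumes "invertible A" shows "invertible (matrix_inv A)"
  using matrix_inv_mult[OF assms] invertible_def by blast

lemma matrix_inv_mult_distrib:
  fixes A B :: "real^'n^'n"
  assumes "invertible A" "invertible B"
  shows "matrix_inv (A ** B) = matrix_inv B ** matrix_inv A"
proof (rule matrix_inv_eqI)
  have "A ** B ** (matrix_inv B ** matrix_inv A) = A ** (B ** matrix_inv B) ** matrix_inv A"
    by (simp add: matrix_mul_assoc)
  then show "A ** B ** (matrix_inv B ** matrix_inv A) = mat 1"
    by (simp add: matrix_inv_mult assms)
qed

lemma borel_measurable_matrix_inv [measurable (raw)]:
  fixes A :: "'x \<Rightarrow> real^'n^'n"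
  assumes [measurable]: "A \<in> borel_measurable M"
  shows "(\<lambda>x. matrix_inv (A x)) \<in> borel_measurable M"
proof -
  \<comment> \<open>Cramer's rule on the invertible matrices; elsewhere \<^const>\<open>matrix_inv\<close> is a constant default.\<close>
  have singular: "matrix_inv B = (SOME C. False)" if "det B = 0" for B :: "real^'n^'n"
    using that unfolding matrix_inv_def by (metis invertible_def invertible_det_nz)
  have regular: "matrix_inv B = (\<chi> k j. det (\<chi> i l. if l = k then axis j 1 $ i else B $ i $ l) / det B)"
    if "det B \<noteq> 0" for B :: "real^'n^'n"
  proof -
    have inv: "invertible B" using that invertible_det_nz by blast
    have "matrix_inv B *v axis j 1 = (\<chi> k. det (\<chi> i l. if l = k then axis j 1 $ i else B $ i $ l) / det B)" for j
      by (rule cramer[OF that, THEN iffD1]) (simp add: matrix_vector_mul_assoc matrix_inv_mult inv)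
    then show ?thesis
      by (simp add: vec_eq_iff matrix_vector_mult_basis column_def)
  qed
  have "(\<lambda>x. matrix_inv (A x)) = (\<lambda>x. if det (A x) = 0 then (SOME C. False) else
      (\<chi> k j. det (\<chi> i l. if l = k then axis j 1 $ i else A x $ i $ l) / det (A x)))"
    using singular regular by auto
  also have "\<dots> \<in> borel_measurable M" by measurable
  finally show ?thesis .
qed

section \<open>Lower triangular matrices and the Cholesky root\<close>

lemma pos_less: "i < j \<Longrightarrow> pos i < pos j"
proof -
  assume "i < j"
  then have "{k. k \<le> i} \<subset> {k. k \<le> j}"
    by (intro psubsetI) (auto dest: order.strict_trans1 simp: set_eq_iff not_le[symmetric])
  then show ?thesis unfolding pos_def by (rule psubset_card_mono[rotated]) simp
qed

lemma pos_le: "i \<le> j \<Longrightarrow> pos i \<le> pos j"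
  unfolding pos_def by (rule card_mono) auto

lemma less_induct_fin [case_names less]:
  fixes j :: "'p::{finite,linorder}"
  assumes "\<And>j. (\<And>i. i < j \<Longrightarrow> P i) \<Longrightarrow> P j"
  shows "P j"
  by (induction j rule: measure_induct_rule[where f=pos]) (metis assms pos_less)

lemma LTpD: "T \<in> LTp \<Longrightarrow> i < j \<Longrightarrow> T $ i $ j = 0" "T \<in> LTp \<Longrightarrow> 0 < T $ i $ i"
  by (auto simp: LTp_def)

text \<open>
  A permutation that nowhere exceeds the identity is the identity.
\<close>

lemma det_LTp: "T \<in> LTp \<Longrightarrow> det T = (\<Prod>i\<in>UNIV. T $ i $ i)"
proof -
  assume T: "T \<in> LTp"
  have id: "p i = i" if p: "p permutes UNIV" and le: "\<And>i. p i \<le> i" for p :: "'a \<Rightarrow> 'a" and i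
  proof (induction i rule: less_induct_fin)
    case (less i)
    show ?case
    proof (rule ccontr)
      assume "p i \<noteq> i"
      then have "p i < i" using le[of i] by simp
      then have "p (p i) = p i" by (rule less)
      then show False using permutes_inj[OF p] \<open>p i \<noteq> i\<close> by (metis injD)
    qed
  qed
  have "(\<Prod>i\<in>UNIV. T $ i $ p i) = 0" if p: "p permutes UNIV" and "p \<noteq> id" for p
  proof -
    obtain i where "i < p i" using id[OF p] \<open>p \<noteq> id\<close> by (metis eq_id_iff not_le)
    then have "T $ i $ p i = 0" using T by (rule LTpD(1)[rotated])
    then show ?thesis by (intro prod_zero) auto
  qed
  then have "det T = (\<Sum>p\<in>{id}. of_int (sign p) * (\<Prod>i\<in>UNIV. T $ i $ p i))"
    unfolding det_def by (intro sum.mono_neutral_right) (auto simp: permutes_id finite_permutations)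
  then show ?thesis by simp
qed

lemma det_LTp_pos: "T \<in> LTp \<Longrightarrow> 0 < det T"
  by (auto simp: det_LTp intro!: prod_pos LTpD)

lemma LTp_invertible: "T \<in> LTp \<Longrightarrow> invertible T"
  using det_LTp_pos invertible_det_nz by (metis less_irrefl)

lemma LTp_mult_nth:
  assumes "T \<in> LTp"
  shows "(T ** B) $ j $ k = T $ j $ j * B $ j $ k + (\<Sum>i | i < j. T $ j $ i * B $ i $ k)"
proof -
  have "(T ** B) $ j $ k = (\<Sum>i\<in>UNIV. T $ j $ i * B $ i $ k)"
    by (simp add: matrix_matrix_mult_def)
  also have "\<dots> = (\<Sum>i\<in>insert j {i. i < j}. T $ j $ i * B $ i $ k)"
    by (rule sum.mono_neutral_right) (use assms in \<open>auto simp: LTp_def\<close>)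
  finally show ?thesis by simp
qed

lemma mult_LTp_nth:
  assumes "T \<in> LTp"
  shows "(B ** T) $ j $ k = T $ k $ k * B $ j $ k + (\<Sum>i | k < i. B $ j $ i * T $ i $ k)"
proof -
  have "(B ** T) $ j $ k = (\<Sum>i\<in>UNIV. B $ j $ i * T $ i $ k)"
    by (simp add: matrix_matrix_mult_def)
  also have "\<dots> = (\<Sum>i\<in>insert k {i. k < i}. B $ j $ i * T $ i $ k)"
    by (rule sum.mono_neutral_right) (use assms in \<open>auto simp: LTp_def\<close>)
  finally show ?thesis by (simp add: mult.commute)
qed

lemma LTp_mult:
  assumes "T \<in> LTp" "U \<in> LTp"
  shows "T ** U \<in> LTp" "(T ** U) $ j $ j = T $ j $ j * U $ j $ j"
proof -
  have diag: "(T ** U) $ j $ j = T $ j $ j * U $ j $ j" for j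
    using assms(2) by (simp add: LTp_mult_nth[OF assms(1)] LTp_def)
  then show "(T ** U) $ j $ j = T $ j $ j * U $ j $ j" .
  have "(T ** U) $ i $ k = 0" if "i < k" for i k
    using assms(2) that by (auto simp: LTp_mult_nth[OF assms(1)] LTp_def intro!: sum.neutral)
  then show "T ** U \<in> LTp"
    using assms by (simp add: LTp_def diag)
qed

lemma mat_1_LTp: "mat 1 \<in> LTp"
  by (auto simp: LTp_def mat_def)

lemma LTp_inv:
  assumes "T \<in> LTp"
  shows "matrix_inv T \<in> LTp" "matrix_inv T $ j $ j = 1 / T $ j $ j"
proof -
  let ?U = "matrix_inv T"
  have id: "T ** ?U = mat 1" by (simp add: matrix_inv_mult LTp_invertible assms)
  have low: "i < j \<longrightarrow> ?U $ i $ j = 0" for i j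
  proof (induction i rule: less_induct_fin)
    case (less i)
    show ?case
    proof
      assume ij: "i < j"
      have "0 = (T ** ?U) $ i $ j" using ij by (simp add: id mat_def)
      also have "\<dots> = T $ i $ i * ?U $ i $ j"
        unfolding LTp_mult_nth[OF assms] using less ij by (auto intro!: sum.neutral)
      finally show "?U $ i $ j = 0" using LTpD(2)[OF assms, of i] by simp
    qed
  qed
  have "1 = (T ** ?U) $ j $ j" for j by (simp add: id mat_def)
  then have "T $ j $ j * ?U $ j $ j = 1" for j
    using low by (auto simp: LTp_mult_nth[OF assms])
  then have diag: "?U $ j $ j = 1 / T $ j $ j" for j
    using LTpD(2)[OF assms, of j] by (simp add: field_simps)
  then show "?U $ j $ j = 1 / T $ j $ j" .
  show "?U \<in> LTp" using low LTpD(2)[OF assms] by (simp add: LTp_def diag)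
qed

lemma LTp_subset_GLp: "LTp \<subseteq> GLp"
  by (auto simp: GLp_def LTp_invertible)

lemma quadratic_form_sum:
  fixes S :: "real^'p^'p"
  shows "v \<bullet> (S *v v) = (\<Sum>i\<in>UNIV. \<Sum>j\<in>UNIV. v $ i * S $ i $ j * v $ j)"
  by (simp add: inner_vec_def matrix_vector_mult_def sum_distrib_left mult.assoc)

lemma positive_definite_mult_transpose:
  fixes T :: "real^'p^'p"
  assumes "invertible T"
  shows "positive_definite (T ** transpose T)"
  unfolding positive_definite_def
proof (intro conjI allI impI)
  show "transpose (T ** transpose T) = T ** transpose T"
    by (simp add: matrix_transpose_mul)
  fix v :: "real^'p" assume "v \<noteq> 0"
  moreover have "v = 0" if "transpose T *v v = 0"
    using that matrix_inv_mult(1)[OF assms]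
    by (metis matrix_transpose_mul matrix_vector_mul_assoc matrix_vector_mul_lid matrix_vector_mult_0_right transpose_mat)
  moreover have "v \<bullet> (T ** transpose T *v v) = (transpose T *v v) \<bullet> (transpose T *v v)"
    by (simp add: matrix_vector_mul_assoc[symmetric] dot_lmul_matrix[symmetric] vector_transpose_matrix)
  ultimately show "0 < v \<bullet> (T ** transpose T *v v)" by auto
qed

lemma mult_transpose_LTp_nth:
  assumes "T \<in> LTp"
  shows "(T ** transpose T) $ j $ k = T $ j $ k * T $ k $ k + (\<Sum>i | i < k. T $ j $ i * T $ k $ i)"
proof -
  have "(T ** transpose T) $ j $ k = (\<Sum>i\<in>UNIV. T $ j $ i * T $ k $ i)"
    by (simp add: matrix_matrix_mult_def transpose_def)
  also have "\<dots> = (\<Sum>i\<in>insert k {i. i < k}. T $ j $ i * T $ k $ i)"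
    by (rule sum.mono_neutral_right) (use assms in \<open>auto simp: LTp_def\<close>)
  finally show ?thesis by simp
qed

lemma mult_transpose_LTp_diag:
  assumes "T \<in> LTp"
  shows "T $ k $ k = sqrt ((T ** transpose T) $ k $ k - (\<Sum>i | i < k. (T $ k $ i)\<^sup>2))"
  using LTpD(2)[OF assms, of k] by (simp add: mult_transpose_LTp_nth[OF assms] power2_eq_square)

lemma mult_transpose_LTp_offdiag:
  assumes "T \<in> LTp"
  shows "T $ j $ k = ((T ** transpose T) $ j $ k - (\<Sum>i | i < k. T $ j $ i * T $ k $ i)) / T $ k $ k"
  using LTpD(2)[OF assms, of k] by (simp add: mult_transpose_LTp_nth[OF assms])

lemma LTp_root_unique:
  assumes "T \<in> LTp" "U \<in> LTp" "T ** transpose T = U ** transpose U"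
  shows "T = U"
proof -
  have "\<forall>j. T $ j $ k = U $ j $ k" for k
  proof (induction k rule: less_induct_fin)
    case (less k)
    then have below: "T $ j $ i = U $ j $ i" if "i < k" for i j using that by blast
    have diag: "T $ k $ k = U $ k $ k"
    proof -
      have "(\<Sum>i | i < k. (T $ k $ i)\<^sup>2) = (\<Sum>i | i < k. (U $ k $ i)\<^sup>2)"
        by (rule sum.cong) (auto simp: below)
      then show ?thesis
        using mult_transpose_LTp_diag[OF assms(1), of k] mult_transpose_LTp_diag[OF assms(2), of k]
        by (simp only: assms(3))
    qed
    show ?case
    proof
      fix j
      have "(\<Sum>i | i < k. T $ j $ i * T $ k $ i) = (\<Sum>i | i < k. U $ j $ i * U $ k $ i)"
        by (rule sum.cong) (auto simp: below)
      then show "T $ j $ k = U $ j $ k"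
        using mult_transpose_LTp_offdiag[OF assms(1), of j k]
          mult_transpose_LTp_offdiag[OF assms(2), of j k]
        by (simp only: assms(3) diag)
    qed
  qed
  then show ?thesis by (simp add: vec_eq_iff)
qed

text \<open>
  The expansion used to complete the square in one step of the Cholesky decomposition.
\<close>

lemma quadratic_form_shift:
  fixes R :: "'p::finite \<Rightarrow> 'p \<Rightarrow> real"
  assumes sym: "\<And>i j. R i j = R j i"
  shows "(\<Sum>i\<in>UNIV. \<Sum>j\<in>UNIV. (v i - s * of_bool (i = b)) * R i j * (v j - s * of_bool (j = b))) =
    (\<Sum>i\<in>UNIV. \<Sum>j\<in>UNIV. v i * R i j * v j) - 2 * s * (\<Sum>i\<in>UNIV. v i * R i b) + s\<^sup>2 * R b b"
proof -
  have 1: "(\<Sum>j\<in>UNIV. y * R i j * (v j - s * of_bool (j = b))) = y * ((\<Sum>j\<in>UNIV. R i j * v j) - s * R i b)" for i y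
  proof -
    have "(\<Sum>j\<in>UNIV. y * R i j * (v j - s * of_bool (j = b)))
       = (\<Sum>j\<in>UNIV. y * (R i j * v j) - (if j = b then y * s * R i b else 0))"
      by (rule sum.cong) (auto simp: algebra_simps)
    then show ?thesis by (simp add: sum_subtractf sum_distrib_left algebra_simps)
  qed
  have 2: "(\<Sum>i\<in>UNIV. (v i - s * of_bool (i = b)) * X i) = (\<Sum>i\<in>UNIV. v i * X i) - s * X b" for X
  proof -
    have "(\<Sum>i\<in>UNIV. (v i - s * of_bool (i = b)) * X i)
       = (\<Sum>i\<in>UNIV. v i * X i - (if i = b then s * X b else 0))"
      by (rule sum.cong) (auto simp: algebra_simps)
    then show ?thesis by (simp add: sum_subtractf)
  qed
  have "(\<Sum>j\<in>UNIV. R b j * v j) = (\<Sum>i\<in>UNIV. v i * R i b)"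
    by (rule sum.cong) (auto simp: sym[of b])
  then show ?thesis
    unfolding 1 2 by (simp add: algebra_simps sum_subtractf sum_distrib_left power2_eq_square)
qed

text \<open>
  Cholesky's algorithm, one column at a time: after the columns in \<open>A\<close> have been split off, the
  residual vanishes on the rows in \<open>A\<close> and is positive definite on the remaining coordinates.  The
  next column is the corresponding column of the residual, divided by the root of its pivot.
\<close>

lemma cholesky_columns:
  fixes S :: "real^'p::{finite,linorder}^'p::{finite,linorder}"
  assumes S: "positive_definite S"
    and "finite A" "\<forall>i\<in>A. \<forall>j<i. j \<in> A"
  shows "\<exists>t :: 'p \<Rightarrow> 'p \<Rightarrow> real.
     (\<forall>k\<in>A. 0 < t k k \<and> (\<forall>j<k. t k j = 0)) \<and>
     (\<forall>i\<in>A. \<forall>j. S $ i $ j - (\<Sum>k\<in>A. t k i * t k j) = 0) \<and>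
     (\<forall>v. (\<forall>i\<in>A. v i = 0) \<and> (\<exists>i. v i \<noteq> 0) \<longrightarrow>
        0 < (\<Sum>i\<in>UNIV. \<Sum>j\<in>UNIV. v i * (S $ i $ j - (\<Sum>k\<in>A. t k i * t k j)) * v j))"
  using assms(2,3)
proof (induction A rule: finite_linorder_max_induct)
  case empty
  have "0 < (\<Sum>i\<in>UNIV. \<Sum>j\<in>UNIV. v i * S $ i $ j * v j)" if "v i \<noteq> 0" for v :: "'p \<Rightarrow> real" and i
  proof -
    have "(\<chi> i. v i) \<noteq> 0" using that by (auto simp: vec_eq_iff)
    then have "0 < (\<chi> i. v i) \<bullet> (S *v (\<chi> i. v i))" using S by (simp add: positive_definite_def)
    then show ?thesis by (simp add: quadratic_form_sum)
  qed
  then show ?case by auto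
next
  case (insert b A)
  have below: "j \<in> A" if "j < b" for j using insert.prems that by auto
  have "\<forall>i\<in>A. \<forall>j<i. j \<in> A" using insert.hyps below by (meson order.strict_trans)
  from insert.IH[OF this] obtain t :: "'p \<Rightarrow> 'p \<Rightarrow> real" where
    t1: "\<forall>k\<in>A. 0 < t k k \<and> (\<forall>j<k. t k j = 0)" and
    t2: "\<forall>i\<in>A. \<forall>j. S $ i $ j - (\<Sum>k\<in>A. t k i * t k j) = 0" and
    t3: "\<forall>v. (\<forall>i\<in>A. v i = 0) \<and> (\<exists>i. v i \<noteq> 0) \<longrightarrow>
        0 < (\<Sum>i\<in>UNIV. \<Sum>j\<in>UNIV. v i * (S $ i $ j - (\<Sum>k\<in>A. t k i * t k j)) * v j)"
    by blast
  have t: "\<And>k. k \<in> A \<Longrightarrow> 0 < t k k" "\<And>k j. k \<in> A \<Longrightarrow> j < k \<Longrightarrow> t k j = 0"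
    using t1 by auto
  have t0: "\<And>i j. i \<in> A \<Longrightarrow> S $ i $ j - (\<Sum>k\<in>A. t k i * t k j) = 0" using t2 by blast
  have tp: "\<And>v i. (\<forall>i\<in>A. v i = 0) \<Longrightarrow> v i \<noteq> 0 \<Longrightarrow>
        0 < (\<Sum>i\<in>UNIV. \<Sum>j\<in>UNIV. v i * (S $ i $ j - (\<Sum>k\<in>A. t k i * t k j)) * v j)"
    using t3 by blast
  define R where "R i j = S $ i $ j - (\<Sum>k\<in>A. t k i * t k j)" for i j
  have R0: "R i j = 0" if "i \<in> A" for i j using t0 that by (simp add: R_def)
  have Rp: "0 < (\<Sum>i\<in>UNIV. \<Sum>j\<in>UNIV. v i * R i j * v j)" if "\<forall>i\<in>A. v i = 0" "v i \<noteq> 0" for v i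
    unfolding R_def by (rule tp[OF that])
  have "S $ i $ j = S $ j $ i" for i j
    using S unfolding positive_definite_def transpose_def by (metis vec_lambda_beta)
  then have sym: "R i j = R j i" for i j by (simp add: R_def mult.commute)
  have bA: "b \<notin> A" using insert.hyps by auto
  have r: "0 < R b b"
    using Rp[of "\<lambda>i. of_bool (i = b)" b] bA quadratic_form_shift[of R "\<lambda>_. 0" "-1" b] sym by auto
  define t' where "t' = t(b := \<lambda>i. R i b / sqrt (R b b))"
  have R': "S $ i $ j - (\<Sum>k\<in>insert b A. t' k i * t' k j) = R i j - R i b * R j b / R b b" for i j
  proof -
    have "(\<Sum>k\<in>A. t' k i * t' k j) = (\<Sum>k\<in>A. t k i * t k j)"
      using bA by (intro sum.cong) (auto simp: t'_def)
    then show ?thesis using bA insert.hyps(1) r by (simp add: R_def[of i j] t'_def field_simps)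
  qed
  show ?case
  proof (intro exI[of _ t'] conjI ballI allI impI; (unfold R')?)
    fix k assume k: "k \<in> insert b A"
    have "0 < R b b / sqrt (R b b)" using r by simp
    then show "0 < t' k k" using k t by (auto simp: t'_def)
    fix j assume "j < k"
    then show "t' k j = 0" using k t below R0 by (auto simp: t'_def)
  next
    fix i j assume "i \<in> insert b A"
    then show "R i j - R i b * R j b / R b b = 0" using R0[of i j] R0[of i b] r sym[of b j] by (cases "i = b") auto
  next
    fix v :: "'p \<Rightarrow> real" assume v: "(\<forall>i\<in>insert b A. v i = 0) \<and> (\<exists>i. v i \<noteq> 0)"
    then obtain l where l: "v l \<noteq> 0" "l \<noteq> b" by auto
    define s where "s = (\<Sum>i\<in>UNIV. v i * R i b) / R b b"
    have "0 < (\<Sum>i\<in>UNIV. \<Sum>j\<in>UNIV. (v i - s * of_bool (i = b)) * R i j * (v j - s * of_bool (j = b)))"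
      using v l bA by (intro Rp[of _ l]) auto
    also have "\<dots> = (\<Sum>i\<in>UNIV. \<Sum>j\<in>UNIV. v i * R i j * v j) - s\<^sup>2 * R b b"
      unfolding quadratic_form_shift[OF sym] using r by (simp add: s_def power2_eq_square)
    also have "s\<^sup>2 * R b b = (\<Sum>i\<in>UNIV. \<Sum>j\<in>UNIV. v i * (R i b * R j b / R b b) * v j)"
    proof -
      have "s\<^sup>2 * R b b = (\<Sum>i\<in>UNIV. v i * R i b) * (\<Sum>j\<in>UNIV. v j * R j b) / R b b"
        using r by (simp add: s_def power2_eq_square)
      also have "\<dots> = (\<Sum>i\<in>UNIV. \<Sum>j\<in>UNIV. v i * (R i b * R j b / R b b) * v j)"
        unfolding sum_product sum_divide_distrib by (intro sum.cong refl) (simp add: algebra_simps)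
      finally show ?thesis .
    qed
    finally show "0 < (\<Sum>i\<in>UNIV. \<Sum>j\<in>UNIV. v i * (R i j - R i b * R j b / R b b) * v j)"
      by (simp add: algebra_simps sum_subtractf)
  qed
qed

lemma LTp_root_exists:
  fixes S :: "real^'p::{finite,linorder}^'p::{finite,linorder}"
  assumes "positive_definite S"
  shows "\<exists>T\<in>LTp. S = T ** transpose T"
proof -
  obtain t :: "'p \<Rightarrow> 'p \<Rightarrow> real" where t: "\<And>k. 0 < t k k" "\<And>k j. j < k \<Longrightarrow> t k j = 0"
    "\<And>i j. S $ i $ j - (\<Sum>k\<in>UNIV. t k i * t k j) = 0"
    using cholesky_columns[OF assms, of UNIV] by auto
  have "(\<chi> i k. t k i) \<in> LTp" using t by (simp add: LTp_def)
  moreover have "S = (\<chi> i k. t k i) ** transpose (\<chi> i k. t k i)"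
    using t(3) by (simp add: vec_eq_iff matrix_matrix_mult_def transpose_def)
  ultimately show ?thesis by blast
qed

lemma cholesky_mult_transpose: "T \<in> LTp \<Longrightarrow> cholesky (T ** transpose T) = T"
  unfolding cholesky_def by (rule the_equality) (auto intro: LTp_root_unique)

lemma cholesky:
  assumes "positive_definite S"
  shows "cholesky S \<in> LTp" "cholesky S ** transpose (cholesky S) = S"
proof -
  obtain T where T: "T \<in> LTp" "S = T ** transpose T" using LTp_root_exists[OF assms] by blast
  then show "cholesky S \<in> LTp" "cholesky S ** transpose (cholesky S) = S"
    using cholesky_mult_transpose by metis+
qed

text \<open>
  By induction on the columns, using the recursion formulas for the entries of the root.
\<close>

lemma borel_measurable_cholesky:
  fixes S :: "'x \<Rightarrow> real^'p::{finite,linorder}^'p::{finite,linorder}"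
  assumes [measurable]: "S \<in> borel_measurable M" "Measurable.pred M (\<lambda>x. positive_definite (S x))"
  shows "(\<lambda>x. cholesky (S x)) \<in> borel_measurable M"
proof -
  let ?c = "\<lambda>j k x. if positive_definite (S x) then cholesky (S x) $ j $ k else 0"
  have col: "\<forall>j. ?c j k \<in> borel_measurable M" for k
  proof (induction k rule: less_induct_fin)
    case (less k)
    then have [measurable]: "?c j i \<in> borel_measurable M" if "i < k" for i j using that by blast
    have "?c k k = (\<lambda>x. if positive_definite (S x) then
        sqrt (S x $ k $ k - (\<Sum>i | i < k. (?c k i x)\<^sup>2)) else 0)"
      using mult_transpose_LTp_diag[OF cholesky(1), of _ k] by (auto simp: cholesky(2))
    also have "\<dots> \<in> borel_measurable M" by measurable
    finally have [measurable]: "?c k k \<in> borel_measurable M" .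
    show ?case
    proof
      fix j
      have "?c j k = (\<lambda>x. if positive_definite (S x) then
          (S x $ j $ k - (\<Sum>i | i < k. ?c j i x * ?c k i x)) / ?c k k x else 0)"
        using mult_transpose_LTp_offdiag[OF cholesky(1), of _ j k] by (auto simp: cholesky(2))
      also have "\<dots> \<in> borel_measurable M" by measurable
      finally show "?c j k \<in> borel_measurable M" .
    qed
  qed
  \<comment> \<open>Without a root the description operator returns one fixed value.\<close>
  have "cholesky (S x) = (THE T. False)" if "\<not> positive_definite (S x)" for x
    unfolding cholesky_def using that positive_definite_mult_transpose[OF LTp_invertible] by metis
  then have "(\<lambda>x. cholesky (S x)) =
      (\<lambda>x. if positive_definite (S x) then (\<chi> j k. ?c j k x) else (THE T. False))"
    by (auto simp: vec_eq_iff)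
  also have "\<dots> \<in> borel_measurable M"
  proof -
    have [measurable]: "?c j k \<in> borel_measurable M" for j k using col by blast
    show ?thesis by measurable
  qed
  finally show ?thesis .
qed

section \<open>Sample moments and standardized observations\<close>

lemma inner_matrix_vector_transpose:
  fixes A :: "real^'n^'m"
  shows "v \<bullet> (A *v w) = (transpose A *v v) \<bullet> w"
  by (simp add: dot_lmul_matrix[symmetric] vector_transpose_matrix)

lemma norm_orthogonal_matrix:
  fixes Q :: "real^'n^'n"
  assumes "transpose Q ** Q = mat 1"
  shows "norm (Q *v v) = norm v"
proof -
  have "(Q *v v) \<bullet> (Q *v v) = v \<bullet> v"
    by (simp add: inner_matrix_vector_transpose matrix_vector_mul_assoc assms)
  then show ?thesis by (simp add: norm_eq_sqrt_inner)
qed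

lemma borel_measurable_sample_mean [measurable (raw)]:
  fixes X :: "'x \<Rightarrow> 'n::finite \<Rightarrow> real^'p"
  assumes [measurable]: "\<And>i. (\<lambda>x. X x i) \<in> borel_measurable M"
  shows "(\<lambda>x. sample_mean (X x)) \<in> borel_measurable M"
  unfolding sample_mean_def by measurable

lemma borel_measurable_sample_cov [measurable (raw)]:
  fixes X :: "'x \<Rightarrow> 'n::finite \<Rightarrow> real^'p"
  assumes [measurable]: "\<And>i. (\<lambda>x. X x i) \<in> borel_measurable M"
  shows "(\<lambda>x. sample_cov (X x)) \<in> borel_measurable M"
  unfolding sample_cov_def by measurable

lemma sample_mean_affine:
  "sample_mean (\<lambda>i::'n::finite. a + B *v x i) = a + B *v sample_mean x"
  by (simp add: sample_mean_def sum.distrib scaleR_right_distrib matrix_vector_mult_scaleR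
      linear_sum[OF matrix_vector_mul_linear] sum_constant_scaleR del: sum_constant)

lemma sample_cov_mult:
  fixes x :: "'n::finite \<Rightarrow> real^'p"
  shows "sample_cov x *v v =
    (1 / CARD('n)) *\<^sub>R (\<Sum>i\<in>UNIV. ((x i - sample_mean x) \<bullet> v) *\<^sub>R (x i - sample_mean x))"
proof -
  define d where "d i = x i - sample_mean x" for i
  have "(sample_cov x *v v) $ j = (1 / CARD('n)) * (\<Sum>i\<in>UNIV. (d i \<bullet> v) * d i $ j)" for j
  proof -
    have "(sample_cov x *v v) $ j = (\<Sum>k\<in>UNIV. \<Sum>i\<in>UNIV. (1 / CARD('n)) * (d i $ j * d i $ k * v $ k))"
      by (simp add: sample_cov_def matrix_vector_mult_def d_def sum_distrib_left sum_distrib_right mult.assoc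
          sum_divide_distrib)
    also have "\<dots> = (\<Sum>i\<in>UNIV. \<Sum>k\<in>UNIV. (1 / CARD('n)) * (d i $ j * d i $ k * v $ k))"
      by (rule sum.swap)
    also have "\<dots> = (1 / CARD('n)) * (\<Sum>i\<in>UNIV. (d i \<bullet> v) * d i $ j)"
      unfolding inner_vec_def sum_distrib_left sum_distrib_right by (intro sum.cong refl) simp
    finally show ?thesis .
  qed
  then show ?thesis by (simp add: vec_eq_iff d_def)
qed

lemma quadratic_form_sample_cov:
  fixes x :: "'n::finite \<Rightarrow> real^'p"
  shows "w \<bullet> (sample_cov x *v v) =
    (1 / CARD('n)) * (\<Sum>i\<in>UNIV. ((x i - sample_mean x) \<bullet> v) * ((x i - sample_mean x) \<bullet> w))"
  by (simp add: sample_cov_mult inner_sum_right inner_commute)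

lemma matrix_eq_bilinear:
  fixes A B :: "real^'n^'m"
  assumes "\<And>v w. w \<bullet> (A *v v) = w \<bullet> (B *v v)"
  shows "A = B"
  using assms by (simp add: matrix_eq vector_eq_rdot)
    (metis inner_commute vector_eq_rdot)

lemma sample_cov_affine:
  fixes x :: "'n::finite \<Rightarrow> real^'p" and B :: "real^'p^'p"
  shows "sample_cov (\<lambda>i. a + B *v x i) = B ** sample_cov x ** transpose B"
proof (rule matrix_eq_bilinear)
  fix v w :: "real^'p"
  have d: "a + B *v x i - sample_mean (\<lambda>i. a + B *v x i) = B *v (x i - sample_mean x)" for i
    by (simp add: sample_mean_affine matrix_vector_mult_diff_distrib)
  have "w \<bullet> (sample_cov (\<lambda>i. a + B *v x i) *v v) =
      (1 / CARD('n)) * (\<Sum>i\<in>UNIV. ((x i - sample_mean x) \<bullet> (transpose B *v v)) * ((x i - sample_mean x) \<bullet> (transpose B *v w)))"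
    unfolding quadratic_form_sample_cov d
    by (simp add: inner_matrix_vector_transpose inner_commute)
  also have "\<dots> = (transpose B *v w) \<bullet> (sample_cov x *v (transpose B *v v))"
    by (simp add: quadratic_form_sample_cov)
  also have "\<dots> = w \<bullet> (B ** sample_cov x ** transpose B *v v)"
    by (simp add: inner_matrix_vector_transpose[of w] matrix_vector_mul_assoc[symmetric])
  finally show "w \<bullet> (sample_cov (\<lambda>i. a + B *v x i) *v v) = w \<bullet> (B ** sample_cov x ** transpose B *v v)" .
qed

text \<open>
  The quadratic form of a sample covariance matrix is a sum of squares.
\<close>

lemma positive_definite_sample_cov_iff:
  fixes x :: "'n::finite \<Rightarrow> real^'p"
  shows "positive_definite (sample_cov x) \<longleftrightarrow> det (sample_cov x) \<noteq> 0"
proof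
  assume pd: "positive_definite (sample_cov x)"
  have "v = 0" if "sample_cov x *v v = 0" for v
    using pd that unfolding positive_definite_def by (metis inner_zero_right less_irrefl)
  then show "det (sample_cov x) \<noteq> 0"
    by (metis invertible_det_nz invertible_left_inverse matrix_left_invertible_ker)
next
  assume nz: "det (sample_cov x) \<noteq> 0"
  show "positive_definite (sample_cov x)"
    unfolding positive_definite_def
  proof (intro conjI allI impI)
    show "transpose (sample_cov x) = sample_cov x"
      by (simp add: transpose_def sample_cov_def vec_eq_iff mult.commute)
    fix v :: "real^'p" assume v: "v \<noteq> 0"
    let ?d = "\<lambda>i. (x i - sample_mean x) \<bullet> v"
    have q: "v \<bullet> (sample_cov x *v v) = (1 / CARD('n)) * (\<Sum>i\<in>UNIV. (?d i)\<^sup>2)"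
      by (simp add: quadratic_form_sample_cov power2_eq_square)
    have "(\<Sum>i\<in>UNIV. (?d i)\<^sup>2) \<noteq> 0"
    proof
      assume "(\<Sum>i\<in>UNIV. (?d i)\<^sup>2) = 0"
      then have "?d i = 0" for i by (simp add: sum_nonneg_eq_0_iff)
      then have "sample_cov x *v v = 0" by (simp add: sample_cov_mult)
      then show False using v nz
        by (metis invertible_det_nz invertible_left_inverse matrix_left_invertible_ker)
    qed
    then have "0 < (\<Sum>i\<in>UNIV. (?d i)\<^sup>2)" by (simp add: order_less_le sum_nonneg)
    then show "0 < v \<bullet> (sample_cov x *v v)" unfolding q by (simp add: zero_less_divide_iff)
  qed
qed

lemma positive_definite_sample_cov_affine:
  fixes x :: "'n::finite \<Rightarrow> real^'p" and B :: "real^'p^'p"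
  assumes "invertible B"
  shows "positive_definite (sample_cov (\<lambda>i. a + B *v x i)) \<longleftrightarrow> positive_definite (sample_cov x)"
  unfolding positive_definite_sample_cov_iff unfolding sample_cov_affine
  using assms by (simp add: det_mul invertible_det_nz)

abbreviation sample_root :: "('n::finite \<Rightarrow> real^'p::{finite,linorder}) \<Rightarrow> real^'p::{finite,linorder}^'p::{finite,linorder}" where
  "sample_root x \<equiv> cholesky (sample_cov x)"

lemma borel_measurable_sample_root [measurable (raw)]:
  fixes X :: "'x \<Rightarrow> 'n::finite \<Rightarrow> real^'p::{finite,linorder}"
  assumes [measurable]: "\<And>i. (\<lambda>x. X x i) \<in> borel_measurable M"
  shows "(\<lambda>x. sample_root (X x)) \<in> borel_measurable M"
  by (rule borel_measurable_cholesky) (simp_all add: positive_definite_sample_cov_iff)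

lemma borel_measurable_standardized [measurable (raw)]:
  fixes X :: "'x \<Rightarrow> 'n::finite \<Rightarrow> real^'p::{finite,linorder}"
  assumes [measurable]: "\<And>i. (\<lambda>x. X x i) \<in> borel_measurable M"
  shows "(\<lambda>x. standardized (X x) i) \<in> borel_measurable M"
  unfolding standardized_def by measurable

lemma standardized_eq:
  assumes "positive_definite (sample_cov x)"
  shows "x i = sample_mean x + sample_root x *v standardized x i"
  using cholesky(1)[OF assms]
  by (simp add: standardized_def matrix_vector_mul_assoc matrix_inv_mult LTp_invertible)

text \<open>
  By uniqueness of the Cholesky root, \<open>T\<close> times the root of the sample is the root of the transformed sample.
\<close>

lemma standardized_affine_LTp:
  fixes x :: "'n::finite \<Rightarrow> real^'p::{finite,linorder}"
  assumes "T \<in> LTp" "positive_definite (sample_cov x)"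
  shows "standardized (\<lambda>i. a + T *v x i) = standardized x"
    and "sample_root (\<lambda>i. a + T *v x i) = T ** sample_root x"
proof -
  let ?U = "sample_root x"
  have U: "?U \<in> LTp" "?U ** transpose ?U = sample_cov x" using cholesky[OF assms(2)] by auto
  have "sample_cov (\<lambda>i. a + T *v x i) = T ** (?U ** transpose ?U) ** transpose T"
    by (simp only: sample_cov_affine U(2))
  also have "\<dots> = (T ** ?U) ** transpose (T ** ?U)"
    by (simp add: matrix_transpose_mul matrix_mul_assoc)
  finally show root: "sample_root (\<lambda>i. a + T *v x i) = T ** ?U"
    by (simp add: cholesky_mult_transpose LTp_mult assms U)
  have "matrix_inv (T ** ?U) ** T = matrix_inv ?U ** (matrix_inv T ** T)"
    by (simp add: matrix_inv_mult_distrib LTp_invertible assms U matrix_mul_assoc)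
  then have "matrix_inv (T ** ?U) ** T = matrix_inv ?U"
    by (simp add: matrix_inv_mult LTp_invertible assms)
  then show "standardized (\<lambda>i. a + T *v x i) = standardized x"
    by (intro ext) (simp add: standardized_def root sample_mean_affine matrix_vector_mul_assoc
        matrix_vector_mult_diff_distrib[symmetric])
qed

definition std_sample :: "('n::finite \<Rightarrow> real^'p) \<Rightarrow> bool" where
  "std_sample z \<longleftrightarrow> sample_mean z = 0 \<and> sample_cov z = mat 1"

lemma std_sample_standardized:
  fixes x :: "'n::finite \<Rightarrow> real^'p::{finite,linorder}"
  assumes "positive_definite (sample_cov x)"
  shows "std_sample (standardized x)"
proof -
  let ?T = "sample_root x"
  let ?U = "matrix_inv ?T"
  have T: "invertible ?T" "?T ** transpose ?T = sample_cov x"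
    using cholesky[OF assms] LTp_invertible by auto
  have z: "standardized x = (\<lambda>i. - (?U *v sample_mean x) + ?U *v x i)"
    by (intro ext) (simp add: standardized_def matrix_vector_mult_diff_distrib)
  have "?U ** (?T ** transpose ?T) ** transpose ?U = (?U ** ?T) ** transpose (?U ** ?T)"
    by (simp add: matrix_transpose_mul matrix_mul_assoc)
  then have "?U ** sample_cov x ** transpose ?U = mat 1"
    by (simp add: T matrix_inv_mult transpose_mat)
  then show ?thesis
    unfolding std_sample_def z sample_mean_affine sample_cov_affine by simp
qed

lemma std_sample_sum: "std_sample z \<Longrightarrow> (\<Sum>i\<in>UNIV. z i) = 0"
  by (simp add: std_sample_def sample_mean_def)

lemma std_sample_inner:
  fixes z :: "'n::finite \<Rightarrow> real^'p"
  assumes "std_sample z"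
  shows "(\<Sum>i\<in>UNIV. (z i \<bullet> v) * (z i \<bullet> w)) = CARD('n) * (v \<bullet> w)"
  using quadratic_form_sample_cov[of w z v] assms by (simp add: std_sample_def inner_commute)

text \<open>
  This bound is the reason why \<open>g_sup\<close> need only take into account points \<open>z\<close> with \<open>norm z \<le> sqrt n\<close>.
\<close>

lemma std_sample_norm_le:
  fixes z :: "'n::finite \<Rightarrow> real^'p"
  assumes "std_sample z"
  shows "norm (z i) \<le> sqrt CARD('n)"
proof (cases "z i = 0")
  case False
  have "(z i \<bullet> z i)\<^sup>2 \<le> (\<Sum>j\<in>UNIV. (z j \<bullet> z i)\<^sup>2)"
    by (rule member_le_sum[of i UNIV "\<lambda>j. (z j \<bullet> z i)\<^sup>2"]) auto
  also have "\<dots> = CARD('n) * (z i \<bullet> z i)"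
    using std_sample_inner[OF assms, of "z i" "z i"] by (simp add: power2_eq_square)
  finally have "z i \<bullet> z i \<le> CARD('n)"
    using False by (simp add: power2_eq_square)
  then show ?thesis by (simp add: norm_eq_sqrt_inner)
qed simp

lemma trace_transpose_mult:
  fixes B :: "real^'p^'p"
  shows "trace (transpose B ** B) = (\<Sum>j\<in>UNIV. \<Sum>k\<in>UNIV. (B $ j $ k)\<^sup>2)"
proof -
  have "trace (transpose B ** B) = (\<Sum>k\<in>UNIV. \<Sum>j\<in>UNIV. (B $ j $ k)\<^sup>2)"
    by (simp add: trace_def matrix_matrix_mult_def transpose_def power2_eq_square)
  also have "\<dots> = (\<Sum>j\<in>UNIV. \<Sum>k\<in>UNIV. (B $ j $ k)\<^sup>2)" by (rule sum.swap)
  finally show ?thesis .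
qed

lemma std_sample_sum_norm_mult:
  fixes z :: "'n::finite \<Rightarrow> real^'p" and B :: "real^'p^'p"
  assumes "std_sample z"
  shows "(\<Sum>i\<in>UNIV. (norm (B *v z i))\<^sup>2) = CARD('n) * trace (transpose B ** B)"
proof -
  have "(\<Sum>i\<in>UNIV. (norm (B *v z i))\<^sup>2) = (\<Sum>i\<in>UNIV. \<Sum>j\<in>UNIV. (z i \<bullet> B $ j) * (z i \<bullet> B $ j))"
    unfolding power2_norm_eq_inner
    by (intro sum.cong refl) (simp add: inner_vec_def[of "B *v _"] matrix_vector_mul_component inner_commute)
  also have "\<dots> = (\<Sum>j\<in>UNIV. \<Sum>i\<in>UNIV. (z i \<bullet> B $ j) * (z i \<bullet> B $ j))" by (rule sum.swap)
  also have "\<dots> = CARD('n) * (\<Sum>j\<in>UNIV. B $ j \<bullet> B $ j)"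
    by (simp add: std_sample_inner[OF assms] sum_distrib_left)
  also have "(\<Sum>j\<in>UNIV. B $ j \<bullet> B $ j) = trace (transpose B ** B)"
    by (simp add: trace_transpose_mult inner_vec_def power2_eq_square)
  finally show ?thesis .
qed

lemma std_sample_sum_norm_affine:
  fixes z :: "'n::finite \<Rightarrow> real^'p" and B :: "real^'p^'p"
  assumes "std_sample z"
  shows "(\<Sum>i\<in>UNIV. (norm (a + B *v z i))\<^sup>2) =
    CARD('n) * (norm a)\<^sup>2 + CARD('n) * trace (transpose B ** B)"
proof -
  have "(norm (a + B *v z i))\<^sup>2 = (norm a)\<^sup>2 + 2 * ((transpose B *v a) \<bullet> z i) + (norm (B *v z i))\<^sup>2" for i
    by (simp add: power2_norm_eq_inner inner_add inner_commute[of "B *v z i" a]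
        inner_matrix_vector_transpose[of a B])
  then have "(\<Sum>i\<in>UNIV. (norm (a + B *v z i))\<^sup>2) = CARD('n) * (norm a)\<^sup>2
      + 2 * ((transpose B *v a) \<bullet> (\<Sum>i\<in>UNIV. z i)) + (\<Sum>i\<in>UNIV. (norm (B *v z i))\<^sup>2)"
    by (simp add: sum.distrib sum_distrib_left inner_sum_right)
  then show ?thesis by (simp add: std_sample_sum[OF assms] std_sample_sum_norm_mult[OF assms])
qed

text \<open>
  The standardized samples before and after the transformation differ by an orthogonal matrix.
\<close>

lemma norm_standardized_affine:
  fixes x :: "'n::finite \<Rightarrow> real^'p::{finite,linorder}"
    and B :: "real^'p::{finite,linorder}^'p::{finite,linorder}"
  assumes B: "invertible B" and pd: "positive_definite (sample_cov x)"
  shows "norm (standardized (\<lambda>i. a + B *v x i) i) = norm (standardized x i)"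
proof -
  let ?x' = "\<lambda>i. a + B *v x i"
  have pd': "positive_definite (sample_cov ?x')"
    using positive_definite_sample_cov_affine[OF B] pd by blast
  define T T' where "T = sample_root x" and "T' = sample_root ?x'"
  have T: "invertible T" "T ** transpose T = sample_cov x"
    using cholesky[OF pd] LTp_invertible by (auto simp: T_def)
  have T': "invertible T'" "T' ** transpose T' = sample_cov ?x'"
    using cholesky[OF pd'] LTp_invertible by (auto simp: T'_def)
  define Q where "Q = matrix_inv T' ** B ** T"
  have "Q ** transpose Q = matrix_inv T' ** (B ** (T ** transpose T) ** transpose B) ** transpose (matrix_inv T')"
    by (simp add: Q_def matrix_transpose_mul matrix_mul_assoc)
  also have "\<dots> = matrix_inv T' ** (T' ** transpose T') ** transpose (matrix_inv T')"
    by (simp add: T T' sample_cov_affine)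
  also have "\<dots> = (matrix_inv T' ** T') ** transpose (matrix_inv T' ** T')"
    by (simp add: matrix_transpose_mul matrix_mul_assoc)
  also have "\<dots> = mat 1" by (simp add: matrix_inv_mult T' transpose_mat)
  finally have "transpose Q ** Q = mat 1" using matrix_left_right_inverse by blast
  moreover have "standardized ?x' i = Q *v standardized x i"
  proof -
    have "?x' i - sample_mean ?x' = B *v (x i - sample_mean x)"
      by (simp add: sample_mean_affine matrix_vector_mult_diff_distrib)
    also have "x i - sample_mean x = T *v standardized x i"
      using standardized_eq[OF pd, of i] by (simp add: T_def)
    finally show ?thesis
      by (simp add: standardized_def[of ?x'] Q_def T'_def[symmetric] matrix_vector_mul_assoc matrix_mul_assoc)
  qed
  ultimately show ?thesis by (simp add: norm_orthogonal_matrix)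
qed

section \<open>Changes of variables for Lebesgue measure\<close>

interpretation lborel_prod: product_sigma_finite "\<lambda>_. lborel :: 'a::euclidean_space measure"
  by standard

lemma measurable_PiM_lborel_component:
  fixes f :: "'x \<Rightarrow> 'i \<Rightarrow> 'a::euclidean_space"
  assumes "f \<in> M \<rightarrow>\<^sub>M Pi\<^sub>M I (\<lambda>_. lborel)" "i \<in> I"
  shows "(\<lambda>x. f x i) \<in> borel_measurable M"
  using measurable_compose[OF assms(1) measurable_component_singleton[OF assms(2), of "\<lambda>_. lborel :: 'a measure"]]
  by simp

lemmas measurable_PiM_lborel_components [measurable (raw)] =
  measurable_PiM_lborel_component[where f="\<lambda>x. x"]
  measurable_PiM_lborel_component[where f="\<lambda>x. fst (g x)" for g]
  measurable_PiM_lborel_component[where f="\<lambda>x. snd (g x)" for g]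

text \<open>
  A map that rescales each coordinate and shifts it by a function of the coordinates of smaller
  rank changes Lebesgue measure by the product of the scaling factors.  Peeling off a coordinate of
  largest rank reduces this to an affine change of one real variable.
\<close>

lemma nn_integral_triangular:
  fixes I :: "'i set" and r :: "'i \<Rightarrow> nat" and c :: "'i \<Rightarrow> ('i \<Rightarrow> real) \<Rightarrow> real"
  assumes "finite I" "\<And>i. i \<in> I \<Longrightarrow> t i \<noteq> 0"
    and "\<And>i b b'. i \<in> I \<Longrightarrow> (\<And>j. j \<in> I \<Longrightarrow> r j < r i \<Longrightarrow> b j = b' j) \<Longrightarrow> c i b = c i b'"
    and "\<And>i. i \<in> I \<Longrightarrow> c i \<in> borel_measurable (Pi\<^sub>M I (\<lambda>_. lborel))"
    and "F \<in> borel_measurable (Pi\<^sub>M I (\<lambda>_. lborel))"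
  shows "(\<integral>\<^sup>+b. F b \<partial>Pi\<^sub>M I (\<lambda>_. lborel)) =
    ennreal (\<Prod>i\<in>I. \<bar>t i\<bar>) * (\<integral>\<^sup>+b. F (\<lambda>i\<in>I. t i * b i + c i b) \<partial>Pi\<^sub>M I (\<lambda>_. lborel))"
  using assms
proof (induction I arbitrary: F rule: finite_ranking_induct[where f=r])
  case empty
  have "(\<lambda>i\<in>{}. t i * b i + c i b) = (\<lambda>i. undefined)" for b
    by (simp add: restrict_def)
  then show ?case
    by (simp only: lborel_prod.nn_integral_empty zero_le prod.empty ennreal_1 mult_1)
next
  case (insert m J)
  show ?case
  proof (cases "m \<in> J")
    case True
    then have eq: "insert m J = J" by blast
    show ?thesis unfolding eq by (rule insert.IH) (fact insert.prems[unfolded eq])+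
  next
    case m: False
    let ?PJ = "Pi\<^sub>M J (\<lambda>_. lborel) :: ('i \<Rightarrow> real) measure"
    let ?PI = "Pi\<^sub>M (insert m J) (\<lambda>_. lborel) :: ('i \<Rightarrow> real) measure"
    note [measurable] = insert.prems(4)
    have dep: "c i (b(m := y)) = c i b" if "i \<in> insert m J" for i b y
      using that insert.hyps(2) by (intro insert.prems(2)) (auto simp: not_less[symmetric])
    have cI: "c i \<in> borel_measurable ?PI" if "i \<in> insert m J" for i using that by (rule insert.prems(3))
    have upd [measurable]: "(\<lambda>b. b(m := y)) \<in> ?PJ \<rightarrow>\<^sub>M ?PI" for y
      by (rule measurable_fun_upd[where J=J]) auto
    have cJ: "c i \<in> borel_measurable ?PJ" if "i \<in> insert m J" for i
    proof -
      have "(\<lambda>b. c i (b(m := 0))) \<in> borel_measurable ?PJ"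
        using upd cI[OF that] by (rule measurable_compose)
      then show ?thesis using dep[OF that] by simp
    qed
    define T where "T b = (\<lambda>i\<in>J. t i * b i + c i b)" for b
    have T [measurable]: "T \<in> ?PJ \<rightarrow>\<^sub>M ?PJ"
      unfolding T_def using cJ by (intro measurable_restrict) auto
    define G where "G b = (\<integral>\<^sup>+y. F (b(m := y)) \<partial>lborel)" for b
    have Fup: "(\<lambda>(b, y). F (b(m := y))) \<in> borel_measurable (?PJ \<Otimes>\<^sub>M lborel)"
    proof -
      have "(\<lambda>(b, y). b(m := y)) \<in> ?PJ \<Otimes>\<^sub>M lborel \<rightarrow>\<^sub>M ?PI"
        using measurable_add_dim[of m J "\<lambda>_. lborel :: real measure"] by simp
      from measurable_compose[OF this insert.prems(4)] show ?thesis by (simp add: case_prod_beta')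
    qed
    then have G [measurable]: "G \<in> borel_measurable ?PJ"
      unfolding G_def by (rule lborel.borel_measurable_nn_integral)
    have eq: "(\<lambda>i\<in>insert m J. t i * (b(m := y)) i + c i (b(m := y))) = (T b)(m := t m * y + c m b)"
      for b y
      using m dep by (auto simp: T_def restrict_def fun_eq_iff)
    have "(\<integral>\<^sup>+b. F b \<partial>?PI) = (\<integral>\<^sup>+b. G b \<partial>?PJ)"
      unfolding G_def by (rule lborel_prod.product_nn_integral_insert[OF insert.hyps(1) m]) measurable
    also have "\<dots> = ennreal (\<Prod>i\<in>J. \<bar>t i\<bar>) * (\<integral>\<^sup>+b. G (T b) \<partial>?PJ)"
      unfolding T_def
    proof (rule insert.IH)
      fix i and b b' :: "'i \<Rightarrow> real" assume i: "i \<in> J" and b: "\<And>j. j \<in> J \<Longrightarrow> r j < r i \<Longrightarrow> b j = b' j"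
      show "c i b = c i b'"
        using i b insert.hyps(2)[OF i] by (intro insert.prems(2)) auto
    qed (use insert.prems(1) cJ G in auto)
    also have "(\<integral>\<^sup>+b. G (T b) \<partial>?PJ) =
        (\<integral>\<^sup>+b. ennreal \<bar>t m\<bar> * (\<integral>\<^sup>+y. F (\<lambda>i\<in>insert m J. t i * (b(m := y)) i + c i (b(m := y))) \<partial>lborel) \<partial>?PJ)"
    proof (rule nn_integral_cong)
      fix b assume b: "b \<in> space ?PJ"
      then have "T b \<in> space ?PJ" using T by (rule measurable_space[rotated])
      then have "(\<lambda>y. F ((T b)(m := y))) \<in> borel_measurable lborel"
        using measurable_Pair2[OF Fup] by simp
      then have "G (T b) = ennreal \<bar>t m\<bar> * (\<integral>\<^sup>+y. F ((T b)(m := c m b + t m * y)) \<partial>lborel)"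
        unfolding G_def using insert.prems(1)[of m] by (subst nn_integral_real_affine[where t="c m b" and c="t m"]) auto
      then show "G (T b) = ennreal \<bar>t m\<bar> * (\<integral>\<^sup>+y. F (\<lambda>i\<in>insert m J. t i * (b(m := y)) i + c i (b(m := y))) \<partial>lborel)"
        unfolding eq by (simp add: add.commute)
    qed
    also have "\<dots> = ennreal \<bar>t m\<bar> * (\<integral>\<^sup>+b. (\<integral>\<^sup>+y. F (\<lambda>i\<in>insert m J. t i * (b(m := y)) i + c i (b(m := y))) \<partial>lborel) \<partial>?PJ)"
    proof (rule nn_integral_cmult, rule lborel.borel_measurable_nn_integral)
      have "(\<lambda>b. (\<lambda>i\<in>insert m J. t i * b i + c i b)) \<in> ?PI \<rightarrow>\<^sub>M ?PI"
        using cI by (intro measurable_restrict) auto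
      from measurable_compose[OF measurable_compose[OF measurable_add_dim[of m J "\<lambda>_. lborel :: real measure"] this] insert.prems(4)]
      show "(\<lambda>(b, y). F (\<lambda>i\<in>insert m J. t i * (b(m := y)) i + c i (b(m := y)))) \<in> borel_measurable (?PJ \<Otimes>\<^sub>M lborel)"
        by (simp add: case_prod_beta' restrict_def)
    qed
    also have "(\<integral>\<^sup>+b. (\<integral>\<^sup>+y. F (\<lambda>i\<in>insert m J. t i * (b(m := y)) i + c i (b(m := y))) \<partial>lborel) \<partial>?PJ) =
        (\<integral>\<^sup>+b. F (\<lambda>i\<in>insert m J. t i * b i + c i b) \<partial>?PI)"
    proof (rule lborel_prod.product_nn_integral_insert[OF insert.hyps(1) m, symmetric])
      have "(\<lambda>b. (\<lambda>i\<in>insert m J. t i * b i + c i b)) \<in> ?PI \<rightarrow>\<^sub>M ?PI"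
        using cI by (intro measurable_restrict) auto
      from measurable_compose[OF this insert.prems(4)]
      show "(\<lambda>b. F (\<lambda>i\<in>insert m J. t i * b i + c i b)) \<in> borel_measurable ?PI" .
    qed
    finally show ?thesis
      using m insert.hyps(1) by (simp add: ennreal_mult'' mult_ac prod_nonneg restrict_def)
  qed
qed

lemma prod_Basis_vec:
  fixes f :: "'a::euclidean_space^'n \<Rightarrow> real"
  shows "(\<Prod>b\<in>Basis. f b) = (\<Prod>i\<in>UNIV. \<Prod>u\<in>Basis. f (axis i u))"
proof -
  let ?g = "\<lambda>(i, u). axis i u :: 'a^'n"
  have "(Basis :: ('a^'n) set) = ?g ` (UNIV \<times> Basis)"
    by (auto simp: Basis_vec_def)
  then have "(\<Prod>b\<in>Basis. f b) = prod f (?g ` (UNIV \<times> Basis))"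
    by (rule arg_cong)
  also have "\<dots> = prod (f \<circ> ?g) (UNIV \<times> Basis)"
    by (rule prod.reindex) (auto simp: inj_on_def axis_eq_axis)
  finally show ?thesis by (simp add: prod.cartesian_product comp_def case_prod_beta')
qed

lemma box_vec:
  fixes l u :: "'a::euclidean_space^'n"
  shows "x \<in> box l u \<longleftrightarrow> (\<forall>i. x $ i \<in> box (l $ i) (u $ i))"
  by (auto simp: box_def Basis_vec_def inner_axis)

lemma lborel_eq_distr_vec:
  "(lborel :: ('a::euclidean_space^'n) measure) =
     distr (Pi\<^sub>M UNIV (\<lambda>_. lborel)) borel (\<lambda>b. \<chi> i. b i)"
proof (rule lborel_eqI)
  let ?P = "Pi\<^sub>M UNIV (\<lambda>_. lborel) :: ('n \<Rightarrow> 'a) measure"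
  fix l u :: "'a^'n" assume le: "\<And>b. b \<in> Basis \<Longrightarrow> l \<bullet> b \<le> u \<bullet> b"
  have m: "(\<lambda>b. \<chi> i. b i) \<in> borel_measurable ?P" by measurable
  have "(\<lambda>b. \<chi> i. b i) -` box l u \<inter> space ?P = Pi\<^sub>E UNIV (\<lambda>i. box (l $ i) (u $ i))"
    by (auto simp: box_vec space_PiM PiE_def Pi_def)
  then have "emeasure (distr ?P borel (\<lambda>b. \<chi> i. b i)) (box l u) = (\<Prod>i\<in>UNIV. emeasure lborel (box (l $ i) (u $ i)))"
    using m by (simp add: emeasure_distr lborel_prod.emeasure_PiM)
  also have "\<dots> = (\<Prod>i\<in>UNIV. ennreal (\<Prod>b\<in>Basis. (u $ i - l $ i) \<bullet> b))"
  proof (rule prod.cong[OF refl])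
    fix i have "l $ i \<bullet> b \<le> u $ i \<bullet> b" if "b \<in> Basis" for b
      using le[of "axis i b"] that by (simp add: inner_axis Basis_vec_def) blast
    then show "emeasure lborel (box (l $ i) (u $ i)) = ennreal (\<Prod>b\<in>Basis. (u $ i - l $ i) \<bullet> b)"
      by simp
  qed
  also have "\<dots> = ennreal (\<Prod>i\<in>UNIV. \<Prod>b\<in>Basis. (u $ i - l $ i) \<bullet> b)"
    using le[of "axis _ _"] by (intro prod_ennreal prod_nonneg ballI)
      (auto simp: inner_axis Basis_vec_def inner_diff_left)
  finally show "emeasure (distr ?P borel (\<lambda>b. \<chi> i. b i)) (box l u) = ennreal (\<Prod>b\<in>Basis. (u - l) \<bullet> b)"
    by (simp add: prod_Basis_vec inner_axis)
qed simp

lemma nn_integral_lborel_vec: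
  fixes F :: "'a::euclidean_space^'n \<Rightarrow> ennreal"
  assumes [measurable]: "F \<in> borel_measurable borel"
  shows "(\<integral>\<^sup>+x. F x \<partial>lborel) = (\<integral>\<^sup>+b. F (\<chi> i. b i) \<partial>Pi\<^sub>M UNIV (\<lambda>_. lborel))"
  by (subst lborel_eq_distr_vec) (simp add: nn_integral_distr)

lemma lborel_eq_distr_matrix:
  "(lborel :: (real^'q^'p) measure) =
     distr (Pi\<^sub>M UNIV (\<lambda>_. lborel)) borel (\<lambda>b. \<chi> j k. b (j, k))"
proof (rule lborel_eqI)
  let ?P = "Pi\<^sub>M UNIV (\<lambda>_. lborel) :: ('p \<times> 'q \<Rightarrow> real) measure"
  fix l u :: "real^'q^'p" assume le: "\<And>b. b \<in> Basis \<Longrightarrow> l \<bullet> b \<le> u \<bullet> b"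
  have m: "(\<lambda>b. \<chi> j k. b (j, k)) \<in> borel_measurable ?P" by measurable
  have le': "l $ j $ k \<le> u $ j $ k" for j k
    using le[of "axis j (axis k 1)"] by (auto simp: inner_axis Basis_vec_def)
  have "(\<lambda>b. \<chi> j k. b (j, k)) -` box l u \<inter> space ?P = Pi\<^sub>E UNIV (\<lambda>(j, k). box (l $ j $ k) (u $ j $ k))"
    by (auto simp: box_vec space_PiM PiE_def Pi_def split: prod.splits)
  then have "emeasure (distr ?P borel (\<lambda>b. \<chi> j k. b (j, k))) (box l u) =
      (\<Prod>i\<in>UNIV. emeasure lborel (case i of (j, k) \<Rightarrow> box (l $ j $ k) (u $ j $ k)))"
    using m by (simp add: emeasure_distr lborel_prod.emeasure_PiM case_prod_beta')
  also have "\<dots> = (\<Prod>(j, k)\<in>UNIV. ennreal (u $ j $ k - l $ j $ k))"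
    by (rule prod.cong) (auto simp: le')
  also have "\<dots> = ennreal (\<Prod>(j, k)\<in>UNIV. u $ j $ k - l $ j $ k)"
    by (subst prod_ennreal[symmetric]) (auto simp: le' case_prod_beta')
  also have "(\<Prod>(j, k)\<in>UNIV. u $ j $ k - l $ j $ k) = (\<Prod>b\<in>Basis. (u - l) \<bullet> b)"
    by (simp add: prod_Basis_vec inner_axis prod.cartesian_product UNIV_Times_UNIV[symmetric] del: UNIV_Times_UNIV)
  finally show "emeasure (distr ?P borel (\<lambda>b. \<chi> j k. b (j, k))) (box l u) = ennreal (\<Prod>b\<in>Basis. (u - l) \<bullet> b)" .
qed simp

lemma nn_integral_lborel_translate:
  fixes F :: "'a::euclidean_space \<Rightarrow> ennreal"
  assumes [measurable]: "F \<in> borel_measurable borel"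
  shows "(\<integral>\<^sup>+x. F (a + x) \<partial>lborel) = (\<integral>\<^sup>+x. F x \<partial>lborel)"
  by (subst (2) lborel_distr_plus[of a, symmetric]) (simp add: nn_integral_distr)

text \<open>
  Elementary matrices generate all matrices; diagonal matrices and shears are triangular changes of
  variables, transpositions permute the factors of the product measure.
\<close>

lemma nn_integral_lborel_linear:
  fixes B :: "real^'p^'p" and F :: "real^'p \<Rightarrow> ennreal"
  assumes "det B \<noteq> 0" "F \<in> borel_measurable borel"
  shows "(\<integral>\<^sup>+x. F x \<partial>lborel) = ennreal \<bar>det B\<bar> * (\<integral>\<^sup>+x. F (B *v x) \<partial>lborel)"
proof -
  let ?P = "Pi\<^sub>M UNIV (\<lambda>_. lborel) :: ('p \<Rightarrow> real) measure"
  have "det B \<noteq> 0 \<longrightarrow> (\<forall>F::real^'p \<Rightarrow> ennreal. F \<in> borel_measurable borel \<longrightarrow>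
    (\<integral>\<^sup>+x. F x \<partial>lborel) = ennreal \<bar>det B\<bar> * (\<integral>\<^sup>+x. F (B *v x) \<partial>lborel))" (is "?Q B")
  proof (induction B rule: induct_matrix_elementary_alt)
    case (1 A B)
    show ?case
    proof (intro impI allI)
      fix F :: "real^'p \<Rightarrow> ennreal" assume nz: "det (A ** B) \<noteq> 0" and [measurable]: "F \<in> borel_measurable borel"
      have AB: "det A \<noteq> 0" "det B \<noteq> 0" using nz by (auto simp: det_mul)
      have "(\<integral>\<^sup>+x. F x \<partial>lborel) = ennreal \<bar>det A\<bar> * (\<integral>\<^sup>+x. F (A *v x) \<partial>lborel)"
        by (rule 1(1)[rule_format, OF AB(1)]) measurable
      also have "(\<integral>\<^sup>+x. F (A *v x) \<partial>lborel) = ennreal \<bar>det B\<bar> * (\<integral>\<^sup>+x. F (A *v (B *v x)) \<partial>lborel)"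
      proof -
        have "(\<lambda>x. F (A *v x)) \<in> borel_measurable borel" by measurable
        then show ?thesis by (rule 1(2)[rule_format, OF AB(2)])
      qed
      finally show "(\<integral>\<^sup>+x. F x \<partial>lborel) = ennreal \<bar>det (A ** B)\<bar> * (\<integral>\<^sup>+x. F (A ** B *v x) \<partial>lborel)"
        by (simp add: det_mul matrix_vector_mul_assoc abs_mult ennreal_mult' mult.assoc)
    qed
  next
    case (2 A i)
    then show ?case by (simp add: det_zero_row)
  next
    case (3 A)
    show ?case
    proof (intro impI allI)
      fix F :: "real^'p \<Rightarrow> ennreal" assume nz: "det A \<noteq> 0" and [measurable]: "F \<in> borel_measurable borel"
      have det: "det A = (\<Prod>i\<in>UNIV. A $ i $ i)" by (rule det_diagonal) (rule 3)
      have mult: "(A *v x) $ i = A $ i $ i * x $ i" for x i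
      proof -
        have "(A *v x) $ i = (\<Sum>j\<in>UNIV. if j = i then A $ i $ i * x $ i else 0)"
        proof -
          have off: "A $ i $ j = 0" if "j \<noteq> i" for j using 3 that by metis
          show ?thesis unfolding matrix_vector_mult_def
            by (simp only: vec_lambda_beta, rule sum.cong) (auto simp: off)
        qed
        then show ?thesis by simp
      qed
      have "(\<integral>\<^sup>+b. F (\<chi> i. b i) \<partial>?P) =
        ennreal (\<Prod>i\<in>UNIV. \<bar>A $ i $ i\<bar>) * (\<integral>\<^sup>+b. F (\<chi> i. (\<lambda>i\<in>UNIV. A $ i $ i * b i + 0) i) \<partial>?P)"
        using nz by (intro nn_integral_triangular[where r="\<lambda>_. 0" and c="\<lambda>_ _. 0" and t="\<lambda>i. A $ i $ i"]) (auto simp: det)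
      moreover have "(\<chi> i. A $ i $ i * b i) = A *v (\<chi> i. b i)" for b :: "'p \<Rightarrow> real"
        unfolding vec_eq_iff mult by simp
      ultimately show "(\<integral>\<^sup>+x. F x \<partial>lborel) = ennreal \<bar>det A\<bar> * (\<integral>\<^sup>+x. F (A *v x) \<partial>lborel)"
        unfolding det by (simp add: nn_integral_lborel_vec abs_prod)
    qed
  next
    case (4 m n)
    let ?s = "Transposition.transpose m n"
    let ?S = "(\<chi> i j. mat 1 $ i $ ?s j) :: real^'p^'p"
    have perm: "?s permutes UNIV" by (simp add: permutes_swap_id)
    have mult: "(?S *v x) $ i = x $ ?s i" for x i
    proof -
      have "i = ?s j \<longleftrightarrow> j = ?s i" for j by (metis transpose_involutory)
      then have "(?S *v x) $ i = (\<Sum>j\<in>UNIV. if j = ?s i then x $ j else 0)"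
        unfolding matrix_vector_mult_def by (simp only: vec_lambda_beta mat_def, intro sum.cong) auto
      then show ?thesis by simp
    qed
    have det: "\<bar>det ?S\<bar> = 1"
      by (subst det_permute_columns[OF perm]) (simp add: sign_def)
    have lb: "lborel = distr lborel borel (\<lambda>x. ?S *v x)"
    proof (rule lborel_eqI)
      fix l u :: "real^'p" assume le: "\<And>b. b \<in> Basis \<Longrightarrow> l \<bullet> b \<le> u \<bullet> b"
      have "l $ i \<le> u $ i" for i using le[of "axis i 1"] by (auto simp: inner_axis Basis_vec_def)
      then have "\<forall>b\<in>Basis. (?S *v l) \<bullet> b \<le> (?S *v u) \<bullet> b"
        unfolding Basis_vec_def by (simp add: inner_axis mult)
      moreover have "(\<lambda>x. ?S *v x) -` box l u = box (?S *v l) (?S *v u)"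
        unfolding set_eq_iff vimage_def mem_Collect_eq mem_box_cart mult
        by (metis transpose_involutory)
      ultimately have "emeasure (distr lborel borel (\<lambda>x. ?S *v x)) (box l u) = ennreal (\<Prod>i\<in>UNIV. u $ ?s i - l $ ?s i)"
        by (simp add: emeasure_distr emeasure_lborel_box_eq prod_Basis_vec inner_axis mult)
      also have "(\<Prod>i\<in>UNIV. u $ ?s i - l $ ?s i) = (\<Prod>i\<in>UNIV. u $ i - l $ i)"
        using prod.permute[OF perm, of "\<lambda>i. u $ i - l $ i"] by (simp add: comp_def)
      finally show "emeasure (distr lborel borel (\<lambda>x. ?S *v x)) (box l u) = ennreal (\<Prod>b\<in>Basis. (u - l) \<bullet> b)"
        by (simp add: prod_Basis_vec inner_axis)
    qed simp
    show ?case
    proof (intro impI allI)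
      fix F :: "real^'p \<Rightarrow> ennreal" assume [measurable]: "F \<in> borel_measurable borel"
      have "(\<integral>\<^sup>+x. F x \<partial>lborel) = (\<integral>\<^sup>+x. F x \<partial>distr lborel borel (\<lambda>x. ?S *v x))"
        using lb by simp
      also have "\<dots> = (\<integral>\<^sup>+x. F (?S *v x) \<partial>lborel)"
        by (simp add: nn_integral_distr)
      finally show "(\<integral>\<^sup>+x. F x \<partial>lborel) = ennreal \<bar>det ?S\<bar> * (\<integral>\<^sup>+x. F (?S *v x) \<partial>lborel)"
        by (simp add: det)
    qed
  next
    case (5 m n)
    let ?E = "(\<chi> i j. of_bool (i = m \<and> j = n \<or> i = j)) :: real^'p^'p"
    have "?E = (\<chi> i. if i = m then row m (mat 1) + 1 *s row n (mat 1) else row i (mat 1))"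
      using 5 by (auto simp: vec_eq_iff row_def mat_def)
    then have det: "det ?E = 1" using det_row_operation[OF 5, of "mat 1" 1] by simp
    have mult: "(?E *v x) $ i = x $ i + (if i = m then x $ n else 0)" for x i
    proof -
      have "(?E *v x) $ i = (\<Sum>j\<in>UNIV. (if j = i then x $ j else 0) + (if j = n then if i = m then x $ j else 0 else 0))"
        unfolding matrix_vector_mult_def using 5 by (simp only: vec_lambda_beta, intro sum.cong) auto
      then show ?thesis by (simp add: sum.distrib)
    qed
    show ?case
    proof (intro impI allI)
      fix F :: "real^'p \<Rightarrow> ennreal" assume [measurable]: "F \<in> borel_measurable borel"
      have "(\<integral>\<^sup>+b. F (\<chi> i. b i) \<partial>?P) =
        ennreal (\<Prod>i\<in>(UNIV::'p set). \<bar>1\<bar>) * (\<integral>\<^sup>+b. F (\<chi> i. (\<lambda>i\<in>UNIV. 1 * b i + (if i = m then b n else 0)) i) \<partial>?P)"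
        using 5 by (intro nn_integral_triangular[where r="\<lambda>i. of_bool (i = m)" and t="\<lambda>i. 1"]) auto
      moreover have "(\<chi> i. b i + (if i = m then b n else 0)) = ?E *v (\<chi> i. b i)" for b :: "'p \<Rightarrow> real"
        unfolding vec_eq_iff mult by simp
      ultimately show "(\<integral>\<^sup>+x. F x \<partial>lborel) = ennreal \<bar>det ?E\<bar> * (\<integral>\<^sup>+x. F (?E *v x) \<partial>lborel)"
        unfolding det by (simp add: nn_integral_lborel_vec)
    qed
  qed
  then show ?thesis using assms by blast
qed

lemma nn_integral_lborel_affine:
  fixes B :: "real^'p^'p" and F :: "real^'p \<Rightarrow> ennreal"
  assumes "det B \<noteq> 0" and [measurable]: "F \<in> borel_measurable borel"
  shows "(\<integral>\<^sup>+x. F x \<partial>lborel) = ennreal \<bar>det B\<bar> * (\<integral>\<^sup>+x. F (a + B *v x) \<partial>lborel)"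
proof -
  have "(\<lambda>x. F (a + x)) \<in> borel_measurable borel" by measurable
  from nn_integral_lborel_linear[OF assms(1) this] show ?thesis
    by (simp add: nn_integral_lborel_translate)
qed

abbreviation samples :: "('n::finite \<Rightarrow> real^'p) measure" where
  "samples \<equiv> Pi\<^sub>M UNIV (\<lambda>_. lborel)"

lemma measurable_samplesI [measurable (raw)]:
  fixes f :: "'x \<Rightarrow> 'n::finite \<Rightarrow> real^'p"
  assumes "\<And>i. (\<lambda>x. f x i) \<in> borel_measurable M"
  shows "(\<lambda>x i. f x i) \<in> M \<rightarrow>\<^sub>M samples"
proof -
  have "(\<lambda>x. \<lambda>i\<in>UNIV. f x i) \<in> M \<rightarrow>\<^sub>M (samples :: ('n \<Rightarrow> real^'p) measure)"
    using assms by (intro measurable_restrict) simp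
  then show ?thesis by (simp add: restrict_def)
qed

lemma nn_integral_samples_affine:
  fixes B :: "real^'p^'p" and F :: "('n::finite \<Rightarrow> real^'p) \<Rightarrow> ennreal"
  assumes B: "det B \<noteq> 0" and [measurable]: "F \<in> borel_measurable samples"
  shows "(\<integral>\<^sup>+x. F x \<partial>samples) = ennreal (\<bar>det B\<bar> ^ CARD('n)) * (\<integral>\<^sup>+x. F (\<lambda>i. a i + B *v x i) \<partial>samples)"
proof -
  let ?h = "\<lambda>x i. a i + B *v x i :: real^'p"
  let ?D = "density (distr samples samples ?h) (\<lambda>_. ennreal (\<bar>det B\<bar> ^ CARD('n)))"
  have h [measurable]: "?h \<in> samples \<rightarrow>\<^sub>M samples" by measurable
  have "?D = (samples :: ('n \<Rightarrow> real^'p) measure)"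
  proof (rule lborel_prod.PiM_eqI)
    fix A :: "'n \<Rightarrow> (real^'p) set" assume A: "\<And>i. i \<in> UNIV \<Longrightarrow> A i \<in> sets lborel"
    then have [measurable]: "A i \<in> sets borel" for i by simp
    have *: "emeasure lborel (A i) = ennreal \<bar>det B\<bar> * emeasure lborel {x. a i + B *v x \<in> A i}" for i
    proof -
      have "(\<integral>\<^sup>+x. indicator (A i) x \<partial>lborel) = ennreal \<bar>det B\<bar> * (\<integral>\<^sup>+x. indicator (A i) (a i + B *v x) \<partial>lborel)"
        by (rule nn_integral_lborel_affine[OF B]) measurable
      also have "(\<integral>\<^sup>+x. indicator (A i) (a i + B *v x) \<partial>lborel) = (\<integral>\<^sup>+x. indicator {x. a i + B *v x \<in> A i} x \<partial>lborel)"
        by (simp add: indicator_def)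
      finally show ?thesis by simp
    qed
    have PA: "Pi\<^sub>E UNIV A \<in> sets samples" using A by (intro sets_PiM_I_finite) auto
    have "emeasure ?D (Pi\<^sub>E UNIV A) = ennreal (\<bar>det B\<bar> ^ CARD('n)) * emeasure (distr samples samples ?h) (Pi\<^sub>E UNIV A)"
      using PA by (subst emeasure_density_const) auto
    also have "emeasure (distr samples samples ?h) (Pi\<^sub>E UNIV A) = emeasure samples (Pi\<^sub>E UNIV (\<lambda>i. {x. a i + B *v x \<in> A i}))"
      using PA by (subst emeasure_distr) (auto simp: space_PiM intro!: arg_cong[where f="emeasure _"])
    also have "\<dots> = (\<Prod>i\<in>UNIV. emeasure lborel {x. a i + B *v x \<in> A i})"
      by (rule lborel_prod.emeasure_PiM) simp_all
    finally show "emeasure ?D (Pi\<^sub>E UNIV A) = (\<Prod>i\<in>UNIV. emeasure lborel (A i))"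
      by (simp add: * prod.distrib ennreal_power[symmetric])
  qed simp_all
  then have "(\<integral>\<^sup>+x. F x \<partial>samples) = (\<integral>\<^sup>+x. F x \<partial>?D)" by simp
  then show ?thesis by (simp add: nn_integral_density nn_integral_distr nn_integral_cmult)
qed

section \<open>Almost every sample has a positive definite covariance matrix\<close>

lemma positive_definite_sample_exists:
  assumes "CARD('p::finite) < CARD('n::finite)"
  shows "\<exists>y :: 'n \<Rightarrow> real^'p. det (sample_cov y) \<noteq> 0"
proof -
  obtain e :: "'p \<Rightarrow> 'n" where e: "inj e"
    using card_le_inj[of "UNIV :: 'p set" "UNIV :: 'n set"] assms by auto
  have "card (range e) < CARD('n)" using assms by (simp add: card_image e)
  then obtain i0 where i0: "i0 \<notin> range e" by (metis UNIV_I less_irrefl subsetI subset_antisym)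
  define y :: "'n \<Rightarrow> real^'p" where "y i = (if i \<in> range e then axis (inv e i) 1 else 0)" for i
  have "v = 0" if "sample_cov y *v v = 0" for v
  proof -
    have "(1 / CARD('n)) * (\<Sum>i\<in>UNIV. ((y i - sample_mean y) \<bullet> v)\<^sup>2) = v \<bullet> (sample_cov y *v v)"
      by (simp add: quadratic_form_sample_cov power2_eq_square)
    then have "(\<Sum>i\<in>UNIV. ((y i - sample_mean y) \<bullet> v)\<^sup>2) = 0" by (simp add: that)
    then have 0: "y i \<bullet> v = sample_mean y \<bullet> v" for i
      by (simp add: sum_nonneg_eq_0_iff inner_diff_left)
    have "y i0 \<bullet> v = 0" using i0 by (simp add: y_def)
    then have "y (e j) \<bullet> v = 0" for j using 0 by metis
    moreover have "y (e j) = axis j 1" for j using e by (simp add: y_def)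
    ultimately show "v = 0" by (simp add: vec_eq_iff inner_axis')
  qed
  then show ?thesis
    by (metis invertible_det_nz invertible_left_inverse matrix_left_invertible_ker)
qed

lemma sample_cov_translate:
  fixes x y :: "'n::finite \<Rightarrow> real^'p"
  shows "sample_cov (\<lambda>i. x i + s *\<^sub>R y i) $ j $ k = sample_cov x $ j $ k
    + s * ((1 / CARD('n)) * (\<Sum>i\<in>UNIV. (x i - sample_mean x) $ j * (y i - sample_mean y) $ k
         + (y i - sample_mean y) $ j * (x i - sample_mean x) $ k)) + s\<^sup>2 * sample_cov y $ j $ k"
proof -
  have "sample_mean (\<lambda>i. x i + s *\<^sub>R y i) = sample_mean x + s *\<^sub>R sample_mean y"
    by (simp add: sample_mean_def sum.distrib scaleR_right_distrib scaleR_sum_right[symmetric])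
  then have d: "x i + s *\<^sub>R y i - sample_mean (\<lambda>i. x i + s *\<^sub>R y i) =
      (x i - sample_mean x) + s *\<^sub>R (y i - sample_mean y)" for i
    by (simp add: algebra_simps)
  have expand: "(\<Sum>i\<in>UNIV. (X i + s * Y i) * (X' i + s * Y' i)) =
      (\<Sum>i\<in>UNIV. X i * X' i) + s * (\<Sum>i\<in>UNIV. X i * Y' i + Y i * X' i) + s\<^sup>2 * (\<Sum>i\<in>UNIV. Y i * Y' i)"
    for X X' Y Y' :: "'n \<Rightarrow> real"
    by (simp add: algebra_simps sum.distrib sum_distrib_left power2_eq_square)
  have scale: "c * (u + s * v + t * w) = c * u + s * (c * v) + t * (c * w)" for c t u v w :: real
    by (simp add: algebra_simps)
  show ?thesis
    unfolding sample_cov_def vec_lambda_beta d vector_add_component vector_scaleR_component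
      real_scaleR_def expand by (rule scale)
qed

text \<open>
  Along a line \<open>s \<mapsto> x + s y\<close> whose direction has a nonsingular covariance matrix, the determinant of
  the covariance matrix is, up to the substitution \<open>u = 1/s\<close> and a power of \<open>s\<close>, a polynomial in \<open>u\<close>
  that does not vanish at \<open>0\<close>.
\<close>

lemma finite_singular_on_line:
  fixes x y :: "'n::finite \<Rightarrow> real^'p"
  assumes y: "det (sample_cov y) \<noteq> 0"
  shows "finite {s. det (sample_cov (\<lambda>i. x i + s *\<^sub>R y i)) = 0}"
proof -
  define C where "C j k = (1 / CARD('n)) * (\<Sum>i\<in>UNIV. (x i - sample_mean x) $ j * (y i - sample_mean y) $ k
         + (y i - sample_mean y) $ j * (x i - sample_mean x) $ k)" for j k
  define q where "q = (\<Sum>p | p permutes (UNIV :: 'p set). of_int (sign p) *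
      (\<Prod>j\<in>UNIV. [: sample_cov y $ j $ p j, C j (p j), sample_cov x $ j $ p j :]))"
  have q: "poly q u = det (\<chi> j k. sample_cov y $ j $ k + u * C j k + u\<^sup>2 * sample_cov x $ j $ k)" for u
    by (simp add: q_def det_def poly_sum poly_prod power2_eq_square algebra_simps)
  have "poly q 0 = det (sample_cov y)" by (simp add: q)
  then have "q \<noteq> 0" using y by auto
  then have fin: "finite {u. poly q u = 0}" by (rule poly_roots_finite)
  have "s \<in> insert 0 (inverse ` {u. poly q u = 0})" if s: "det (sample_cov (\<lambda>i. x i + s *\<^sub>R y i)) = 0" for s
  proof (cases "s = 0")
    case False
    have "sample_cov (\<lambda>i. x i + s *\<^sub>R y i) =
      (\<chi> j. s\<^sup>2 *s (\<chi> j k. sample_cov y $ j $ k + (1/s) * C j k + (1/s)\<^sup>2 * sample_cov x $ j $ k) $ j)"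
      unfolding vec_eq_iff sample_cov_translate C_def[symmetric]
      using False by (simp add: field_simps power2_eq_square)
    then have "det (sample_cov (\<lambda>i. x i + s *\<^sub>R y i)) = (s\<^sup>2) ^ CARD('p) * poly q (1/s)"
      by (simp add: det_rows_mul q)
    then have "poly q (inverse s) = 0" using s False by (simp add: inverse_eq_divide)
    then show ?thesis by (metis (mono_tags) imageI inverse_inverse_eq insertI2 mem_Collect_eq)
  qed simp
  then have "{s. det (sample_cov (\<lambda>i. x i + s *\<^sub>R y i)) = 0} \<subseteq> insert 0 (inverse ` {u. poly q u = 0})"
    by blast
  then show ?thesis by (rule finite_subset) (simp add: fin)
qed

text \<open>
  Fubini's theorem, for lines in the direction of one sample with nonsingular covariance matrix.
\<close>

lemma AE_samples_positive_definite:
  assumes "CARD('p::finite) < CARD('n::finite)"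
  shows "AE x in (samples :: ('n \<Rightarrow> real^'p) measure). positive_definite (sample_cov x)"
proof -
  let ?S = "samples :: ('n \<Rightarrow> real^'p) measure"
  let ?N = "{x :: 'n \<Rightarrow> real^'p. det (sample_cov x) = 0}"
  obtain y :: "'n \<Rightarrow> real^'p" where y: "det (sample_cov y) \<noteq> 0"
    using positive_definite_sample_exists[OF assms] by blast
  interpret pair_sigma_finite ?S lborel
    by (intro pair_sigma_finite.intro lborel_prod.sigma_finite lborel.sigma_finite_measure_axioms) simp
  have N: "{x \<in> space ?S. det (sample_cov x) = 0} \<in> sets ?S" by measurable
  then have N' [measurable]: "?N \<in> sets ?S" by (simp add: space_PiM)
  have "emeasure ?S ?N = (\<integral>\<^sup>+x. indicator ?N x \<partial>?S)" using N' by simp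
  also have "\<dots> = (\<integral>\<^sup>+s. indicator {0..1::real} s * (\<integral>\<^sup>+x. indicator ?N x \<partial>?S) \<partial>lborel)"
    by (subst nn_integral_multc) auto
  also have "\<dots> = (\<integral>\<^sup>+s. (\<integral>\<^sup>+x. indicator {0..1::real} s * indicator ?N (\<lambda>i. x i + s *\<^sub>R y i) \<partial>?S) \<partial>lborel)"
  proof (rule nn_integral_cong)
    fix s :: real
    have m: "(\<lambda>x. indicator ?N (\<lambda>i. x i + s *\<^sub>R y i) :: ennreal) \<in> borel_measurable ?S"
      by measurable
    have "(\<integral>\<^sup>+x. indicator ?N x \<partial>?S) = (\<integral>\<^sup>+x. indicator ?N (\<lambda>i. s *\<^sub>R y i + mat 1 *v x i) \<partial>?S)"
      by (subst nn_integral_samples_affine[where B="mat 1" and a="\<lambda>i. s *\<^sub>R y i"]) auto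
    then have "(\<integral>\<^sup>+x. indicator ?N x \<partial>?S) = (\<integral>\<^sup>+x. indicator ?N (\<lambda>i. x i + s *\<^sub>R y i) \<partial>?S)"
      by (simp add: add.commute)
    then show "indicator {0..1} s * (\<integral>\<^sup>+x. indicator ?N x \<partial>?S) =
        (\<integral>\<^sup>+x. indicator {0..1} s * indicator ?N (\<lambda>i. x i + s *\<^sub>R y i) \<partial>?S)"
      using m by (simp add: nn_integral_cmult)
  qed
  also have "\<dots> = (\<integral>\<^sup>+x. (\<integral>\<^sup>+s. indicator {0..1::real} s * indicator ?N (\<lambda>i. x i + s *\<^sub>R y i) \<partial>lborel) \<partial>?S)"
    by (rule Fubini') measurable
  also have "\<dots> = (\<integral>\<^sup>+x. 0 \<partial>?S)"
  proof (rule nn_integral_cong)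
    fix x :: "'n \<Rightarrow> real^'p"
    have "AE s in lborel. s \<notin> {s. det (sample_cov (\<lambda>i. x i + s *\<^sub>R y i)) = 0}"
      using finite_singular_on_line[OF y, of x]
      by (intro AE_not_in) (auto simp: finite_imp_null_set_lborel)
    then have "(\<integral>\<^sup>+s. indicator {0..1::real} s * indicator ?N (\<lambda>i. x i + s *\<^sub>R y i) \<partial>lborel) = (\<integral>\<^sup>+(s::real). 0 \<partial>lborel)"
      by (intro nn_integral_cong_AE) (auto simp: indicator_def)
    then show "(\<integral>\<^sup>+s. indicator {0..1::real} s * indicator ?N (\<lambda>i. x i + s *\<^sub>R y i) \<partial>lborel) = 0" by simp
  qed
  finally have "?N \<in> null_sets ?S" using N' by (simp add: null_sets_def)
  from AE_not_in[OF this] show ?thesis by (simp add: positive_definite_sample_cov_iff)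
qed

section \<open>Integration over matrices with a prescribed pattern\<close>

type_synonym 'p sqmat = "((real, 'p) vec, 'p) vec"

abbreviation coords :: "'i set \<Rightarrow> ('i \<Rightarrow> real) measure" where
  "coords I \<equiv> Pi\<^sub>M I (\<lambda>_. lborel)"

definition mat_of :: "('p \<times> 'p) set \<Rightarrow> ('p::finite \<times> 'p \<Rightarrow> real) \<Rightarrow> real^'p^'p" where
  "mat_of I b = (\<chi> j k. if (j, k) \<in> I then b (j, k) else 0)"

lemma mat_of_nth: "mat_of I b $ j $ k = (if (j, k) \<in> I then b (j, k) else 0)"
  by (simp add: mat_of_def)

lemma measurable_mat_of [measurable (raw)]:
  fixes f :: "'x \<Rightarrow> 'p::finite \<times> 'p \<Rightarrow> real"
  assumes "f \<in> M \<rightarrow>\<^sub>M coords I"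
  shows "(\<lambda>x. mat_of I (f x)) \<in> borel_measurable M"
  unfolding mat_of_def
proof (intro borel_measurable_vec_lambda)
  fix j k
  show "(\<lambda>x. if (j, k) \<in> I then f x (j, k) else 0) \<in> borel_measurable M"
    by (cases "(j, k) \<in> I") (auto intro: measurable_PiM_lborel_component[OF assms])
qed

lemma nn_integral_mat_of_LTp_left:
  fixes I :: "('p::{finite,linorder} \<times> 'p) set" and F :: "'p sqmat \<Rightarrow> ennreal"
  assumes T: "T \<in> LTp" and I: "\<And>i j k. (j, k) \<notin> I \<Longrightarrow> i \<le> j \<Longrightarrow> (i, k) \<notin> I"
    and [measurable]: "F \<in> borel_measurable borel"
  shows "(\<integral>\<^sup>+b. F (mat_of I b) \<partial>coords I) =
    ennreal (\<Prod>(j, k)\<in>I. T $ j $ j) * (\<integral>\<^sup>+b. F (T ** mat_of I b) \<partial>coords I)"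
proof -
  let ?c = "\<lambda>(j, k) b. \<Sum>i | i < j. T $ j $ i * mat_of I b $ i $ k"
  have "(\<integral>\<^sup>+b. F (mat_of I b) \<partial>coords I) =
    ennreal (\<Prod>u\<in>I. \<bar>case u of (j, k) \<Rightarrow> T $ j $ j\<bar>) *
    (\<integral>\<^sup>+b. F (mat_of I (\<lambda>u\<in>I. (case u of (j, k) \<Rightarrow> T $ j $ j) * b u + ?c u b)) \<partial>coords I)"
  proof (rule nn_integral_triangular[where r="\<lambda>(j, k). pos j"])
    fix u and b b' :: "'p \<times> 'p \<Rightarrow> real"
    assume "u \<in> I" and eq: "\<And>v. v \<in> I \<Longrightarrow> (case v of (j, k) \<Rightarrow> pos j) < (case u of (j, k) \<Rightarrow> pos j) \<Longrightarrow> b v = b' v"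
    obtain j k where u: "u = (j, k)" by (cases u)
    show "?c u b = ?c u b'"
      using eq by (auto simp: u mat_of_nth pos_less intro!: sum.cong)
  next
    fix u assume "u \<in> I"
    show "?c u \<in> borel_measurable (coords I)" by (cases u) simp
  qed (use LTpD(2)[OF T] in \<open>auto simp: less_imp_neq[symmetric] split: prod.splits\<close>)
  moreover have "mat_of I (\<lambda>u\<in>I. (case u of (j, k) \<Rightarrow> T $ j $ j) * b u + ?c u b) = T ** mat_of I b" for b
  proof -
    have "(T ** mat_of I b) $ j $ k = (if (j, k) \<in> I then T $ j $ j * b (j, k) + ?c (j, k) b else 0)" for j k
    proof (cases "(j, k) \<in> I")
      case False
      then have "mat_of I b $ i $ k = 0" if "i \<le> j" for i using I that by (auto simp: mat_of_nth)
      then show ?thesis using False by (auto simp: LTp_mult_nth[OF T] intro!: sum.neutral)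
    qed (simp add: LTp_mult_nth[OF T] mat_of_nth)
    then show ?thesis by (simp add: vec_eq_iff mat_of_nth[of I "restrict _ _"])
  qed
  moreover have "(\<Prod>u\<in>I. \<bar>case u of (j, k) \<Rightarrow> T $ j $ j\<bar>) = (\<Prod>(j, k)\<in>I. T $ j $ j)"
    using LTpD(2)[OF T] by (intro prod.cong) (auto simp: less_imp_le)
  ultimately show ?thesis by simp
qed

lemma nn_integral_mat_of_LTp_right:
  fixes I :: "('p::{finite,linorder} \<times> 'p) set" and F :: "'p sqmat \<Rightarrow> ennreal"
  assumes T: "T \<in> LTp" and I: "\<And>i j k. (j, k) \<notin> I \<Longrightarrow> k \<le> i \<Longrightarrow> (j, i) \<notin> I"
    and [measurable]: "F \<in> borel_measurable borel"
  shows "(\<integral>\<^sup>+b. F (mat_of I b) \<partial>coords I) =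
    ennreal (\<Prod>(j, k)\<in>I. T $ k $ k) * (\<integral>\<^sup>+b. F (mat_of I b ** T) \<partial>coords I)"
proof -
  let ?c = "\<lambda>(j, k) b. \<Sum>i | k < i. mat_of I b $ j $ i * T $ i $ k"
  \<comment> \<open>Column \<open>k\<close> of the product involves the later columns, so the rank decreases with the column.\<close>
  have "(\<integral>\<^sup>+b. F (mat_of I b) \<partial>coords I) =
    ennreal (\<Prod>u\<in>I. \<bar>case u of (j, k) \<Rightarrow> T $ k $ k\<bar>) *
    (\<integral>\<^sup>+b. F (mat_of I (\<lambda>u\<in>I. (case u of (j, k) \<Rightarrow> T $ k $ k) * b u + ?c u b)) \<partial>coords I)"
  proof (rule nn_integral_triangular[where r="\<lambda>(j, k). CARD('p) - pos k"])
    fix u and b b' :: "'p \<times> 'p \<Rightarrow> real"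
    assume "u \<in> I" and eq: "\<And>v. v \<in> I \<Longrightarrow> (case v of (j, k) \<Rightarrow> CARD('p) - pos k) < (case u of (j, k) \<Rightarrow> CARD('p) - pos k) \<Longrightarrow> b v = b' v"
    have "pos k \<le> CARD('p)" for k :: 'p unfolding pos_def by (rule card_mono) auto
    then have "CARD('p) - pos i < CARD('p) - pos k" if "k < i" for i k :: 'p
      using pos_less[OF that] by (meson diff_less_mono2 order.strict_trans2)
    moreover obtain j k where "u = (j, k)" by (cases u)
    ultimately show "?c u b = ?c u b'"
      using eq by (auto simp: mat_of_nth intro!: sum.cong)
  next
    fix u assume "u \<in> I"
    show "?c u \<in> borel_measurable (coords I)" by (cases u) simp
  qed (use LTpD(2)[OF T] in \<open>auto simp: less_imp_neq[symmetric] split: prod.splits\<close>)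
  moreover have "mat_of I (\<lambda>u\<in>I. (case u of (j, k) \<Rightarrow> T $ k $ k) * b u + ?c u b) = mat_of I b ** T" for b
  proof -
    have "(mat_of I b ** T) $ j $ k = (if (j, k) \<in> I then T $ k $ k * b (j, k) + ?c (j, k) b else 0)" for j k
    proof (cases "(j, k) \<in> I")
      case False
      then have "mat_of I b $ j $ i = 0" if "k \<le> i" for i using I that by (auto simp: mat_of_nth)
      then show ?thesis using False by (auto simp: mult_LTp_nth[OF T] intro!: sum.neutral)
    qed (simp add: mult_LTp_nth[OF T] mat_of_nth)
    then show ?thesis by (simp add: vec_eq_iff mat_of_nth[of I "restrict _ _"])
  qed
  moreover have "(\<Prod>u\<in>I. \<bar>case u of (j, k) \<Rightarrow> T $ k $ k\<bar>) = (\<Prod>(j, k)\<in>I. T $ k $ k)"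
    using LTpD(2)[OF T] by (intro prod.cong) (auto simp: less_imp_le)
  ultimately show ?thesis by simp
qed

lemma sigma_finite_coords: "finite I \<Longrightarrow> sigma_finite_measure (coords I)"
  by (rule lborel_prod.sigma_finite)

section \<open>Disintegration of Lebesgue measure over a matrix group\<close>

text \<open>
  The groups of nonsingular and of lower triangular matrices are treated together.  The entries in \<open>I\<close> are
  those that need not vanish on \<open>G\<close>, and \<open>d\<close> is the density of a Haar measure of \<open>G\<close> with respect to Lebesgue
  measure in these entries.  Translations by lower triangular matrices are enough, because they
  suffice to standardize a sample.
\<close>

locale matrix_group =
  fixes I :: "('p::{finite,linorder} \<times> 'p) set" and G :: "'p sqmat set" and d :: "'p sqmat \<Rightarrow> real"
  assumes I_rows: "\<And>i j k. (j, k) \<notin> I \<Longrightarrow> i \<le> j \<Longrightarrow> (i, k) \<notin> I"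
    and I_cols: "\<And>i j k. (j, k) \<notin> I \<Longrightarrow> k \<le> i \<Longrightarrow> (j, i) \<notin> I"
    and G_borel [measurable]: "G \<in> sets borel"
    and d_borel [measurable]: "d \<in> borel_measurable borel"
    and G_invertible: "\<And>B. B \<in> G \<Longrightarrow> invertible B"
    and G_left: "\<And>T B. T \<in> LTp \<Longrightarrow> T ** B \<in> G \<longleftrightarrow> B \<in> G"
    and G_right: "\<And>T B. T \<in> LTp \<Longrightarrow> B ** T \<in> G \<longleftrightarrow> B \<in> G"
    and d_pos: "\<And>B. B \<in> G \<Longrightarrow> 0 < d B"
    and d_LTp: "\<And>T. T \<in> LTp \<Longrightarrow> d T = 1 / (\<Prod>(j, k)\<in>I. T $ j $ j)"
    and d_left: "\<And>T B. T \<in> LTp \<Longrightarrow> B \<in> G \<Longrightarrow> d (T ** B) = d T * d B"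
    and d_right: "\<And>T B. T \<in> LTp \<Longrightarrow> B \<in> G \<Longrightarrow> d (B ** T) = d B * d T"
    and d_root: "\<And>B. B \<in> G \<Longrightarrow> d (cholesky (matrix_inv B ** transpose (matrix_inv B))) * d B = 1"
    and G_pos: "emeasure (coords I) {b \<in> space (coords I). mat_of I b \<in> G} \<noteq> 0"
begin

lemma d_LTp_pos: "T \<in> LTp \<Longrightarrow> 0 < d T"
  by (auto simp: d_LTp intro!: prod_pos LTpD)

text \<open>
  The product of Lebesgue measure in \<open>a\<close> with \<open>d(B) / \<bar>det B\<bar>\<close> times Lebesgue measure on the pattern
  is a left Haar measure on the affine group; the further factor \<open>\<bar>det B\<bar> ^ n\<close> is the Jacobian of
  the action on samples.
\<close>

definition weight :: "nat \<Rightarrow> 'p sqmat \<Rightarrow> ennreal" where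
  "weight n B = indicator G B * ennreal (d B * \<bar>det B\<bar> ^ (n - 1))"

definition orbit_integral :: "(('n::finite \<Rightarrow> (real, 'p) vec) \<Rightarrow> ennreal) \<Rightarrow> ('n \<Rightarrow> (real, 'p) vec) \<Rightarrow> ennreal" where
  "orbit_integral F z =
     (\<integral>\<^sup>+b. weight CARD('n) (mat_of I b) * (\<integral>\<^sup>+a. F (\<lambda>i. a + mat_of I b *v z i) \<partial>lborel) \<partial>coords I)"

text \<open>
  The factor for passing from \<open>y\<close> to its standardized sample as base point of the orbit.
\<close>

definition modulus :: "('n::finite \<Rightarrow> (real, 'p) vec) \<Rightarrow> real" where
  "modulus y = (let T = sample_root y in
     1 / ((\<Prod>(j, k)\<in>I. T $ k $ k) * (d T * det T ^ (CARD('n) - 1))))"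

lemma measurable_weight [measurable]: "weight n \<in> borel_measurable borel"
  unfolding weight_def by measurable

lemma weight_LTp_right:
  assumes T: "T \<in> LTp"
  shows "weight n (B ** T) = ennreal (d T * det T ^ (n - 1)) * weight n B"
proof (cases "B \<in> G")
  case True
  then show ?thesis
    using G_right[OF T, of B] d_right[OF T True] d_LTp_pos[OF T] d_pos[OF True] det_LTp_pos[OF T]
    by (simp add: weight_def det_mul abs_mult power_mult_distrib ennreal_mult'[symmetric] mult_ac)
qed (use G_right[OF T, of B] in \<open>simp add: weight_def\<close>)

text \<open>
  Right translation by the Cholesky root of \<open>y\<close> multiplies the invariant measure by a constant, so that the integral over an orbit may be based at the standardized sample.
\<close>

lemma orbit_integral_standardized:
  fixes y :: "'n::finite \<Rightarrow> (real, 'p) vec"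
  assumes pd: "positive_definite (sample_cov y)" and [measurable]: "F \<in> borel_measurable samples"
  shows "orbit_integral F y = ennreal (modulus y) * orbit_integral F (standardized y)"
proof -
  define T where "T = sample_root y"
  let ?z = "standardized y"
  let ?n = "CARD('n)"
  have T: "T \<in> LTp" using cholesky(1)[OF pd] by (simp add: T_def)
  define P c where "P = (\<Prod>(j, k)\<in>I. T $ k $ k)" and "c = d T * det T ^ (?n - 1)"
  have P: "0 < P" using LTpD(2)[OF T] by (auto simp: P_def intro!: prod_pos)
  have c: "0 < c" using d_LTp_pos[OF T] det_LTp_pos[OF T] by (simp add: c_def)
  define \<Phi> where "\<Phi> B = weight ?n B * (\<integral>\<^sup>+a. F (\<lambda>i. a + B *v ?z i) \<partial>lborel)" for B
  have \<Phi>_borel [measurable]: "\<Phi> \<in> borel_measurable borel" unfolding \<Phi>_def by measurable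
  have inner: "(\<integral>\<^sup>+a. F (\<lambda>i. a + B *v y i) \<partial>lborel) = (\<integral>\<^sup>+a. F (\<lambda>i. a + (B ** T) *v ?z i) \<partial>lborel)" for B
  proof -
    have "a + B *v y i = (B *v sample_mean y + a) + (B ** T) *v ?z i" for a i
      by (subst standardized_eq[OF pd, of i])
        (simp add: T_def matrix_vector_right_distrib matrix_vector_mul_assoc)
    then have "(\<lambda>i. a + B *v y i) = (\<lambda>i. (B *v sample_mean y + a) + (B ** T) *v ?z i)" for a
      by blast
    then show ?thesis
      using nn_integral_lborel_translate[of "\<lambda>a. F (\<lambda>i. a + (B ** T) *v ?z i)" "B *v sample_mean y"]
      by (simp only:) simp
  qed
  have "orbit_integral F y = (\<integral>\<^sup>+b. ennreal (1 / c) * \<Phi> (mat_of I b ** T) \<partial>coords I)"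
    unfolding orbit_integral_def
  proof (rule nn_integral_cong)
    fix b
    have "ennreal (1 / c) * weight ?n (mat_of I b ** T) = weight ?n (mat_of I b)"
      unfolding weight_LTp_right[OF T] c_def[symmetric]
      using c by (simp add: mult.assoc[symmetric] ennreal_mult'[symmetric])
    then show "weight ?n (mat_of I b) * (\<integral>\<^sup>+a. F (\<lambda>i. a + mat_of I b *v y i) \<partial>lborel) =
        ennreal (1 / c) * \<Phi> (mat_of I b ** T)"
      by (simp add: inner \<Phi>_def mult.assoc[symmetric])
  qed
  also have "\<dots> = ennreal (1 / c) * (\<integral>\<^sup>+b. \<Phi> (mat_of I b ** T) \<partial>coords I)"
    by (intro nn_integral_cmult) measurable
  also have "(\<integral>\<^sup>+b. \<Phi> (mat_of I b ** T) \<partial>coords I) = ennreal (1 / P) * (\<integral>\<^sup>+b. \<Phi> (mat_of I b) \<partial>coords I)"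
    using P by (simp add: nn_integral_mat_of_LTp_right[OF T I_cols \<Phi>_borel] P_def[symmetric]
        mult.assoc[symmetric] ennreal_mult'[symmetric])
  also have "(\<integral>\<^sup>+b. \<Phi> (mat_of I b) \<partial>coords I) = orbit_integral F ?z"
    by (simp add: orbit_integral_def \<Phi>_def)
  also have "ennreal (1 / c) * (ennreal (1 / P) * orbit_integral F ?z) = ennreal (modulus y) * orbit_integral F ?z"
  proof -
    have "modulus y = 1 / c * (1 / P)"
      unfolding modulus_def Let_def T_def[symmetric] P_def[symmetric] c_def[symmetric]
      by (simp only: mult.commute[of P c] times_divide_times_eq mult_1)
    then have "ennreal (modulus y) = ennreal (1 / c) * ennreal (1 / P)"
      using c by (simp only: ennreal_mult' zero_le_divide_1_iff less_imp_le)
    then show ?thesis by (simp only: mult.assoc)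
  qed
  finally show ?thesis .
qed

text \<open>
  A function of mean and covariance matrix whose average over the group, with respect to the
  invariant measure, is finite and positive.  The inverse of the covariance matrix in the exponent turns
  this average into the Gaussian integral \<open>total\<close>.
\<close>

definition cut :: "('n::finite \<Rightarrow> (real, 'p) vec) \<Rightarrow> ennreal" where
  "cut y = (if positive_definite (sample_cov y)
     then indicator (cbox (- One) One) (sample_mean y) *
       ennreal (exp (- trace (matrix_inv (sample_cov y)) / 2) * d (sample_root y)) else 0)"

definition total :: ennreal where
  "total = emeasure lborel (cbox (- One) One :: (real, 'p) vec set) *
     (\<integral>\<^sup>+b. indicator G (mat_of I b) * ennreal (exp (- trace (transpose (mat_of I b) ** mat_of I b) / 2)) \<partial>coords I)"

lemma measurable_cut [measurable]: "cut \<in> borel_measurable (samples :: ('n::finite \<Rightarrow> (real, 'p) vec) measure)"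
  unfolding cut_def positive_definite_sample_cov_iff by measurable

text \<open>
  The integral over \<open>a\<close> is proportional to the volume of the cube; substituting \<open>T B\<close> for \<open>B\<close>, with \<open>T\<close> the Cholesky
  root of \<open>x\<close>, then removes the dependence on \<open>x\<close>.
\<close>

lemma cut_average:
  fixes x :: "'n::finite \<Rightarrow> (real, 'p) vec"
  assumes pd: "positive_definite (sample_cov x)"
  shows "(\<integral>\<^sup>+b. indicator G (mat_of I b) * ennreal (d (mat_of I b) / \<bar>det (mat_of I b)\<bar>) *
      (\<integral>\<^sup>+a. cut (\<lambda>i. matrix_inv (mat_of I b) *v (x i - a)) \<partial>lborel) \<partial>coords I) = total"
proof -
  define T where "T = sample_root x"
  have T: "T \<in> LTp" "T ** transpose T = sample_cov x" using cholesky[OF pd] by (auto simp: T_def)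
  define E where "E S = ennreal (exp (- trace (matrix_inv S) / 2) * d (cholesky S))" for S
  let ?K = "cbox (- One) One :: (real, 'p) vec set"
  have uminus: "- u \<in> ?K \<longleftrightarrow> u \<in> ?K" for u
    by (auto simp: mem_box inner_minus_left)
  define \<Psi> where "\<Psi> B = indicator G B * ennreal (d B) *
    E (matrix_inv B ** sample_cov x ** transpose (matrix_inv B))" for B
  have \<Psi>_eq: "\<Psi> = (\<lambda>B. indicator G B * (ennreal (d B) *
      E (matrix_inv B ** sample_cov x ** transpose (matrix_inv B))))"
    by (simp add: \<Psi>_def fun_eq_iff mult.assoc)
  \<comment> \<open>On invertible matrices the argument of the Cholesky root is a sample covariance matrix.\<close>
  have \<Psi>_borel [measurable]: "\<Psi> \<in> borel_measurable borel"
  proof -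
    have "E (matrix_inv B ** sample_cov x ** transpose (matrix_inv B)) =
        E (sample_cov (\<lambda>i. 0 + matrix_inv B *v x i))" for B
      unfolding sample_cov_affine ..
    moreover have "(\<lambda>B. E (sample_cov (\<lambda>i. 0 + matrix_inv B *v x i))) \<in> borel_measurable borel"
      unfolding E_def by measurable
    ultimately show ?thesis unfolding \<Psi>_eq by simp
  qed
  have inner: "indicator G B * ennreal (d B / \<bar>det B\<bar>) *
      (\<integral>\<^sup>+a. cut (\<lambda>i. matrix_inv B *v (x i - a)) \<partial>lborel) = emeasure lborel ?K * \<Psi> B" for B
  proof (cases "B \<in> G")
    case True
    then have inv: "invertible B" "det B \<noteq> 0" using G_invertible invertible_det_nz by blast+
    let ?U = "matrix_inv B"
    have "invertible ?U" by (rule invertible_matrix_inv[OF inv(1)])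
    have cut: "cut (\<lambda>i. ?U *v (x i - a)) = indicator ?K (?U *v (sample_mean x - a)) *
        E (?U ** sample_cov x ** transpose ?U)" for a
    proof -
      have eq: "(\<lambda>i. ?U *v (x i - a)) = (\<lambda>i. - (?U *v a) + ?U *v x i)"
        by (simp add: matrix_vector_mult_diff_distrib)
      have "positive_definite (sample_cov (\<lambda>i. - (?U *v a) + ?U *v x i))"
        using pd positive_definite_sample_cov_affine[OF \<open>invertible ?U\<close>] by blast
      then show ?thesis
        unfolding eq cut_def E_def sample_mean_affine sample_cov_affine
        by (simp add: matrix_vector_mult_diff_distrib)
    qed
    have "(\<integral>\<^sup>+a. indicator ?K (?U *v (sample_mean x - a)) \<partial>lborel) =
        ennreal \<bar>det B\<bar> * (\<integral>\<^sup>+a. indicator ?K (?U *v (sample_mean x - (sample_mean x + B *v a))) \<partial>lborel)"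
      by (rule nn_integral_lborel_affine[OF inv(2)]) measurable
    also have "(\<integral>\<^sup>+a. indicator ?K (?U *v (sample_mean x - (sample_mean x + B *v a))) \<partial>lborel) =
        (\<integral>\<^sup>+a. indicator ?K a \<partial>lborel)"
    proof (rule nn_integral_cong)
      fix a
      have "?U *v (sample_mean x - (sample_mean x + B *v a)) = - a"
        by (simp add: linear_neg[OF matrix_vector_mul_linear] matrix_vector_mul_assoc
            matrix_inv_mult[OF inv(1)])
      then show "indicator ?K (?U *v (sample_mean x - (sample_mean x + B *v a))) = (indicator ?K a :: ennreal)"
        by (simp only: indicator_def uminus)
    qed
    finally have "(\<integral>\<^sup>+a. indicator ?K (?U *v (sample_mean x - a)) \<partial>lborel) = ennreal \<bar>det B\<bar> * emeasure lborel ?K"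
      by simp
    moreover have "ennreal (d B / \<bar>det B\<bar>) * ennreal \<bar>det B\<bar> = ennreal (d B)"
      using inv(2) d_pos[OF True] by (simp add: ennreal_mult'[symmetric])
    ultimately show ?thesis
      using True by (simp add: cut \<Psi>_def nn_integral_multc mult.assoc[symmetric])
        (simp add: mult_ac)
  qed (simp add: \<Psi>_def)
  have "\<Psi> (T ** B) = ennreal (d T) * (indicator G B * ennreal (exp (- trace (transpose B ** B) / 2)))" for B
  proof (cases "B \<in> G")
    case True
    then have inv: "invertible B" using G_invertible by blast
    let ?U = "matrix_inv B"
    have invT: "invertible T" using T(1) by (rule LTp_invertible)
    have "matrix_inv (T ** B) ** sample_cov x ** transpose (matrix_inv (T ** B)) =
        ?U ** ((matrix_inv T ** T) ** transpose (matrix_inv T ** T)) ** transpose ?U"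
      unfolding T(2)[symmetric] matrix_inv_mult_distrib[OF invT inv]
      by (simp only: matrix_transpose_mul matrix_mul_assoc)
    then have S: "matrix_inv (T ** B) ** sample_cov x ** transpose (matrix_inv (T ** B)) = ?U ** transpose ?U"
      by (simp add: matrix_inv_mult invT transpose_mat)
    have "(?U ** transpose ?U) ** (transpose B ** B) = ?U ** transpose (B ** ?U) ** B"
      by (simp add: matrix_transpose_mul matrix_mul_assoc)
    then have "matrix_inv (?U ** transpose ?U) = transpose B ** B"
      by (intro matrix_inv_eqI) (simp add: matrix_inv_mult inv transpose_mat)
    then have "E (?U ** transpose ?U) = ennreal (exp (- trace (transpose B ** B) / 2) * d (cholesky (?U ** transpose ?U)))"
      by (simp add: E_def)
    moreover have "d (cholesky (?U ** transpose ?U)) = 1 / d B"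
      using d_root[OF True] d_pos[OF True] by (simp add: field_simps)
    ultimately show ?thesis
      using True G_left[OF T(1), of B] d_left[OF T(1) True] d_pos[OF True] d_LTp_pos[OF T(1)]
      by (simp add: \<Psi>_def S ennreal_mult'[symmetric])
  qed (use G_left[OF T(1), of B] in \<open>simp add: \<Psi>_def\<close>)
  then have "(\<integral>\<^sup>+b. \<Psi> (mat_of I b) \<partial>coords I) = ennreal (\<Prod>(j, k)\<in>I. T $ j $ j) * (ennreal (d T) *
      (\<integral>\<^sup>+b. indicator G (mat_of I b) * ennreal (exp (- trace (transpose (mat_of I b) ** mat_of I b) / 2)) \<partial>coords I))"
    by (simp add: nn_integral_mat_of_LTp_left[OF T(1) I_rows \<Psi>_borel] nn_integral_cmult)
  moreover have "ennreal (\<Prod>(j, k)\<in>I. T $ j $ j) * ennreal (d T) = 1"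
  proof -
    have "ennreal P * ennreal (1 / P) = 1" if "0 < P" for P
      using that by (simp add: ennreal_mult'[symmetric])
    moreover have "0 < (\<Prod>(j, k)\<in>I. T $ j $ j)" using LTpD(2)[OF T(1)] by (auto intro!: prod_pos)
    ultimately show ?thesis unfolding d_LTp[OF T(1)] by blast
  qed
  ultimately show ?thesis
    by (simp add: inner nn_integral_cmult total_def mult.assoc[symmetric])
qed

lemma trace_mat_of: "trace (transpose (mat_of I b) ** mat_of I b) = (\<Sum>u\<in>I. (b u)\<^sup>2)"
proof -
  have "(\<Sum>j\<in>UNIV. \<Sum>k\<in>UNIV. (mat_of I b $ j $ k)\<^sup>2) = (\<Sum>u\<in>UNIV. if u \<in> I then (b u)\<^sup>2 else 0)"
    unfolding sum.cartesian_product UNIV_Times_UNIV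
    by (rule sum.cong) (auto simp: mat_of_nth)
  then show ?thesis by (simp add: trace_transpose_mult sum.If_cases)
qed

lemma total_finite_positive: "total < \<infinity>" "total \<noteq> 0"
proof -
  let ?K = "cbox (- One) One :: (real, 'p) vec set"
  let ?g = "\<lambda>b. ennreal (exp (- trace (transpose (mat_of I b) ** mat_of I b) / 2))"
  have K: "emeasure lborel ?K = ennreal (2 ^ DIM((real, 'p) vec))"
  proof -
    have "(\<Prod>b\<in>Basis. (One - - One) \<bullet> (b :: (real, 'p) vec)) = (\<Prod>b\<in>(Basis :: (real, 'p) vec set). 2)"
    proof (rule prod.cong)
      fix b :: "(real, 'p) vec" assume "b \<in> Basis"
      then have "One \<bullet> b = 1" by simp
      then show "(One - - One) \<bullet> b = 2" by (simp only: inner_diff_left inner_minus_left)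
    qed simp
    then show ?thesis by (simp add: emeasure_lborel_cbox_eq del: diff_minus_eq_add)
  qed
  have "(\<integral>\<^sup>+b. indicator G (mat_of I b) * ?g b \<partial>coords I) \<le> (\<integral>\<^sup>+b. (\<Prod>u\<in>I. ennreal (exp (- (b u)\<^sup>2 / 2))) \<partial>coords I)"
  proof (rule nn_integral_mono)
    fix b
    have "?g b = (\<Prod>u\<in>I. ennreal (exp (- (b u)\<^sup>2 / 2)))"
      by (simp add: trace_mat_of prod_ennreal exp_sum[symmetric] sum_negf sum_divide_distrib)
    then show "indicator G (mat_of I b) * ?g b \<le> (\<Prod>u\<in>I. ennreal (exp (- (b u)\<^sup>2 / 2)))"
      by (simp add: indicator_def)
  qed
  also have "\<dots> = (\<Prod>u\<in>I. (\<integral>\<^sup>+t. ennreal (exp (- t\<^sup>2 / 2)) \<partial>lborel))"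
    by (rule lborel_prod.product_nn_integral_prod) auto
  also have "\<dots> < \<infinity>"
  proof -
    have "(\<integral>\<^sup>+t. ennreal (exp (- t\<^sup>2 / 2)) \<partial>lborel) = (\<integral>\<^sup>+t. ennreal (sqrt (2 * pi)) * ennreal (std_normal_density t) \<partial>lborel)"
      by (intro nn_integral_cong) (simp add: std_normal_density_def ennreal_mult'[symmetric])
    also have "\<dots> = ennreal (sqrt (2 * pi)) * (\<integral>\<^sup>+t. ennreal (std_normal_density t) \<partial>lborel)"
      by (rule nn_integral_cmult) auto
    also have "(\<integral>\<^sup>+t. ennreal (std_normal_density t) \<partial>lborel) = 1"
      using prob_space_normal_density[of 1 0] prob_space.emeasure_space_1[of "density lborel std_normal_density"]
      by (simp add: emeasure_density)
    finally show ?thesis by (simp add: ennreal_power ennreal_less_top)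
  qed
  finally have fin: "(\<integral>\<^sup>+b. indicator G (mat_of I b) * ?g b \<partial>coords I) < \<infinity>" .
  then show "total < \<infinity>" by (simp add: total_def K ennreal_mult_less_top)
  have "(\<integral>\<^sup>+b. indicator G (mat_of I b) * ?g b \<partial>coords I) \<noteq> 0"
  proof
    assume "(\<integral>\<^sup>+b. indicator G (mat_of I b) * ?g b \<partial>coords I) = 0"
    then have "AE b in coords I. indicator G (mat_of I b) * ?g b = 0"
      by (subst (asm) nn_integral_0_iff_AE) auto
    then have "AE b in coords I. \<not> mat_of I b \<in> G"
      by eventually_elim (auto simp: indicator_def split: if_splits)
    then have "emeasure (coords I) {b \<in> space (coords I). mat_of I b \<in> G} = 0"
      by (subst (asm) AE_iff_measurable[OF _ refl]) auto
    then show False using G_pos by simp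
  qed
  then show "total \<noteq> 0" by (simp add: total_def K)
qed

text \<open>
  Compute \<open>\<integral>F(x) (\<integral>cut(g\<^sup>-\<^sup>1 x) dg) dx\<close> in two ways: the inner integral is the constant \<open>total\<close> for almost
  every \<open>x\<close>; and exchanging the integrals and substituting \<open>x = g y\<close> produces integrals over orbits.
\<close>

lemma disintegration_orbits:
  fixes F :: "('n::finite \<Rightarrow> (real, 'p) vec) \<Rightarrow> ennreal"
  assumes n: "CARD('p) < CARD('n)" and [measurable]: "F \<in> borel_measurable samples"
  shows "total * (\<integral>\<^sup>+x. F x \<partial>samples) = (\<integral>\<^sup>+y. cut y * orbit_integral F y \<partial>samples)"
proof -
  let ?S = "samples :: ('n \<Rightarrow> (real, 'p) vec) measure"
  let ?n = "CARD('n)"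
  let ?h = "\<lambda>B. indicator G B * ennreal (d B / \<bar>det B\<bar>) :: ennreal"
  interpret SC: pair_sigma_finite ?S "coords I"
    by (intro pair_sigma_finite.intro lborel_prod.sigma_finite) simp_all
  interpret SL: pair_sigma_finite ?S "lborel :: (real, 'p) vec measure"
    by (intro pair_sigma_finite.intro lborel_prod.sigma_finite lborel.sigma_finite_measure_axioms) simp
  interpret CS: pair_sigma_finite "coords I" ?S
    by (intro pair_sigma_finite.intro lborel_prod.sigma_finite) simp_all
  interpret LS: pair_sigma_finite "lborel :: (real, 'p) vec measure" ?S
    by (intro pair_sigma_finite.intro lborel_prod.sigma_finite lborel.sigma_finite_measure_axioms) simp
  have "total * (\<integral>\<^sup>+x. F x \<partial>?S) = (\<integral>\<^sup>+x. F x * total \<partial>?S)"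
    by (simp add: nn_integral_multc mult.commute)
  also have "\<dots> = (\<integral>\<^sup>+x. F x * (\<integral>\<^sup>+b. ?h (mat_of I b) *
      (\<integral>\<^sup>+a. cut (\<lambda>i. matrix_inv (mat_of I b) *v (x i - a)) \<partial>lborel) \<partial>coords I) \<partial>?S)"
    using AE_samples_positive_definite[OF n]
    by (intro nn_integral_cong_AE) (auto simp: cut_average)
  also have "\<dots> = (\<integral>\<^sup>+x. (\<integral>\<^sup>+b. (\<integral>\<^sup>+a. F x * (?h (mat_of I b) *
      cut (\<lambda>i. matrix_inv (mat_of I b) *v (x i - a))) \<partial>lborel) \<partial>coords I) \<partial>?S)"
    by (intro nn_integral_cong) (simp add: nn_integral_cmult)
  also have "\<dots> = (\<integral>\<^sup>+b. (\<integral>\<^sup>+x. (\<integral>\<^sup>+a. F x * (?h (mat_of I b) *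
      cut (\<lambda>i. matrix_inv (mat_of I b) *v (x i - a))) \<partial>lborel) \<partial>?S) \<partial>coords I)"
    by (rule CS.Fubini') measurable
  also have "\<dots> = (\<integral>\<^sup>+b. (\<integral>\<^sup>+a. (\<integral>\<^sup>+x. F x * (?h (mat_of I b) *
      cut (\<lambda>i. matrix_inv (mat_of I b) *v (x i - a))) \<partial>?S) \<partial>lborel) \<partial>coords I)"
    by (intro nn_integral_cong LS.Fubini') measurable
  also have "\<dots> = (\<integral>\<^sup>+b. (\<integral>\<^sup>+a. (\<integral>\<^sup>+y. weight ?n (mat_of I b) * F (\<lambda>i. a + mat_of I b *v y i) * cut y \<partial>?S) \<partial>lborel) \<partial>coords I)"
  proof (rule nn_integral_cong, rule nn_integral_cong)
    fix b and a :: "(real, 'p) vec"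
    let ?B = "mat_of I b"
    show "(\<integral>\<^sup>+x. F x * (?h ?B * cut (\<lambda>i. matrix_inv ?B *v (x i - a))) \<partial>?S) =
        (\<integral>\<^sup>+y. weight ?n ?B * F (\<lambda>i. a + ?B *v y i) * cut y \<partial>?S)"
    proof (cases "?B \<in> G")
      case True
      then have inv: "invertible ?B" "det ?B \<noteq> 0" using G_invertible invertible_det_nz by blast+
      have w: "ennreal (\<bar>det ?B\<bar> ^ ?n) * ?h ?B = weight ?n ?B"
      proof -
        have "\<bar>det ?B\<bar> ^ ?n = \<bar>det ?B\<bar> ^ (?n - 1) * \<bar>det ?B\<bar>"
          by (metis power_minus_mult zero_less_card_finite)
        then show ?thesis
          using True inv(2) d_pos[OF True] by (simp add: weight_def ennreal_mult'[symmetric] mult.commute)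
      qed
      have "(\<integral>\<^sup>+x. F x * (?h ?B * cut (\<lambda>i. matrix_inv ?B *v (x i - a))) \<partial>?S) =
        ennreal (\<bar>det ?B\<bar> ^ ?n) * (\<integral>\<^sup>+y. F (\<lambda>i. a + ?B *v y i) *
          (?h ?B * cut (\<lambda>i. matrix_inv ?B *v (a + ?B *v y i - a))) \<partial>?S)"
        by (rule nn_integral_samples_affine[OF inv(2), of _ "\<lambda>_. a"]) measurable
      also have "\<dots> = ennreal (\<bar>det ?B\<bar> ^ ?n) * (\<integral>\<^sup>+y. F (\<lambda>i. a + ?B *v y i) * (?h ?B * cut y) \<partial>?S)"
        by (simp add: matrix_vector_mul_assoc matrix_inv_mult[OF inv(1)])
      also have "\<dots> = (\<integral>\<^sup>+y. ennreal (\<bar>det ?B\<bar> ^ ?n) * (F (\<lambda>i. a + ?B *v y i) * (?h ?B * cut y)) \<partial>?S)"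
        by (rule nn_integral_cmult[symmetric]) measurable
      also have "\<dots> = (\<integral>\<^sup>+y. weight ?n ?B * F (\<lambda>i. a + ?B *v y i) * cut y \<partial>?S)"
        unfolding w[symmetric] by (simp only: mult_ac)
      finally show ?thesis .
    qed (simp add: weight_def)
  qed
  also have "\<dots> = (\<integral>\<^sup>+b. (\<integral>\<^sup>+y. (\<integral>\<^sup>+a. weight ?n (mat_of I b) * F (\<lambda>i. a + mat_of I b *v y i) * cut y \<partial>lborel) \<partial>?S) \<partial>coords I)"
    by (intro nn_integral_cong SL.Fubini') measurable
  also have "\<dots> = (\<integral>\<^sup>+y. (\<integral>\<^sup>+b. (\<integral>\<^sup>+a. weight ?n (mat_of I b) * F (\<lambda>i. a + mat_of I b *v y i) * cut y \<partial>lborel) \<partial>coords I) \<partial>?S)"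
    by (rule SC.Fubini') measurable
  also have "\<dots> = (\<integral>\<^sup>+y. cut y * orbit_integral F y \<partial>?S)"
    by (intro nn_integral_cong) (simp add: orbit_integral_def nn_integral_cmult nn_integral_multc mult.commute)
  finally show ?thesis .
qed

text \<open>
  Changing the base point of every orbit to the standardized sample turns the previous identity into the
  form in which it is used.
\<close>

lemma disintegration:
  assumes n: "CARD('p) < CARD('n::finite)"
  obtains \<omega> :: "('n::finite \<Rightarrow> (real, 'p) vec) \<Rightarrow> ennreal" where "\<omega> \<in> borel_measurable samples"
    "\<And>F. F \<in> borel_measurable samples \<Longrightarrow>
      (\<integral>\<^sup>+x. F x \<partial>samples) = (\<integral>\<^sup>+y. \<omega> y * orbit_integral F (standardized y) \<partial>samples)"
    "\<And>y. \<not> positive_definite (sample_cov y) \<Longrightarrow> \<omega> y = 0"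
proof
  let ?\<omega> = "\<lambda>y :: 'n \<Rightarrow> (real, 'p) vec. inverse total * (cut y * ennreal (modulus y))"
  have modulus [measurable]: "modulus \<in> borel_measurable (samples :: ('n \<Rightarrow> (real, 'p) vec) measure)"
    unfolding modulus_def Let_def case_prod_beta' by measurable
  show "?\<omega> \<in> borel_measurable samples" by measurable
  show "?\<omega> y = 0" if "\<not> positive_definite (sample_cov y)" for y
    using that by (simp add: cut_def)
  fix F :: "('n \<Rightarrow> (real, 'p) vec) \<Rightarrow> ennreal" assume [measurable]: "F \<in> borel_measurable samples"
  interpret coords: sigma_finite_measure "coords I" by (rule sigma_finite_coords) simp
  have J [measurable]: "(\<lambda>y. orbit_integral F (standardized y)) \<in> borel_measurable samples"
    unfolding orbit_integral_def by measurable
  have "inverse total * total = 1"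
    using total_finite_positive ennreal_divide_self[of total]
    by (simp add: divide_ennreal_def mult.commute)
  then have "(\<integral>\<^sup>+x. F x \<partial>samples) = inverse total * (total * (\<integral>\<^sup>+x. F x \<partial>samples))"
    by (simp add: mult.assoc[symmetric])
  also have "\<dots> = inverse total * (\<integral>\<^sup>+y. cut y * orbit_integral F y \<partial>samples)"
    by (simp add: disintegration_orbits[OF n])
  also have "(\<integral>\<^sup>+y. cut y * orbit_integral F y \<partial>samples) =
      (\<integral>\<^sup>+y. (cut y * ennreal (modulus y)) * orbit_integral F (standardized y) \<partial>samples)"
    by (intro nn_integral_cong) (auto simp: cut_def orbit_integral_standardized mult.assoc)
  also have "inverse total * \<dots> = (\<integral>\<^sup>+y. ?\<omega> y * orbit_integral F (standardized y) \<partial>samples)"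
    by (subst nn_integral_cmult[symmetric]) (auto simp: mult.assoc)
  finally show "(\<integral>\<^sup>+x. F x \<partial>samples) = (\<integral>\<^sup>+y. ?\<omega> y * orbit_integral F (standardized y) \<partial>samples)" .
qed

end

section \<open>The two groups\<close>

lemma det_cholesky_mult_transpose:
  fixes U :: "'p::{finite,linorder} sqmat"
  assumes "invertible U"
  shows "det (cholesky (U ** transpose U)) = \<bar>det U\<bar>"
proof -
  let ?T = "cholesky (U ** transpose U)"
  have T: "?T \<in> LTp" "?T ** transpose ?T = U ** transpose U"
    using cholesky[OF positive_definite_mult_transpose[OF assms]] by auto
  have "(det ?T)\<^sup>2 = (det U)\<^sup>2"
    using arg_cong[OF T(2), of det] by (simp add: det_mul power2_eq_square)
  then have "\<bar>det ?T\<bar> = \<bar>det U\<bar>" by (simp add: power2_eq_iff abs_eq_iff)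
  then show ?thesis using det_LTp_pos[OF T(1)] by simp
qed

lemma open_GLp: "open (GLp :: (real^'p^'p) set)"
proof -
  have "GLp = {B :: real^'p^'p. det B \<noteq> 0}" by (auto simp: GLp_def invertible_det_nz)
  moreover have "continuous_on UNIV (det :: real^'p^'p \<Rightarrow> real)"
    unfolding det_def by (intro continuous_intros)
  then have "open {B :: real^'p^'p. det B \<noteq> 0}"
    by (intro open_Collect_neq) auto
  ultimately show ?thesis by simp
qed

lemma GLp_borel [measurable]: "(GLp :: (real^'p^'p) set) \<in> sets borel"
  by (intro borel_open open_GLp)

definition GL_density :: "'p::finite sqmat \<Rightarrow> real" where
  "GL_density B = 1 / \<bar>det B\<bar> ^ CARD('p)"

definition LT_density :: "'p::{finite,linorder} sqmat \<Rightarrow> real" where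
  "LT_density B = 1 / (\<Prod>j\<in>UNIV. (B $ j $ j) ^ pos j)"

definition lower :: "('p::linorder \<times> 'p) set" where
  "lower = {(j, k). k \<le> j}"

lemma prod_lower:
  fixes T :: "'p::{finite,linorder} sqmat"
  shows "(\<Prod>(j, k)\<in>lower. T $ j $ j) = (\<Prod>j\<in>UNIV. (T $ j $ j) ^ pos j)"
proof -
  have "lower = Sigma UNIV (\<lambda>j :: 'p. {k. k \<le> j})" by (auto simp: lower_def)
  then have "(\<Prod>(j, k)\<in>lower. T $ j $ j) = (\<Prod>(j, k)\<in>Sigma UNIV (\<lambda>j :: 'p. {k. k \<le> j}). T $ j $ j)"
    by simp
  also have "\<dots> = (\<Prod>j\<in>UNIV. \<Prod>k | k \<le> j. T $ j $ j)"
    by (rule prod.Sigma[symmetric]) auto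
  finally show ?thesis by (simp add: pos_def)
qed

lemma matrix_group_GL:
  "matrix_group UNIV (GLp :: 'p::{finite,linorder} sqmat set) GL_density"
proof
  show "GLp \<in> sets (borel :: 'p sqmat measure)" by (rule GLp_borel)
  show "(GL_density :: 'p sqmat \<Rightarrow> real) \<in> borel_measurable borel"
    unfolding GL_density_def by measurable
  fix T B :: "'p sqmat"
  show "invertible B" if "B \<in> GLp" using that by (simp add: GLp_def)
  show "0 < GL_density B" if "B \<in> GLp"
    using that by (simp add: GLp_def GL_density_def invertible_det_nz)
  assume T: "T \<in> LTp"
  have detT: "0 < det T" by (rule det_LTp_pos[OF T])
  then show "T ** B \<in> GLp \<longleftrightarrow> B \<in> GLp" "B ** T \<in> GLp \<longleftrightarrow> B \<in> GLp"
    by (simp_all add: GLp_def invertible_det_nz det_mul)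
  show "GL_density (T ** B) = GL_density T * GL_density B"
    "GL_density (B ** T) = GL_density B * GL_density T"
    by (simp_all add: GL_density_def det_mul abs_mult power_mult_distrib)
  have "(\<Prod>(j, k)\<in>(UNIV :: ('p \<times> 'p) set). T $ j $ j) = (\<Prod>j\<in>UNIV. \<Prod>k\<in>(UNIV :: 'p set). T $ j $ j)"
    by (subst prod.cartesian_product) simp
  then show "GL_density T = 1 / (\<Prod>(j, k)\<in>(UNIV :: ('p \<times> 'p) set). T $ j $ j)"
    using detT by (simp add: GL_density_def det_LTp[OF T] prod_power_distrib)
next
  fix B :: "'p sqmat" assume "B \<in> GLp"
  then have inv: "invertible B" "det B \<noteq> 0" by (simp_all add: GLp_def invertible_det_nz)
  have "det B * det (matrix_inv B) = 1"
    using arg_cong[OF matrix_inv_mult(1)[OF inv(1)], of det] by (simp add: det_mul)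
  then have "\<bar>det B\<bar> * \<bar>det (matrix_inv B)\<bar> = 1" by (simp add: abs_mult[symmetric])
  then show "GL_density (cholesky (matrix_inv B ** transpose (matrix_inv B))) * GL_density B = 1"
    by (simp add: GL_density_def det_cholesky_mult_transpose[OF invertible_matrix_inv[OF inv(1)]]
        power_mult_distrib[symmetric] mult.commute)
next
  have "emeasure lborel (GLp :: 'p sqmat set) \<noteq> 0"
  proof
    assume "emeasure lborel (GLp :: 'p sqmat set) = 0"
    then have "(GLp :: 'p sqmat set) \<in> null_sets lborel" by (simp add: null_sets_def GLp_borel)
    then have "negligible (GLp :: 'p sqmat set)"
      by (simp add: negligible_iff_null_sets null_sets_completionI)
    moreover have "mat 1 \<in> (GLp :: 'p sqmat set)" by (simp add: GLp_def invertible_det_nz)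
    ultimately show False using open_not_negligible[OF open_GLp] by blast
  qed
  also have "emeasure lborel (GLp :: 'p sqmat set) =
      emeasure (coords UNIV) {b \<in> space (coords UNIV). mat_of UNIV b \<in> (GLp :: 'p sqmat set)}"
    by (subst lborel_eq_distr_matrix)
      (auto simp: emeasure_distr GLp_borel mat_of_def space_PiM intro!: arg_cong[where f="emeasure _"])
  finally show "emeasure (coords UNIV) {b \<in> space (coords UNIV). mat_of UNIV b \<in> (GLp :: 'p sqmat set)} \<noteq> 0" .
qed simp_all

lemma LTp_borel [measurable]: "LTp \<in> sets (borel :: 'p::{finite,linorder} sqmat measure)"
proof -
  have "{T :: 'p sqmat. (\<forall>i\<in>UNIV. \<forall>j\<in>{i<..}. T $ i $ j = 0) \<and> (\<forall>i\<in>UNIV. 0 < T $ i $ i)} \<in> sets borel"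
    by measurable
  moreover have "LTp = {T :: 'p sqmat. (\<forall>i\<in>UNIV. \<forall>j\<in>{i<..}. T $ i $ j = 0) \<and> (\<forall>i\<in>UNIV. 0 < T $ i $ i)}"
    by (auto simp: LTp_def)
  ultimately show ?thesis by (simp only:)
qed

lemma matrix_group_LT:
  "matrix_group lower (LTp :: 'p::{finite,linorder} sqmat set) LT_density"
proof
  show "(j, k) \<notin> lower \<Longrightarrow> i \<le> j \<Longrightarrow> (i, k) \<notin> lower"
    "(j, k) \<notin> lower \<Longrightarrow> k \<le> i \<Longrightarrow> (j, i) \<notin> lower" for i j k :: 'p
    by (auto simp: lower_def)
  show "LTp \<in> sets (borel :: 'p sqmat measure)" by (rule LTp_borel)
  show "(LT_density :: 'p sqmat \<Rightarrow> real) \<in> borel_measurable borel"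
    unfolding LT_density_def by measurable
  fix T B :: "'p sqmat"
  show "invertible B" if "B \<in> LTp" using that by (rule LTp_invertible)
  show "0 < LT_density B" if "B \<in> LTp"
    using LTpD(2)[OF that] by (auto simp: LT_density_def intro!: prod_pos)
  assume T: "T \<in> LTp"
  have inv: "matrix_inv T \<in> LTp" "invertible T" using LTp_inv(1) LTp_invertible T by auto
  have "B \<in> LTp" if "T ** B \<in> LTp"
    using LTp_mult(1)[OF inv(1) that] by (simp add: matrix_mul_assoc matrix_inv_mult inv)
  then show "T ** B \<in> LTp \<longleftrightarrow> B \<in> LTp" using LTp_mult(1)[OF T] by blast
  have "B \<in> LTp" if "B ** T \<in> LTp"
    using LTp_mult(1)[OF that inv(1)] by (simp add: matrix_mul_assoc[symmetric] matrix_inv_mult inv)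
  then show "B ** T \<in> LTp \<longleftrightarrow> B \<in> LTp" using LTp_mult(1)[OF _ T] by blast
  show "LT_density T = 1 / (\<Prod>(j, k)\<in>lower. T $ j $ j)"
    by (simp add: LT_density_def prod_lower)
  assume B: "B \<in> LTp"
  show "LT_density (T ** B) = LT_density T * LT_density B"
    "LT_density (B ** T) = LT_density B * LT_density T"
    by (simp_all add: LT_density_def LTp_mult[OF T B] LTp_mult[OF B T] power_mult_distrib prod.distrib)
next
  fix B :: "'p sqmat" assume B: "B \<in> LTp"
  have "B $ j $ j \<noteq> 0" for j using LTpD(2)[OF B, of j] by simp
  then show "LT_density (cholesky (matrix_inv B ** transpose (matrix_inv B))) * LT_density B = 1"
    by (simp add: cholesky_mult_transpose LTp_inv[OF B] LT_density_def prod.distrib[symmetric]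
        power_mult_distrib[symmetric])
next
  let ?P = "coords (lower :: ('p \<times> 'p) set)"
  have "emeasure ?P (Pi\<^sub>E lower (\<lambda>_. {0<..<1})) = 1"
    by (subst lborel_prod.emeasure_PiM) auto
  moreover have "emeasure ?P (Pi\<^sub>E lower (\<lambda>_. {0<..<1})) \<le> emeasure ?P {b \<in> space ?P. mat_of lower b \<in> (LTp :: 'p sqmat set)}"
  proof (rule emeasure_mono)
    show "Pi\<^sub>E lower (\<lambda>_. {0<..<1}) \<subseteq> {b \<in> space ?P. mat_of lower b \<in> (LTp :: 'p sqmat set)}"
      by (auto simp: LTp_def mat_of_nth lower_def space_PiM PiE_def Pi_def)
    show "{b \<in> space ?P. mat_of lower b \<in> (LTp :: 'p sqmat set)} \<in> sets ?P"
      by measurable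
  qed
  ultimately show "emeasure ?P {b \<in> space ?P. mat_of lower b \<in> (LTp :: 'p sqmat set)} \<noteq> 0" by auto
qed

section \<open>Conditional means under the null distribution\<close>

definition gauss :: "('n::finite \<Rightarrow> real^'p) \<Rightarrow> real" where
  "gauss x = exp (- (\<Sum>i\<in>UNIV. (norm (x i))\<^sup>2) / 2)"

lemma gauss_pos: "0 < gauss x"
  by (simp add: gauss_def)

lemma measurable_gauss [measurable]: "gauss \<in> borel_measurable samples"
  unfolding gauss_def by measurable

definition sum_norm2 :: "('n::finite \<Rightarrow> real^'p) \<Rightarrow> real" where
  "sum_norm2 x = (\<Sum>i\<in>UNIV. (norm (x i))\<^sup>2)"

definition sum_norm4 :: "('n::finite \<Rightarrow> real^'p) \<Rightarrow> real" where
  "sum_norm4 x = (\<Sum>i\<in>UNIV. (norm (x i)) ^ 4)"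

lemma measurable_sum_norm [measurable]:
  "sum_norm2 \<in> borel_measurable samples" "sum_norm4 \<in> borel_measurable samples"
  unfolding sum_norm2_def sum_norm4_def by measurable

lemma sum_norm_nonneg: "0 \<le> sum_norm2 x" "0 \<le> sum_norm4 x"
  by (auto simp: sum_norm2_def sum_norm4_def intro!: sum_nonneg)

text \<open>
  With \<open>c < 1 / 2\<close> this dominates the product of \<open>gauss\<close> with a polynomial.
\<close>

lemma nn_integral_gauss_scaled_finite:
  assumes "0 < c"
  shows "(\<integral>\<^sup>+x. ennreal (exp (- (c * sum_norm2 x))) \<partial>(samples :: ('n::finite \<Rightarrow> real^'p) measure)) < \<infinity>"
proof -
  have real: "(\<integral>\<^sup>+t. ennreal (exp (- (c * t\<^sup>2))) \<partial>lborel) < \<infinity>"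
  proof -
    let ?s = "1 / sqrt (2 * c)"
    have s: "0 < ?s" "?s\<^sup>2 = 1 / (2 * c)" using assms by (simp_all add: power_divide)
    have "(\<integral>\<^sup>+t. ennreal (exp (- (c * t\<^sup>2))) \<partial>lborel) =
        (\<integral>\<^sup>+t. ennreal (sqrt (2 * pi * ?s\<^sup>2)) * ennreal (normal_density 0 ?s t) \<partial>lborel)"
      using assms by (intro nn_integral_cong)
        (simp add: normal_density_def ennreal_mult'[symmetric] s(2) field_simps)
    also have "\<dots> = ennreal (sqrt (2 * pi * ?s\<^sup>2)) * (\<integral>\<^sup>+t. ennreal (normal_density 0 ?s t) \<partial>lborel)"
      by (rule nn_integral_cmult) auto
    also have "(\<integral>\<^sup>+t. ennreal (normal_density 0 ?s t) \<partial>lborel) = 1"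
      using prob_space.emeasure_space_1[OF prob_space_normal_density[OF s(1), of 0]]
      by (simp add: emeasure_density)
    finally show ?thesis by (simp add: ennreal_less_top)
  qed
  have vec: "(\<integral>\<^sup>+v. ennreal (exp (- (c * (norm (v :: real^'p))\<^sup>2))) \<partial>lborel) < \<infinity>" 
  proof -
    have "(\<integral>\<^sup>+v. ennreal (exp (- (c * (norm (v :: real^'p))\<^sup>2))) \<partial>lborel) =
        (\<integral>\<^sup>+b. (\<Prod>j\<in>UNIV. ennreal (exp (- (c * (b j)\<^sup>2)))) \<partial>Pi\<^sub>M (UNIV :: 'p set) (\<lambda>_. lborel))"
    proof -
      have "exp (- (c * (norm (\<chi> j. b j))\<^sup>2)) = (\<Prod>j\<in>UNIV. exp (- (c * (b j)\<^sup>2)))" for b :: "'p \<Rightarrow> real"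
      proof -
        have "(norm (\<chi> j. b j))\<^sup>2 = (\<Sum>j\<in>UNIV. (b j)\<^sup>2)"
          unfolding power2_norm_eq_inner inner_vec_def by (simp add: power2_eq_square)
        then show ?thesis by (simp add: exp_sum[symmetric] sum_negf sum_distrib_left)
      qed
      then show ?thesis by (simp add: nn_integral_lborel_vec prod_ennreal)
    qed
    also have "\<dots> = (\<Prod>j\<in>(UNIV :: 'p set). (\<integral>\<^sup>+t. ennreal (exp (- (c * t\<^sup>2))) \<partial>lborel))"
      by (rule lborel_prod.product_nn_integral_prod) auto
    also have "\<dots> < \<infinity>" using real by (simp add: power_less_top_ennreal)
    finally show ?thesis .
  qed
  have "(\<integral>\<^sup>+x. ennreal (exp (- (c * sum_norm2 x))) \<partial>(samples :: ('n \<Rightarrow> real^'p) measure)) =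
      (\<integral>\<^sup>+x. (\<Prod>i\<in>UNIV. ennreal (exp (- (c * (norm (x i))\<^sup>2)))) \<partial>(samples :: ('n \<Rightarrow> real^'p) measure))"
    by (intro nn_integral_cong)
      (simp add: prod_ennreal exp_sum[symmetric] sum_norm2_def sum_negf sum_distrib_left)
  also have "\<dots> = (\<Prod>i\<in>(UNIV :: 'n set). (\<integral>\<^sup>+v. ennreal (exp (- (c * (norm (v :: real^'p))\<^sup>2))) \<partial>lborel))"
    by (rule lborel_prod.product_nn_integral_prod) auto
  also have "\<dots> < \<infinity>" using vec by (simp add: power_less_top_ennreal)
  finally show ?thesis .
qed

lemma nn_integral_gauss:
  "(\<integral>\<^sup>+x. ennreal (gauss x) \<partial>(samples :: ('n::finite \<Rightarrow> real^'p) measure)) < \<infinity>"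
  "(\<integral>\<^sup>+x. ennreal (gauss x) \<partial>(samples :: ('n::finite \<Rightarrow> real^'p) measure)) \<noteq> 0"
proof -
  let ?S = "samples :: ('n \<Rightarrow> real^'p) measure"
  show "(\<integral>\<^sup>+x. ennreal (gauss x) \<partial>?S) < \<infinity>"
    using nn_integral_gauss_scaled_finite[of "1/2", where 'n='n and 'p='p]
    by (simp add: gauss_def sum_norm2_def)
  show "(\<integral>\<^sup>+x. ennreal (gauss x) \<partial>?S) \<noteq> 0"
  proof
    assume "(\<integral>\<^sup>+x. ennreal (gauss x) \<partial>?S) = 0"
    then have "AE x in ?S. ennreal (gauss x) = 0"
      by (subst (asm) nn_integral_0_iff_AE) auto
    then have "AE x in ?S. False" by eventually_elim (metis ennreal_eq_0_iff gauss_pos not_le)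
    then have "emeasure ?S (space ?S) = 0" 
      using AE_iff_measurable[of "space ?S" ?S "\<lambda>_. False"] by auto
    moreover have "emeasure ?S (Pi\<^sub>E UNIV (\<lambda>_. UNIV)) = (\<Prod>i\<in>(UNIV::'n set). emeasure lborel (UNIV :: (real^'p) set))"
      by (rule lborel_prod.emeasure_PiM) auto
    ultimately show False by (simp add: space_PiM emeasure_lborel_UNIV)
  qed
qed

lemma sum_norm4_gauss_finite:
  "(\<integral>\<^sup>+x. ennreal (sum_norm4 x * gauss x) \<partial>(samples :: ('n::finite \<Rightarrow> real^'p) measure)) < \<infinity>"
proof -
  have bound: "sum_norm4 x * gauss x \<le> (64 * CARD('n)) * exp (- (1/4 * sum_norm2 x))" for x :: "'n \<Rightarrow> real^'p"
  proof -
    have "norm (x i) ^ 4 \<le> 64 * exp (sum_norm2 x / 4)" for i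
    proof -
      have "(norm (x i))\<^sup>2 \<le> sum_norm2 x"
        unfolding sum_norm2_def by (rule member_le_sum[of i UNIV "\<lambda>i. (norm (x i))\<^sup>2"]) auto
      moreover have "sum_norm2 x / 8 \<le> exp (sum_norm2 x / 8)"
        using exp_ge_add_one_self[of "sum_norm2 x / 8"] by linarith
      ultimately have "(norm (x i))\<^sup>2 \<le> 8 * exp (sum_norm2 x / 8)" by linarith
      then have "((norm (x i))\<^sup>2)\<^sup>2 \<le> (8 * exp (sum_norm2 x / 8))\<^sup>2" by (rule power_mono) simp
      then show ?thesis by (simp add: power_mult_distrib exp_double[symmetric] power_mult[symmetric])
    qed
    then have "sum_norm4 x \<le> (\<Sum>i\<in>(UNIV::'n set). 64 * exp (sum_norm2 x / 4))"
      unfolding sum_norm4_def by (rule sum_mono)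
    then have "sum_norm4 x * gauss x \<le> (64 * CARD('n) * exp (sum_norm2 x / 4)) * gauss x"
      by (intro mult_right_mono) (simp_all add: less_imp_le gauss_pos)
    also have "\<dots> = (64 * CARD('n)) * exp (- (1/4 * sum_norm2 x))"
      by (simp add: gauss_def sum_norm2_def[symmetric] mult.assoc exp_add[symmetric])
    finally show ?thesis .
  qed
  have "(\<integral>\<^sup>+x. ennreal (sum_norm4 x * gauss x) \<partial>(samples :: ('n \<Rightarrow> real^'p) measure)) \<le>
      (\<integral>\<^sup>+x. ennreal (64 * CARD('n)) * ennreal (exp (- (1/4 * sum_norm2 x))) \<partial>(samples :: ('n \<Rightarrow> real^'p) measure))"
    using bound by (intro nn_integral_mono) (simp add: ennreal_mult'[symmetric] ennreal_leI)
  also have "\<dots> = ennreal (64 * CARD('n)) * (\<integral>\<^sup>+x. ennreal (exp (- (1/4 * sum_norm2 x))) \<partial>(samples :: ('n \<Rightarrow> real^'p) measure))"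
    by (rule nn_integral_cmult) measurable
  also have "\<dots> < \<infinity>"
    using nn_integral_gauss_scaled_finite[of "1/4", where 'n='n and 'p='p]
    by (simp add: ennreal_mult_less_top)
  finally show ?thesis .
qed

lemma nn_integral_lborel_uminus:
  fixes F :: "'a::euclidean_space \<Rightarrow> ennreal"
  assumes [measurable]: "F \<in> borel_measurable borel"
  shows "(\<integral>\<^sup>+x. F (- x) \<partial>lborel) = (\<integral>\<^sup>+x. F x \<partial>lborel)"
  by (subst (2) lborel_affine[of "-1" 0]) (simp_all add: nn_integral_density nn_integral_distr)

lemma ennreal_eq_nonneg: "x < \<infinity> \<Longrightarrow> \<exists>r\<ge>0. x = ennreal r"
  by (cases x) auto

lemma ennreal_eq_positive: "x < \<infinity> \<Longrightarrow> x \<noteq> 0 \<Longrightarrow> \<exists>r>0. x = ennreal r"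
  by (cases x) (auto simp: order_less_le)

lemma standardized_std_sample:
  fixes z :: "'n::finite \<Rightarrow> real^'p::{finite,linorder}"
  assumes "std_sample z"
  shows "standardized z = z" "positive_definite (sample_cov z)"
proof -
  have "cholesky (mat 1 ** transpose (mat 1 :: 'p sqmat)) = mat 1"
    by (rule cholesky_mult_transpose[OF mat_1_LTp])
  then have "cholesky (mat 1 :: 'p sqmat) = mat 1" by (simp add: transpose_mat)
  moreover have "matrix_inv (mat 1 :: 'p sqmat) = mat 1" by (rule matrix_inv_eqI) simp
  ultimately show "standardized z = z"
    using assms by (simp add: fun_eq_iff standardized_def std_sample_def)
  show "positive_definite (sample_cov z)"
    unfolding positive_definite_sample_cov_iff using assms by (simp add: std_sample_def)
qed

lemma std_sample_nonzero:
  fixes z :: "'n::finite \<Rightarrow> real^'p"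
  assumes "std_sample z"
  shows "\<exists>i. z i \<noteq> 0"
proof (rule ccontr)
  assume "\<not> ?thesis"
  then have "real CARD('n) * ((axis j 1 :: real^'p) \<bullet> axis j 1) = 0" for j
    using std_sample_inner[OF assms, of "axis j 1" "axis j 1"] by simp
  then show False by (simp add: inner_axis_axis)
qed

lemma sum_norm4_reflect:
  fixes z :: "'n::finite \<Rightarrow> real^'p" and B :: "real^'p^'p"
  assumes z: "std_sample z"
  shows "sum_norm4 (\<lambda>i. a + B *v z i) + sum_norm4 (\<lambda>i. - a + B *v z i) =
    2 * (CARD('n) * (norm a ^ 4 + 2 * (norm a)\<^sup>2 * trace (transpose B ** B) + 4 * (norm (transpose B *v a))\<^sup>2)
      + (\<Sum>i\<in>UNIV. norm (B *v z i) ^ 4))"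
proof -
  have pair: "norm (a + v) ^ 4 + norm (- a + v) ^ 4 =
      2 * norm a ^ 4 + 4 * (norm a)\<^sup>2 * (norm v)\<^sup>2 + 2 * norm v ^ 4 + 8 * (a \<bullet> v)\<^sup>2" for v :: "real^'p"
  proof -
    have 4: "norm u ^ 4 = (u \<bullet> u)\<^sup>2" for u :: "real^'p"
      by (simp add: power2_norm_eq_inner[symmetric] power_mult[symmetric])
    show ?thesis
      unfolding 4 power2_norm_eq_inner
      by (simp add: inner_add inner_diff inner_commute[of v a] power2_eq_square algebra_simps)
  qed
  have "a \<bullet> (B *v z i) = z i \<bullet> (transpose B *v a)" for i
    by (simp add: inner_matrix_vector_transpose inner_commute)
  then have inner: "(\<Sum>i\<in>UNIV. (a \<bullet> (B *v z i))\<^sup>2) = CARD('n) * (norm (transpose B *v a))\<^sup>2"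
    using std_sample_inner[OF z, of "transpose B *v a" "transpose B *v a"]
    by (simp add: power2_norm_eq_inner) (simp add: power2_eq_square)
  show ?thesis
    unfolding sum_norm4_def sum.distrib[symmetric] pair
    by (simp add: sum.distrib sum_distrib_left[symmetric] inner std_sample_sum_norm_mult[OF z] algebra_simps)
qed

text \<open>
  Invariance as a pointwise equivalence, the form in which it can be used under an integral; see
  \<open>invariant_set_invariant_region\<close>.
\<close>

definition invariant_set :: "(real^'p^'p) set \<Rightarrow> ('n::finite \<Rightarrow> real^'p) set \<Rightarrow> bool" where
  "invariant_set G R \<longleftrightarrow> R \<in> sets samples \<and>
     (\<forall>a. \<forall>B\<in>G. \<forall>x. (\<lambda>i. a + B *v x i) \<in> R \<longleftrightarrow> x \<in> R)"

context matrix_group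
begin

text \<open>
  The common value of \<open>gauss\<close> at \<open>a + B z\<close> for all standardized samples \<open>z\<close> of size \<open>n\<close>.
\<close>

definition null_weight :: "nat \<Rightarrow> (real, 'p) vec \<Rightarrow> 'p sqmat \<Rightarrow> real" where
  "null_weight n a B = exp (- real n / 2 * (norm a)\<^sup>2) * exp (- real n / 2 * trace (transpose B ** B))"

definition group_mean :: "nat \<Rightarrow> ((real, 'p) vec \<Rightarrow> 'p sqmat \<Rightarrow> ennreal) \<Rightarrow> ennreal" where
  "group_mean n \<Phi> = (\<integral>\<^sup>+b. weight n (mat_of I b) *
     (\<integral>\<^sup>+a. \<Phi> a (mat_of I b) * ennreal (null_weight n a (mat_of I b)) \<partial>lborel) \<partial>coords I)"

lemma measurable_null_weight [measurable (raw)]: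
  assumes [measurable]: "f \<in> borel_measurable M" "g \<in> borel_measurable M"
  shows "(\<lambda>x. null_weight n (f x) (g x)) \<in> borel_measurable M"
  unfolding null_weight_def by measurable

lemma orbit_integral_gauss:
  fixes z :: "'n::finite \<Rightarrow> (real, 'p) vec"
  assumes "std_sample z"
  shows "orbit_integral (\<lambda>x. F x * ennreal (gauss x)) z = group_mean CARD('n) (\<lambda>a B. F (\<lambda>i. a + B *v z i))"
proof -
  have "gauss (\<lambda>i. a + B *v z i) = null_weight CARD('n) a B" for a B
    unfolding gauss_def null_weight_def std_sample_sum_norm_affine[OF assms] exp_add[symmetric]
    by (rule arg_cong[where f=exp]) (simp add: field_simps)
  then show ?thesis by (simp add: orbit_integral_def group_mean_def)
qed

lemma group_mean_cong:
  assumes "\<And>a B. B \<in> G \<Longrightarrow> \<Phi> a B = \<Psi> a B"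
  shows "group_mean n \<Phi> = group_mean n \<Psi>"
  unfolding group_mean_def
proof (rule nn_integral_cong)
  fix b
  show "weight n (mat_of I b) * (\<integral>\<^sup>+a. \<Phi> a (mat_of I b) * ennreal (null_weight n a (mat_of I b)) \<partial>lborel) =
     weight n (mat_of I b) * (\<integral>\<^sup>+a. \<Psi> a (mat_of I b) * ennreal (null_weight n a (mat_of I b)) \<partial>lborel)"
    using assms by (cases "mat_of I b \<in> G") (simp_all add: weight_def)
qed

lemma group_mean_add:
  assumes [measurable]: "(\<lambda>(a, B). \<Phi> a B) \<in> borel_measurable (borel \<Otimes>\<^sub>M borel)"
    "(\<lambda>(a, B). \<Psi> a B) \<in> borel_measurable (borel \<Otimes>\<^sub>M borel)"
  shows "group_mean n (\<lambda>a B. \<Phi> a B + \<Psi> a B) = group_mean n \<Phi> + group_mean n \<Psi>"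
  unfolding group_mean_def
  by (simp add: distrib_right nn_integral_add distrib_left)

lemma group_mean_cmult:
  assumes [measurable]: "(\<lambda>(a, B). \<Phi> a B) \<in> borel_measurable (borel \<Otimes>\<^sub>M borel)"
  shows "group_mean n (\<lambda>a B. c * \<Phi> a B) = c * group_mean n \<Phi>"
proof -
  have "group_mean n (\<lambda>a B. c * \<Phi> a B) = (\<integral>\<^sup>+b. c * (weight n (mat_of I b) *
     (\<integral>\<^sup>+a. \<Phi> a (mat_of I b) * ennreal (null_weight n a (mat_of I b)) \<partial>lborel)) \<partial>coords I)"
    unfolding group_mean_def by (intro nn_integral_cong) (simp add: mult.assoc nn_integral_cmult mult.left_commute)
  also have "\<dots> = c * group_mean n \<Phi>"
    unfolding group_mean_def by (rule nn_integral_cmult) measurable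
  finally show ?thesis .
qed

lemma orbit_integral_indicator:
  fixes z :: "'n::finite \<Rightarrow> (real, 'p) vec"
  assumes "invariant_set G R"
  shows "orbit_integral (\<lambda>x. indicator R x * F x) z = indicator R z * orbit_integral F z"
proof -
  have "weight CARD('n) B * (\<integral>\<^sup>+a. indicator R (\<lambda>i. a + B *v z i) * F (\<lambda>i. a + B *v z i) \<partial>lborel) =
      indicator R z * (weight CARD('n) B * (\<integral>\<^sup>+a. F (\<lambda>i. a + B *v z i) \<partial>lborel))" for B
  proof (cases "B \<in> G")
    case True
    then have "indicator R (\<lambda>i. a + B *v z i) = (indicator R z :: ennreal)" for a
      using assms by (auto simp: invariant_set_def indicator_def)
    then show ?thesis by (cases "z \<in> R") simp_all
  qed (simp add: weight_def)
  note key = this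
  show ?thesis unfolding orbit_integral_def key by (cases "z \<in> R") simp_all
qed

text \<open>
  By the disintegration an integral is determined by the averages over the orbits of standardized
  samples, and the indicator of an invariant set is constant on each orbit.
\<close>

lemma nn_integral_invariant_set_cong:
  fixes F F' :: "('n::finite \<Rightarrow> (real, 'p) vec) \<Rightarrow> ennreal"
  assumes n: "CARD('p) < CARD('n)" and R: "invariant_set G R"
    and F [measurable]: "F \<in> borel_measurable samples" "F' \<in> borel_measurable samples"
    and eq: "\<And>z :: 'n \<Rightarrow> (real, 'p) vec. std_sample z \<Longrightarrow>
      group_mean CARD('n) (\<lambda>a B. F (\<lambda>i. a + B *v z i)) = group_mean CARD('n) (\<lambda>a B. F' (\<lambda>i. a + B *v z i))"
  shows "(\<integral>\<^sup>+x. indicator R x * (F x * ennreal (gauss x)) \<partial>samples) =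
    (\<integral>\<^sup>+x. indicator R x * (F' x * ennreal (gauss x)) \<partial>samples)"
proof -
  obtain \<omega> :: "('n \<Rightarrow> (real, 'p) vec) \<Rightarrow> ennreal" where \<omega>:
    "\<And>F. F \<in> borel_measurable samples \<Longrightarrow>
      (\<integral>\<^sup>+x. F x \<partial>samples) = (\<integral>\<^sup>+y. \<omega> y * orbit_integral F (standardized y) \<partial>samples)"
    "\<And>y. \<not> positive_definite (sample_cov y) \<Longrightarrow> \<omega> y = 0"
    by (rule disintegration[OF n]) blast
  have [measurable]: "R \<in> sets samples" using R by (simp add: invariant_set_def)
  have "\<omega> y * orbit_integral (\<lambda>x. indicator R x * (F x * ennreal (gauss x))) (standardized y) =
      \<omega> y * orbit_integral (\<lambda>x. indicator R x * (F' x * ennreal (gauss x))) (standardized y)" for y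
  proof (cases "positive_definite (sample_cov y)")
    case True
    from std_sample_standardized[OF this] show ?thesis
      by (simp add: orbit_integral_indicator[OF R] orbit_integral_gauss eq)
  qed (simp add: \<omega>(2))
  then show ?thesis by (simp add: \<omega>(1))
qed

definition matrix_mean :: "nat \<Rightarrow> ('p sqmat \<Rightarrow> real) \<Rightarrow> ennreal" where
  "matrix_mean n h = (\<integral>\<^sup>+b. weight n (mat_of I b) *
     ennreal (exp (- real n / 2 * trace (transpose (mat_of I b) ** mat_of I b)) * h (mat_of I b)) \<partial>coords I)"

definition location_mass :: "nat \<Rightarrow> ennreal" where
  "location_mass n = (\<integral>\<^sup>+a. ennreal (exp (- real n / 2 * (norm (a :: (real, 'p) vec))\<^sup>2)) \<partial>lborel)"

definition fourth_moment :: "nat \<Rightarrow> (real, 'p) vec \<Rightarrow> ennreal" where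
  "fourth_moment n v = matrix_mean n (\<lambda>B. norm (B *v v) ^ 4)"

lemma group_mean_matrix:
  assumes [measurable]: "h \<in> borel_measurable borel" and "\<And>B. 0 \<le> h B"
  shows "group_mean n (\<lambda>a B. ennreal (h B)) = location_mass n * matrix_mean n h"
proof -
  have "(\<integral>\<^sup>+a. ennreal (h B) * ennreal (null_weight n a B) \<partial>lborel) =
     location_mass n * ennreal (exp (- real n / 2 * trace (transpose B ** B)) * h B)" for B
  proof -
    have "(\<integral>\<^sup>+a. ennreal (h B) * ennreal (null_weight n a B) \<partial>lborel) =
      (\<integral>\<^sup>+a. ennreal (exp (- real n / 2 * (norm (a :: (real, 'p) vec))\<^sup>2)) * ennreal (exp (- real n / 2 * trace (transpose B ** B)) * h B) \<partial>lborel)"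
      by (intro nn_integral_cong) (use assms(2)[of B] in \<open>simp add: null_weight_def ennreal_mult'[symmetric] mult_ac\<close>)
    then show ?thesis by (simp add: location_mass_def nn_integral_multc)
  qed
  then have "group_mean n (\<lambda>a B. ennreal (h B)) = (\<integral>\<^sup>+b. location_mass n * (weight n (mat_of I b) *
     ennreal (exp (- real n / 2 * trace (transpose (mat_of I b) ** mat_of I b)) * h (mat_of I b))) \<partial>coords I)"
    unfolding group_mean_def by (simp add: mult.left_commute)
  also have "\<dots> = location_mass n * matrix_mean n h"
    unfolding matrix_mean_def by (rule nn_integral_cmult) measurable
  finally show ?thesis .
qed

text \<open>
  The terms of \<open>sum_norm4 (\<lambda>i. a + B *v z i)\<close> that are even in \<open>a\<close> and involve \<open>a\<close>, summed for a
  standardized sample of size \<open>n\<close>.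
\<close>

definition rest :: "nat \<Rightarrow> (real, 'p) vec \<Rightarrow> 'p sqmat \<Rightarrow> real" where
  "rest n a B = real n * (norm a ^ 4 + 2 * (norm a)\<^sup>2 * trace (transpose B ** B) + 4 * (norm (transpose B *v a))\<^sup>2)"

lemma rest_nonneg: "0 \<le> rest n a B"
  by (auto simp: rest_def trace_transpose_mult intro!: mult_nonneg_nonneg add_nonneg_nonneg sum_nonneg)

lemma measurable_rest [measurable (raw)]:
  assumes [measurable]: "f \<in> borel_measurable M" "g \<in> borel_measurable M"
  shows "(\<lambda>x. rest n (f x) (g x)) \<in> borel_measurable M"
  unfolding rest_def by measurable

text \<open>
  Averaging over \<open>a\<close> and \<open>- a\<close> cancels the terms that are odd in \<open>a\<close>.  Of the remaining terms only the
  sum of \<open>norm (B z\<^sub>i) ^ 4\<close> depends on the standardized sample.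
\<close>

lemma group_mean_sum_norm4:
  fixes z :: "'n::finite \<Rightarrow> (real, 'p) vec"
  assumes z: "std_sample z"
  shows "group_mean CARD('n) (\<lambda>a B. ennreal (sum_norm4 (\<lambda>i. a + B *v z i))) =
    group_mean CARD('n) (\<lambda>a B. ennreal (rest CARD('n) a B)) +
    location_mass CARD('n) * (\<Sum>i\<in>UNIV. fourth_moment CARD('n) (z i))"
proof -
  let ?n = "CARD('n)"
  let ?s = "\<lambda>B. \<Sum>i\<in>UNIV. norm (B *v z i) ^ 4"
  have s: "0 \<le> ?s B" for B by (intro sum_nonneg) simp
  have "(\<integral>\<^sup>+a. ennreal (sum_norm4 (\<lambda>i. a + B *v z i)) * ennreal (null_weight ?n a B) \<partial>lborel) =
     (\<integral>\<^sup>+a. ennreal (rest ?n a B + ?s B) * ennreal (null_weight ?n a B) \<partial>lborel)" for B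
  proof -
    let ?F = "\<lambda>a. ennreal (sum_norm4 (\<lambda>i. a + B *v z i)) * ennreal (null_weight ?n a B)"
    let ?Q = "\<lambda>a. ennreal (rest ?n a B + ?s B) * ennreal (null_weight ?n a B)"
    have [measurable]: "?F \<in> borel_measurable borel" by measurable
    have F: "?F \<in> borel_measurable lborel" "(\<lambda>a. ?F (- a)) \<in> borel_measurable lborel" by measurable
    have "2 * (\<integral>\<^sup>+a. ?F a \<partial>lborel) = (\<integral>\<^sup>+a. ?F a \<partial>lborel) + (\<integral>\<^sup>+a. ?F (- a) \<partial>lborel)"
      by (subst nn_integral_lborel_uminus[of ?F]) (simp_all add: mult_2)
    also have "\<dots> = (\<integral>\<^sup>+a. ?F a + ?F (- a) \<partial>lborel)"
      using F by (rule nn_integral_add[symmetric])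
    also have "\<dots> = (\<integral>\<^sup>+a. 2 * ?Q a \<partial>lborel)"
    proof (rule nn_integral_cong)
      fix a
      have "?F a + ?F (- a) = ennreal (sum_norm4 (\<lambda>i. a + B *v z i) + sum_norm4 (\<lambda>i. - a + B *v z i)) * ennreal (null_weight ?n a B)"
        by (simp add: null_weight_def sum_norm_nonneg distrib_right)
      also have "\<dots> = ennreal (2 * (rest ?n a B + ?s B)) * ennreal (null_weight ?n a B)"
        unfolding sum_norm4_reflect[OF z] rest_def by (simp add: algebra_simps)
      also have "\<dots> = 2 * ?Q a"
      proof -
        have "ennreal (2 * t) = 2 * ennreal t" if "0 \<le> t" for t
          using ennreal_mult'[of 2 t] by simp
        then show ?thesis
          using rest_nonneg[of ?n a B] s[of B] by (simp only: mult.assoc add_nonneg_nonneg)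
      qed
      finally show "?F a + ?F (- a) = 2 * ?Q a" .
    qed
    also have "\<dots> = 2 * (\<integral>\<^sup>+a. ?Q a \<partial>lborel)"
      by (rule nn_integral_cmult) measurable
    finally show ?thesis by (simp add: ennreal_mult_cancel_left)
  qed
  note inner = this
  have "group_mean ?n (\<lambda>a B. ennreal (sum_norm4 (\<lambda>i. a + B *v z i))) =
      group_mean ?n (\<lambda>a B. ennreal (rest ?n a B + ?s B))"
    by (simp only: group_mean_def inner)
  also have "\<dots> = group_mean ?n (\<lambda>a B. ennreal (rest ?n a B) + ennreal (?s B))"
    by (simp only: ennreal_plus[OF rest_nonneg s])
  also have "\<dots> = group_mean ?n (\<lambda>a B. ennreal (rest ?n a B)) + group_mean ?n (\<lambda>a B. ennreal (?s B))"
    by (rule group_mean_add) measurable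
  also have "group_mean ?n (\<lambda>a B. ennreal (?s B)) = location_mass ?n * matrix_mean ?n ?s"
    using s by (intro group_mean_matrix) measurable
  also have "matrix_mean ?n ?s = (\<Sum>i\<in>UNIV. fourth_moment ?n (z i))"
    unfolding fourth_moment_def matrix_mean_def
    by (subst nn_integral_sum[symmetric], measurable, intro nn_integral_cong)
      (simp add: sum_distrib_left[symmetric] sum_ennreal)
  finally show ?thesis .
qed

lemma group_mean_sum_norm2:
  fixes z :: "'n::finite \<Rightarrow> (real, 'p) vec"
  assumes z: "std_sample z"
  shows "group_mean CARD('n) (\<lambda>a B. ennreal (sum_norm2 (\<lambda>i. a + B *v z i))) =
    group_mean CARD('n) (\<lambda>a B. ennreal (CARD('n) * (norm a)\<^sup>2 + CARD('n) * trace (transpose B ** B)))"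
  by (simp add: sum_norm2_def std_sample_sum_norm_affine[OF z])

text \<open>
  The bounds are inherited, through the disintegration, from the integrals over all samples of \<open>gauss\<close> and
  of its product with \<open>sum_norm4\<close>; the average of \<open>sum_norm4\<close> could a priori be infinite on a null set of orbits.
\<close>

lemma group_mean_bounds:
  assumes n: "CARD('p) < CARD('n::finite)"
  shows "group_mean CARD('n) (\<lambda>_ _. 1) < \<infinity>" "group_mean CARD('n) (\<lambda>_ _. 1) \<noteq> 0"
    and "group_mean CARD('n) (\<lambda>a B. ennreal (rest CARD('n) a B)) < \<infinity>"
    and "\<exists>z :: 'n::finite \<Rightarrow> (real, 'p) vec. std_sample z \<and>
      group_mean CARD('n) (\<lambda>a B. ennreal (sum_norm4 (\<lambda>i. a + B *v z i))) < \<infinity>"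
proof -
  let ?S = "samples :: ('n \<Rightarrow> (real, 'p) vec) measure"
  let ?n = "CARD('n)"
  obtain \<omega> :: "('n \<Rightarrow> (real, 'p) vec) \<Rightarrow> ennreal" where \<omega>: "\<omega> \<in> borel_measurable ?S"
    "\<And>F. F \<in> borel_measurable samples \<Longrightarrow>
      (\<integral>\<^sup>+x. F x \<partial>?S) = (\<integral>\<^sup>+y. \<omega> y * orbit_integral F (standardized y) \<partial>?S)"
    "\<And>y. \<not> positive_definite (sample_cov y) \<Longrightarrow> \<omega> y = 0"
    by (rule disintegration[OF n]) blast
  note [measurable] = \<omega>(1)
  define \<Omega> where "\<Omega> = (\<integral>\<^sup>+y. \<omega> y \<partial>?S)"
  have orbit: "\<omega> y * orbit_integral (\<lambda>x. F x * ennreal (gauss x)) (standardized y) =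
      \<omega> y * group_mean ?n (\<lambda>a B. F (\<lambda>i. a + B *v standardized y i))" for F y
    using std_sample_standardized[of y] \<omega>(3)[of y] by (cases "positive_definite (sample_cov y)") (simp_all add: orbit_integral_gauss)
  have "(\<integral>\<^sup>+x. 1 * ennreal (gauss x) \<partial>?S) = (\<integral>\<^sup>+y. \<omega> y * group_mean ?n (\<lambda>_ _. 1) \<partial>?S)"
    by (subst \<omega>(2)) (simp_all only: orbit, measurable)
  then have mass: "(\<integral>\<^sup>+x. ennreal (gauss x) \<partial>?S) = \<Omega> * group_mean ?n (\<lambda>_ _. 1)"
    by (simp add: nn_integral_multc \<Omega>_def)
  then have \<Omega>: "\<Omega> \<noteq> 0" and pos: "group_mean ?n (\<lambda>_ _. 1) \<noteq> 0"
    using nn_integral_gauss(2)[where 'n='n and 'p='p] by auto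
  then show "group_mean ?n (\<lambda>_ _. 1) < \<infinity>" "group_mean ?n (\<lambda>_ _. 1) \<noteq> 0"
    using mass nn_integral_gauss(1)[where 'n='n and 'p='p] by (auto simp: ennreal_mult_less_top)
  let ?J = "\<lambda>z :: 'n \<Rightarrow> (real, 'p) vec. group_mean ?n (\<lambda>a B. ennreal (sum_norm4 (\<lambda>i. a + B *v z i)))"
  have "(\<integral>\<^sup>+x. ennreal (sum_norm4 x) * ennreal (gauss x) \<partial>?S) = (\<integral>\<^sup>+y. \<omega> y * ?J (standardized y) \<partial>?S)"
    by (subst \<omega>(2)) (simp_all only: orbit, measurable)
  then have fin: "(\<integral>\<^sup>+y. \<omega> y * ?J (standardized y) \<partial>?S) < \<infinity>"
    using sum_norm4_gauss_finite[where 'n='n and 'p='p]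
    by (simp add: ennreal_mult' sum_norm_nonneg less_imp_le[OF gauss_pos])
  have "\<exists>y. \<omega> y \<noteq> 0 \<and> ?J (standardized y) < \<infinity>"
  proof (rule ccontr)
    assume "\<not> ?thesis"
    then have "\<omega> y * \<infinity> \<le> \<omega> y * ?J (standardized y)" for y
      by (cases "\<omega> y = 0") (auto simp: less_top[symmetric])
    then have "(\<integral>\<^sup>+y. \<omega> y * \<infinity> \<partial>?S) \<le> (\<integral>\<^sup>+y. \<omega> y * ?J (standardized y) \<partial>?S)"
      by (intro nn_integral_mono)
    then have "\<Omega> * \<infinity> < \<infinity>" using fin by (simp add: nn_integral_multc \<Omega>_def)
    then show False using \<Omega> by (simp add: ennreal_mult_less_top)
  qed
  then obtain y where y: "\<omega> y \<noteq> 0" "?J (standardized y) < \<infinity>" by blast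
  have z: "std_sample (standardized y)" using y(1) \<omega>(3) std_sample_standardized by blast
  then show "\<exists>z :: 'n \<Rightarrow> (real, 'p) vec. std_sample z \<and> ?J z < \<infinity>" using y(2) by blast
  show "group_mean ?n (\<lambda>a B. ennreal (rest ?n a B)) < \<infinity>"
    using y(2) unfolding group_mean_sum_norm4[OF z] by simp
qed

lemma group_mean_one: "group_mean n (\<lambda>_ _. 1) = location_mass n * matrix_mean n (\<lambda>_. 1)"
  using group_mean_matrix[of "\<lambda>_. 1" n] by simp

text \<open>
  Under the null distribution \<open>\<alpha> + \<beta> * (\<Sum>i. L (z i))\<close> is the conditional mean of \<open>sum_norm4\<close> given the
  standardized sample \<open>z\<close>, and the constant \<open>\<gamma>\<close> is that of \<open>sum_norm2\<close>: both sides have the same average over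
  every orbit.
\<close>

lemma conditional_means:
  fixes L :: "(real, 'p) vec \<Rightarrow> real"
  assumes n: "CARD('p) < CARD('n::finite)"
    and w: "0 < w" and L [measurable]: "L \<in> borel_measurable borel" and L0: "\<And>v. 0 \<le> L v"
    and moment: "\<And>v. fourth_moment CARD('n) v = ennreal w * ennreal (L v)"
    and L_inv: "\<And>a B i (x :: 'n::finite \<Rightarrow> (real, 'p) vec). B \<in> G \<Longrightarrow> positive_definite (sample_cov x) \<Longrightarrow>
      L (standardized (\<lambda>i. a + B *v x i) i) = L (standardized x i)"
  obtains \<alpha> \<beta> \<gamma> :: real where "0 \<le> \<alpha>" "0 < \<beta>" "0 \<le> \<gamma>"
    "\<And>R :: ('n::finite \<Rightarrow> (real, 'p) vec) set. invariant_set G R \<Longrightarrow>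
      (\<integral>\<^sup>+x. indicator R x * (ennreal (sum_norm4 x) * ennreal (gauss x)) \<partial>samples) =
      (\<integral>\<^sup>+x. indicator R x * (ennreal (\<alpha> + \<beta> * (\<Sum>i\<in>UNIV. L (standardized x i))) * ennreal (gauss x)) \<partial>samples)"
    "\<And>R :: ('n::finite \<Rightarrow> (real, 'p) vec) set. invariant_set G R \<Longrightarrow>
      (\<integral>\<^sup>+x. indicator R x * (ennreal (sum_norm2 x) * ennreal (gauss x)) \<partial>samples) =
      (\<integral>\<^sup>+x. indicator R x * (ennreal \<gamma> * ennreal (gauss x)) \<partial>samples)"
proof -
  let ?n = "CARD('n)"
  let ?A = "location_mass ?n"
  note bounds = group_mean_bounds[OF n]
  let ?one = "group_mean ?n (\<lambda>_ _. 1)"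
  let ?rest = "group_mean ?n (\<lambda>a B. ennreal (rest ?n a B))"
  obtain m where m: "?one = ennreal m" "0 < m"
    using ennreal_eq_positive[OF bounds(1,2)] by blast
  obtain c where c: "?rest = ennreal c" "0 \<le> c"
    using ennreal_eq_nonneg[OF bounds(3)] by blast
  have "?A \<noteq> 0" "?A < \<infinity>"
    using bounds(1,2) unfolding group_mean_one by (auto simp: ennreal_mult_less_top)
  then obtain A where A: "?A = ennreal A" "0 < A"
    using ennreal_eq_positive by blast
  define \<alpha> \<beta> where "\<alpha> = c / m" and "\<beta> = A * w / m"
  let ?L = "\<lambda>x :: 'n \<Rightarrow> (real, 'p) vec. \<Sum>i\<in>UNIV. L (standardized x i)"
  have \<alpha>\<beta>: "0 \<le> \<alpha>" "0 < \<beta>" using m c A w by (simp_all add: \<alpha>_def \<beta>_def)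
  have four: "(\<integral>\<^sup>+x. indicator R x * (ennreal (sum_norm4 x) * ennreal (gauss x)) \<partial>samples) =
      (\<integral>\<^sup>+x. indicator R x * (ennreal (\<alpha> + \<beta> * ?L x) * ennreal (gauss x)) \<partial>samples)"
    if R: "invariant_set G R" for R
  proof (rule nn_integral_invariant_set_cong[OF n R])
    fix z :: "'n \<Rightarrow> (real, 'p) vec" assume z: "std_sample z"
    let ?s = "\<Sum>i\<in>UNIV. L (z i)"
    have s: "0 \<le> ?s" using L0 by (intro sum_nonneg) auto
    have "group_mean ?n (\<lambda>a B. ennreal (sum_norm4 (\<lambda>i. a + B *v z i))) =
        ennreal c + ennreal A * (\<Sum>i\<in>UNIV. ennreal (w * L (z i)))"
      using w L0 by (simp add: group_mean_sum_norm4[OF z] c A moment ennreal_mult')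
    also have "\<dots> = ennreal (c + A * (w * ?s))"
      using w L0 A c s by (simp add: sum_ennreal sum_distrib_left[symmetric] ennreal_mult'[symmetric] ennreal_plus[symmetric] del: ennreal_plus)
    also have "c + A * (w * ?s) = (\<alpha> + \<beta> * ?s) * m"
      using m by (simp add: \<alpha>_def \<beta>_def field_simps)
    also have "ennreal \<dots> = ennreal (\<alpha> + \<beta> * ?s) * ?one"
      using \<alpha>\<beta> s m by (simp add: ennreal_mult')
    also have "\<dots> = group_mean ?n (\<lambda>a B. ennreal (\<alpha> + \<beta> * ?s) * 1)"
      by (rule group_mean_cmult[symmetric]) measurable
    also have "\<dots> = group_mean ?n (\<lambda>a B. ennreal (\<alpha> + \<beta> * ?L (\<lambda>i. a + B *v z i)))"
      by (rule group_mean_cong) (simp add: L_inv standardized_std_sample[OF z])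
    finally show "group_mean ?n (\<lambda>a B. ennreal (sum_norm4 (\<lambda>i. a + B *v z i))) =
        group_mean ?n (\<lambda>a B. ennreal (\<alpha> + \<beta> * ?L (\<lambda>i. a + B *v z i)))" .
  qed measurable
  let ?two = "group_mean ?n (\<lambda>a B. ennreal (?n * (norm a)\<^sup>2 + ?n * trace (transpose B ** B)))"
  have "?two < \<infinity>"
  proof -
    obtain z :: "'n \<Rightarrow> (real, 'p) vec" where z: "std_sample z"
      "group_mean ?n (\<lambda>a B. ennreal (sum_norm4 (\<lambda>i. a + B *v z i))) < \<infinity>"
      using bounds(4) by blast
    have le: "sum_norm2 x \<le> ?n + sum_norm4 x" for x :: "'n \<Rightarrow> (real, 'p) vec"
    proof -
      have "t\<^sup>2 \<le> 1 + t ^ 4" for t :: real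
        using zero_le_power2[of "t\<^sup>2 - 1/2"] by (simp add: power2_eq_square algebra_simps power4_eq_xxxx)
      then have "sum_norm2 x \<le> (\<Sum>i\<in>(UNIV :: 'n set). 1 + norm (x i) ^ 4)"
        unfolding sum_norm2_def by (intro sum_mono)
      then show ?thesis by (simp add: sum_norm4_def sum.distrib)
    qed
    have "?two = group_mean ?n (\<lambda>a B. ennreal (sum_norm2 (\<lambda>i. a + B *v z i)))"
      by (rule group_mean_sum_norm2[OF z(1), symmetric])
    also have "\<dots> \<le> group_mean ?n (\<lambda>a B. ennreal (?n) * 1 + ennreal (sum_norm4 (\<lambda>i. a + B *v z i)))"
      unfolding group_mean_def using le
      by (intro nn_integral_mono mult_mono) (simp_all add: sum_norm_nonneg ennreal_plus[symmetric] ennreal_leI del: ennreal_plus)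
    also have "\<dots> = group_mean ?n (\<lambda>a B. ennreal (?n) * 1) + group_mean ?n (\<lambda>a B. ennreal (sum_norm4 (\<lambda>i. a + B *v z i)))"
      by (rule group_mean_add) measurable
    also have "group_mean ?n (\<lambda>a B. ennreal (?n) * 1) = ennreal ?n * ?one"
      by (rule group_mean_cmult) measurable
    finally show ?thesis using z(2) m by (auto simp: ennreal_mult_eq_top_iff less_top[symmetric] top_unique)
  qed
  then obtain t where t: "?two = ennreal t" "0 \<le> t"
    using ennreal_eq_nonneg by blast
  define \<gamma> where "\<gamma> = t / m"
  have \<gamma>: "0 \<le> \<gamma>" using t m by (simp add: \<gamma>_def)
  have two: "(\<integral>\<^sup>+x. indicator R x * (ennreal (sum_norm2 x) * ennreal (gauss x)) \<partial>samples) =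
      (\<integral>\<^sup>+x. indicator R x * (ennreal \<gamma> * ennreal (gauss x)) \<partial>samples)"
    if R: "invariant_set G R" for R :: "('n \<Rightarrow> (real, 'p) vec) set"
  proof (rule nn_integral_invariant_set_cong[OF n R])
    fix z :: "'n \<Rightarrow> (real, 'p) vec" assume z: "std_sample z"
    have "ennreal t = ennreal \<gamma> * ?one" using m \<gamma> by (simp add: \<gamma>_def ennreal_mult'[symmetric])
    also have "\<dots> = group_mean ?n (\<lambda>a B. ennreal \<gamma> * 1)"
      by (rule group_mean_cmult[symmetric]) measurable
    finally show "group_mean ?n (\<lambda>a B. ennreal (sum_norm2 (\<lambda>i. a + B *v z i))) = group_mean ?n (\<lambda>a B. ennreal \<gamma>)"
      by (simp add: group_mean_sum_norm2[OF z] t)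
  qed measurable
  from that[OF \<alpha>\<beta> \<gamma> four two] show ?thesis .
qed

end

section \<open>The fourth moment over the general linear group\<close>

lemma abs_det_orthogonal:
  fixes Q :: "real^'p^'p"
  assumes "transpose Q ** Q = mat 1"
  shows "\<bar>det Q\<bar> = 1"
proof -
  have "(det Q)\<^sup>2 = 1"
    using arg_cong[OF assms, of det] by (simp add: det_mul power2_eq_square)
  then show ?thesis by (simp only: abs_square_eq_1)
qed

lemma nn_integral_mult_orthogonal:
  fixes Q :: "real^'p^'p" and F :: "real^'p^'p \<Rightarrow> ennreal"
  assumes Q: "transpose Q ** Q = mat 1" and [measurable]: "F \<in> borel_measurable borel"
  shows "(\<integral>\<^sup>+B. F B \<partial>lborel) = (\<integral>\<^sup>+B. F (B ** Q) \<partial>lborel)"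
proof -
  have det: "\<bar>det (transpose Q)\<bar> = 1" using abs_det_orthogonal[OF Q] by simp
  have rows: "(\<chi> j. 0 + transpose Q *v r j) = (\<chi> j. r j) ** Q" for r :: "'p \<Rightarrow> real^'p"
    by (simp add: vec_eq_iff matrix_matrix_mult_def matrix_vector_mult_def transpose_def mult.commute)
  have "(\<integral>\<^sup>+B. F B \<partial>lborel) = (\<integral>\<^sup>+r. F (\<chi> j. r j) \<partial>samples)"
    by (rule nn_integral_lborel_vec) measurable
  also have "\<dots> = ennreal (\<bar>det (transpose Q)\<bar> ^ CARD('p)) * (\<integral>\<^sup>+r. F (\<chi> j. 0 + transpose Q *v r j) \<partial>samples)"
    by (rule nn_integral_samples_affine[where a="\<lambda>_. 0"]) (use det in auto)
  also have "\<dots> = (\<integral>\<^sup>+r. F ((\<chi> j. r j) ** Q) \<partial>samples)"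
    unfolding rows det by simp
  also have "\<dots> = (\<integral>\<^sup>+B. F (B ** Q) \<partial>lborel)"
    by (rule nn_integral_lborel_vec[symmetric]) measurable
  finally show ?thesis .
qed

global_interpretation GL: matrix_group UNIV GLp GL_density
  by (rule matrix_group_GL)

global_interpretation LT: matrix_group lower LTp LT_density
  by (rule matrix_group_LT)

lemma GL_matrix_mean:
  fixes h :: "'p::{finite,linorder} sqmat \<Rightarrow> real"
  assumes [measurable]: "h \<in> borel_measurable borel"
  shows "GL.matrix_mean n h = (\<integral>\<^sup>+B. GL.weight n B * ennreal (exp (- real n / 2 * trace (transpose B ** B)) * h B) \<partial>lborel)"
  by (subst lborel_eq_distr_matrix) (simp add: nn_integral_distr GL.matrix_mean_def mat_of_def)

text \<open>
  The measure is invariant under multiplication by orthogonal matrices from the right, and these act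
  transitively on spheres.
\<close>

lemma GL_fourth_moment:
  fixes v e :: "(real, 'p::{finite,linorder}) vec"
  assumes e: "norm e = 1"
  shows "GL.fourth_moment n v = GL.fourth_moment n e * ennreal (norm v ^ 4)"
proof -
  obtain f where f: "orthogonal_transformation f" "f (norm v *\<^sub>R e) = v"
    using orthogonal_transformation_exists[of "norm v *\<^sub>R e" v] e by auto
  define Q where "Q = matrix f"
  have lin: "linear f" using f(1) by (rule orthogonal_transformation_linear)
  have Q: "transpose Q ** Q = mat 1"
    using f(1) by (simp add: orthogonal_transformation_matrix orthogonal_matrix Q_def)
  have Qv: "norm v *\<^sub>R (Q *v e) = v"
    using f(2) fun_cong[OF matrix_vector_mul(2)[OF lin], of "norm v *\<^sub>R e"] by (simp add: Q_def matrix_vector_mult_scaleR)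
  have Q': "Q ** transpose Q = mat 1" using Q matrix_left_right_inverse by blast
  have detQ: "\<bar>det Q\<bar> = 1" by (rule abs_det_orthogonal[OF Q])
  have w: "GL.weight n (B ** Q) = GL.weight n B" for B :: "'p sqmat"
  proof -
    have "B ** Q \<in> GLp \<longleftrightarrow> B \<in> GLp" using detQ by (auto simp: GLp_def invertible_det_nz det_mul)
    then show ?thesis using detQ by (simp add: GL.weight_def indicator_def GL_density_def det_mul abs_mult)
  qed
  have tr: "trace (transpose (B ** Q) ** (B ** Q)) = trace (transpose B ** B)" for B :: "'p sqmat"
  proof -
    have "trace (transpose (B ** Q) ** (B ** Q)) = trace (transpose Q ** (transpose B ** B ** Q))"
      by (simp add: matrix_transpose_mul matrix_mul_assoc)
    also have "\<dots> = trace (transpose B ** B ** Q ** transpose Q)" by (rule trace_mul_sym)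
    also have "\<dots> = trace (transpose B ** B ** (Q ** transpose Q))" by (simp only: matrix_mul_assoc)
    finally show ?thesis by (simp add: Q')
  qed
  have [measurable]: "(\<lambda>B :: 'p sqmat. norm (B *v u) ^ 4) \<in> borel_measurable borel" for u by measurable
  let ?k = "\<lambda>B. GL.weight n B * ennreal (exp (- real n / 2 * trace (transpose B ** B)) * norm (B *v e) ^ 4)"
  have "GL.fourth_moment n v = (\<integral>\<^sup>+B. ennreal (norm v ^ 4) * ?k (B ** Q) \<partial>lborel)"
    unfolding GL.fourth_moment_def
  proof (subst GL_matrix_mean, measurable, rule nn_integral_cong)
    fix B :: "'p sqmat"
    have "norm (B *v v) = norm v * norm (B ** Q *v e)"
      by (subst Qv[symmetric]) (simp add: matrix_vector_mult_scaleR matrix_vector_mul_assoc)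
    then show "GL.weight n B * ennreal (exp (- real n / 2 * trace (transpose B ** B)) * norm (B *v v) ^ 4) =
        ennreal (norm v ^ 4) * ?k (B ** Q)"
      unfolding w tr by (simp add: power_mult_distrib ennreal_mult' mult_ac)
  qed
  also have "\<dots> = ennreal (norm v ^ 4) * (\<integral>\<^sup>+B. ?k (B ** Q) \<partial>lborel)"
    by (rule nn_integral_cmult) measurable
  also have "(\<integral>\<^sup>+B. ?k (B ** Q) \<partial>lborel) = GL.fourth_moment n e"
    unfolding GL.fourth_moment_def
    by (subst GL_matrix_mean, measurable) (rule nn_integral_mult_orthogonal[OF Q, symmetric], measurable)
  finally show ?thesis by (simp add: mult.commute)
qed

text \<open>
  It is finite as part of a finite group average of \<open>sum_norm4\<close>; were it zero, then \<open>B e = 0\<close> for almost every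
  \<open>B\<close>.
\<close>

lemma GL_fourth_moment_bounds:
  fixes e :: "(real, 'p::{finite,linorder}) vec"
  assumes n: "CARD('p) < CARD('n::finite)" and e: "norm e = 1"
  shows "GL.fourth_moment CARD('n) e < \<infinity>" "GL.fourth_moment CARD('n) e \<noteq> 0"
proof -
  let ?n = "CARD('n)"
  note bounds = GL.group_mean_bounds[OF n]
  have nz: "GL.location_mass TYPE('p) ?n * GL.matrix_mean ?n (\<lambda>_ :: 'p sqmat. 1) \<noteq> 0"
    using bounds(2) by (simp add: GL.group_mean_one)
  obtain z :: "'n \<Rightarrow> (real, 'p) vec" where z: "std_sample z"
    "GL.group_mean ?n (\<lambda>a B. ennreal (sum_norm4 (\<lambda>i. a + B *v z i))) < \<infinity>"
    using bounds(4) by blast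
  obtain i where i: "z i \<noteq> 0" using std_sample_nonzero[OF z(1)] by blast
  have "GL.location_mass TYPE('p) ?n * (\<Sum>i\<in>UNIV. GL.fourth_moment ?n (z i)) < \<infinity>"
    using z(2) unfolding GL.group_mean_sum_norm4[OF z(1)] by simp
  then have "(\<Sum>i\<in>UNIV. GL.fourth_moment ?n (z i)) < \<infinity>"
    using nz by (auto simp: ennreal_mult_less_top)
  then have "GL.fourth_moment ?n (z i) < \<infinity>" by simp
  then show "GL.fourth_moment ?n e < \<infinity>"
    using i by (auto simp: GL_fourth_moment[OF e, of ?n "z i"] ennreal_mult_less_top)
  show "GL.fourth_moment ?n e \<noteq> 0"
  proof
    let ?c = "\<lambda>b. exp (- real ?n / 2 * trace (transpose (mat_of UNIV b) ** mat_of UNIV b :: 'p sqmat))"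
    assume "GL.fourth_moment ?n e = 0"
    then have "AE b in coords UNIV. GL.weight ?n (mat_of UNIV b) *
        ennreal (?c b * norm (mat_of UNIV b *v e) ^ 4) = 0"
      unfolding GL.fourth_moment_def GL.matrix_mean_def by (subst (asm) nn_integral_0_iff_AE) auto
    then have "AE b in coords UNIV. GL.weight ?n (mat_of UNIV b) * ennreal (?c b * 1) = 0"
    proof eventually_elim
      case (elim b)
      show ?case
      proof (cases "mat_of UNIV b \<in> (GLp :: 'p sqmat set)")
        case True
        then have inv: "invertible (mat_of UNIV b :: 'p sqmat)" by (simp add: GLp_def)
        have "mat_of UNIV b *v e \<noteq> 0"
        proof
          assume "mat_of UNIV b *v e = 0"
          then have "matrix_inv (mat_of UNIV b) *v (mat_of UNIV b *v e) = 0" by simp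
          then show False using e by (simp add: matrix_vector_mul_assoc matrix_inv_mult[OF inv])
        qed
        then have "ennreal (?c b * norm (mat_of UNIV b *v e) ^ 4) \<noteq> 0"
          by (auto simp: ennreal_eq_0_iff not_le)
        then show ?thesis using elim by simp
      qed (simp add: GL.weight_def)
    qed
    then have "GL.matrix_mean ?n (\<lambda>_ :: 'p sqmat. 1) = 0"
      unfolding GL.matrix_mean_def by (subst nn_integral_0_iff_AE) auto
    then show False using nz by simp
  qed
qed

section \<open>The fourth moment over the lower triangular group\<close>

lemma nn_integral_poly_even:
  fixes h :: "real \<Rightarrow> real"
  assumes [measurable]: "h \<in> borel_measurable borel" and h0: "\<And>t. 0 \<le> h t"
    and m0: "(\<integral>\<^sup>+t. ennreal (h t) \<partial>lborel) = 1"
    and m2: "(\<integral>\<^sup>+t. ennreal (h t * t\<^sup>2) \<partial>lborel) = ennreal s"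
    and m4: "(\<integral>\<^sup>+t. ennreal (h t * t ^ 4) \<partial>lborel) = ennreal r"
    and odd: "(\<forall>t. h (- t) = h t) \<or> (B = 0 \<and> D = 0)"
    and nonneg: "0 \<le> A" "0 \<le> C" "0 \<le> E" "0 \<le> s" "0 \<le> r"
      "\<And>t. 0 \<le> A + B * t + C * t\<^sup>2 + D * t ^ 3 + E * t ^ 4"
  shows "(\<integral>\<^sup>+t. ennreal (h t * (A + B * t + C * t\<^sup>2 + D * t ^ 3 + E * t ^ 4)) \<partial>lborel) = ennreal (A + C * s + E * r)"
proof -
  have even: "(\<integral>\<^sup>+t. ennreal (h t * (A + C * t\<^sup>2 + E * t ^ 4)) \<partial>lborel) = ennreal (A + C * s + E * r)"
  proof -
    have "(\<integral>\<^sup>+t. ennreal (h t * (A + C * t\<^sup>2 + E * t ^ 4)) \<partial>lborel) =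
      (\<integral>\<^sup>+t. ennreal A * ennreal (h t) + ennreal C * ennreal (h t * t\<^sup>2) + ennreal E * ennreal (h t * t ^ 4) \<partial>lborel)"
      using h0 nonneg
      by (intro nn_integral_cong) (simp add: ennreal_mult'[symmetric] ennreal_plus[symmetric] algebra_simps del: ennreal_plus)
    also have "\<dots> = ennreal A * 1 + ennreal C * ennreal s + ennreal E * ennreal r"
      by (simp add: nn_integral_add nn_integral_cmult m0 m2 m4)
    also have "\<dots> = ennreal (A + C * s + E * r)"
      using nonneg by (simp add: ennreal_mult')
    finally show ?thesis .
  qed
  show ?thesis
  proof (cases "B = 0 \<and> D = 0")
    case True
    then show ?thesis using even by simp
  next
    case False
    let ?f = "\<lambda>t. ennreal (h t * (A + B * t + C * t\<^sup>2 + D * t ^ 3 + E * t ^ 4))"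
    have [measurable]: "?f \<in> borel_measurable borel" by measurable
    have sym: "h (- t) = h t" for t using odd False by blast
    have "2 * (\<integral>\<^sup>+t. ?f t \<partial>lborel) = (\<integral>\<^sup>+t. ?f t \<partial>lborel) + (\<integral>\<^sup>+t. ?f (- t) \<partial>lborel)"
      by (subst nn_integral_lborel_uminus[of ?f]) (simp_all add: mult_2)
    also have "\<dots> = (\<integral>\<^sup>+t. ?f t + ?f (- t) \<partial>lborel)"
      by (rule nn_integral_add[symmetric]) auto
    also have "\<dots> = (\<integral>\<^sup>+t. 2 * ennreal (h t * (A + C * t\<^sup>2 + E * t ^ 4)) \<partial>lborel)"
    proof (rule nn_integral_cong)
      fix t
      have "?f t + ?f (- t) = ennreal (h t * (A + B * t + C * t\<^sup>2 + D * t ^ 3 + E * t ^ 4) +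
          h (- t) * (A + B * (- t) + C * (- t)\<^sup>2 + D * (- t) ^ 3 + E * (- t) ^ 4))"
        using h0[of t] h0[of "- t"] nonneg(6)[of t] nonneg(6)[of "- t"]
        by (intro ennreal_plus[symmetric] mult_nonneg_nonneg)
      also have "h (- t) = h t" by (rule sym)
      also have "h t * (A + B * t + C * t\<^sup>2 + D * t ^ 3 + E * t ^ 4) +
          h t * (A + B * (- t) + C * (- t)\<^sup>2 + D * (- t) ^ 3 + E * (- t) ^ 4) = 2 * (h t * (A + C * t\<^sup>2 + E * t ^ 4))"
        by (simp add: algebra_simps power3_eq_cube)
      finally show "?f t + ?f (- t) = 2 * ennreal (h t * (A + C * t\<^sup>2 + E * t ^ 4))"
        by (simp add: ennreal_mult' sym)
    qed
    also have "\<dots> = 2 * ennreal (A + C * s + E * r)"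
      by (subst nn_integral_cmult) (auto simp: even)
    finally show ?thesis by (simp add: ennreal_mult_cancel_left)
  qed
qed

text \<open>
  The square of a sum of squares of linear forms in independent coordinates, where different forms
  involve different coordinates: its mean is governed by the second moments and, through the
  last sum, by the deviations of the fourth moments from normality.  Coordinates are added one at a time; a coordinate whose law is not
  symmetric has to be the first one in its row, so that its odd moments do not contribute.
\<close>

lemma nn_integral_quartic:
  fixes I :: "'u set" and row :: "'u \<Rightarrow> 'r::finite" and h :: "'u \<Rightarrow> real \<Rightarrow> real" and \<zeta> \<sigma> \<tau> :: "'u \<Rightarrow> real"
  assumes "finite I"
    and h [measurable]: "\<And>u. h u \<in> borel_measurable borel" and h0: "\<And>u t. 0 \<le> h u t"
    and m0: "\<And>u. (\<integral>\<^sup>+t. ennreal (h u t) \<partial>lborel) = 1"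
    and m2: "\<And>u. (\<integral>\<^sup>+t. ennreal (h u t * t\<^sup>2) \<partial>lborel) = ennreal (\<sigma> u)"
    and m4: "\<And>u. (\<integral>\<^sup>+t. ennreal (h u t * t ^ 4) \<partial>lborel) = ennreal (\<tau> u)"
    and \<sigma>: "\<And>u. 0 \<le> \<sigma> u" and \<tau>: "\<And>u. 0 \<le> \<tau> u"
    and even: "\<And>u t. symm u \<Longrightarrow> h u (- t) = h u t"
    and first: "\<And>u v. \<not> symm u \<Longrightarrow> \<not> symm v \<Longrightarrow> row u = row v \<Longrightarrow> u = v"
  defines "S J b j \<equiv> \<Sum>u\<in>J. if row u = j then \<zeta> u * b u else 0"
    and "s J j \<equiv> \<Sum>u\<in>J. if row u = j then (\<zeta> u)\<^sup>2 * \<sigma> u else 0"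
  shows "(\<integral>\<^sup>+b. ennreal ((\<Prod>u\<in>I. h u (b u)) * (\<Sum>j\<in>UNIV. (S I b j)\<^sup>2)\<^sup>2) \<partial>coords I) =
    ennreal ((\<Sum>j\<in>UNIV. s I j)\<^sup>2 + 2 * (\<Sum>j\<in>UNIV. (s I j)\<^sup>2) + (\<Sum>u\<in>I. (\<zeta> u) ^ 4 * (\<tau> u - 3 * (\<sigma> u)\<^sup>2)))"
proof -
  let ?E = "\<lambda>J X. \<integral>\<^sup>+b. ennreal ((\<Prod>u\<in>J. h u (b u)) * X b) \<partial>coords J"
  let ?Y = "\<lambda>J b. \<Sum>j\<in>UNIV. (S J b j)\<^sup>2"
  have s0: "0 \<le> s J j" for J j using \<sigma> by (auto simp: s_def intro!: sum_nonneg)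
  have Y0: "0 \<le> ?Y J b" for J b by (intro sum_nonneg) simp
  have P0: "0 \<le> (\<Prod>u\<in>J. h u (b u))" for J b using h0 by (intro prod_nonneg) auto
  have SJ [measurable]: "(\<lambda>b. S J b j) \<in> borel_measurable (coords K)" if "J \<subseteq> K" for J K j
    unfolding S_def using that by (intro borel_measurable_sum) (auto intro!: measurable_PiM_lborel_component[where f="\<lambda>x. x" and I=K])
  have PJ [measurable]: "(\<lambda>b. \<Prod>u\<in>J. h u (b u)) \<in> borel_measurable (coords K)" if "J \<subseteq> K" for J K
    using that by (intro borel_measurable_prod measurable_compose[OF _ h]) (auto intro!: measurable_PiM_lborel_component[where f="\<lambda>x. x" and I=K])
  have moments: "(\<forall>j. ?E J (\<lambda>b. (S J b j)\<^sup>2) = ennreal (s J j)) \<and> ?E J (?Y J) = ennreal (\<Sum>j\<in>UNIV. s J j) \<and>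
    ?E J (\<lambda>b. (?Y J b)\<^sup>2) = ennreal ((\<Sum>j\<in>UNIV. s J j)\<^sup>2 + 2 * (\<Sum>j\<in>UNIV. (s J j)\<^sup>2) + (\<Sum>u\<in>J. (\<zeta> u) ^ 4 * (\<tau> u - 3 * (\<sigma> u)\<^sup>2)))
    \<and> 0 \<le> (\<Sum>j\<in>UNIV. s J j)\<^sup>2 + 2 * (\<Sum>j\<in>UNIV. (s J j)\<^sup>2) + (\<Sum>u\<in>J. (\<zeta> u) ^ 4 * (\<tau> u - 3 * (\<sigma> u)\<^sup>2))"
    if "finite J" for J
    using that
  proof (induction J rule: finite_ranking_induct[where f="\<lambda>u. of_bool (symm u) :: nat"])
    case empty
    show ?case by (simp add: S_def s_def)
  next
    case (insert m J)
    show ?case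
    proof (cases "m \<in> J")
      case True
      then have "insert m J = J" by blast
      then show ?thesis using insert.IH by simp
    next
      case m: False
      let ?r = "row m"
      define \<delta> where "\<delta> = (\<zeta> m)\<^sup>2 * \<sigma> m"
      have \<delta>: "0 \<le> \<delta>" using \<sigma> by (simp add: \<delta>_def)
      have S_ins: "S (insert m J) (b(m := t)) j = S J b j + (if j = ?r then \<zeta> m * t else 0)" for b t j
        using m insert.hyps(1) by (auto simp: S_def intro!: sum.cong)
      have s_ins: "s (insert m J) j = s J j + (if j = ?r then \<delta> else 0)" for j
        using m insert.hyps(1) by (auto simp: s_def \<delta>_def)
      have symmetric: "(\<forall>t. h m (- t) = h m t) \<or> (\<forall>b. S J b ?r = 0)"
      proof (cases "symm m")
        case False
        have "row u \<noteq> ?r" if "u \<in> J" for u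
        proof
          assume "row u = ?r"
          moreover have "\<not> symm u" using insert.hyps(2)[OF that] False by auto
          ultimately show False using first[of u m] False m that by auto
        qed
        then show ?thesis by (auto simp: S_def)
      qed (use even in auto)
      have Y_ins: "?Y (insert m J) (b(m := t)) = ?Y J b + 2 * (\<zeta> m * S J b ?r) * t + (\<zeta> m)\<^sup>2 * t\<^sup>2" for b t
      proof -
        have "?Y (insert m J) (b(m := t)) = (\<Sum>j\<in>UNIV. (S J b j)\<^sup>2 + (if j = ?r then 2 * (\<zeta> m * S J b ?r) * t + (\<zeta> m)\<^sup>2 * t\<^sup>2 else 0))"
          by (rule sum.cong) (auto simp: S_ins power2_eq_square algebra_simps)
        then show ?thesis by (simp add: sum.distrib)
      qed
      \<comment> \<open>Integrating out the new coordinate of a polynomial of degree four in it.\<close>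
      have step: "?E (insert m J) X = (\<integral>\<^sup>+b. ennreal ((\<Prod>u\<in>J. h u (b u)) * (A b + C b * \<sigma> m + E * \<tau> m)) \<partial>coords J)"
        if X [measurable]: "X \<in> borel_measurable (coords (insert m J))"
          and eq: "\<And>b t. X (b(m := t)) = A b + B b * t + C b * t\<^sup>2 + D b * t ^ 3 + E * t ^ 4"
          and odd: "\<And>b. S J b ?r = 0 \<Longrightarrow> B b = 0 \<and> D b = 0"
          and nonneg: "\<And>b. 0 \<le> A b" "\<And>b. 0 \<le> C b" "0 \<le> E" "\<And>b. 0 \<le> X b"
        for X A B C D E
      proof -
        have "?E (insert m J) X = (\<integral>\<^sup>+b. \<integral>\<^sup>+t. ennreal ((\<Prod>u\<in>insert m J. h u ((b(m := t)) u)) * X (b(m := t))) \<partial>lborel \<partial>coords J)"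
          by (rule lborel_prod.product_nn_integral_insert[OF insert.hyps(1) m]) (use PJ in measurable)
        also have "\<dots> = (\<integral>\<^sup>+b. ennreal ((\<Prod>u\<in>J. h u (b u)) * (A b + C b * \<sigma> m + E * \<tau> m)) \<partial>coords J)"
        proof (rule nn_integral_cong)
          fix b
          have prod: "(\<Prod>u\<in>insert m J. h u ((b(m := t)) u)) = (\<Prod>u\<in>J. h u (b u)) * h m t" for t
          proof -
            have "(\<Prod>u\<in>J. h u ((b(m := t)) u)) = (\<Prod>u\<in>J. h u (b u))"
              using m by (intro prod.cong) auto
            then show ?thesis using m insert.hyps(1) by (simp add: mult.commute)
          qed
          have "(\<integral>\<^sup>+t. ennreal ((\<Prod>u\<in>insert m J. h u ((b(m := t)) u)) * X (b(m := t))) \<partial>lborel) =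
            (\<integral>\<^sup>+t. ennreal (\<Prod>u\<in>J. h u (b u)) * ennreal (h m t * (A b + B b * t + C b * t\<^sup>2 + D b * t ^ 3 + E * t ^ 4)) \<partial>lborel)"
            unfolding prod eq by (simp add: ennreal_mult'[OF P0] mult.assoc)
          also have "\<dots> = ennreal (\<Prod>u\<in>J. h u (b u)) * (\<integral>\<^sup>+t. ennreal (h m t * (A b + B b * t + C b * t\<^sup>2 + D b * t ^ 3 + E * t ^ 4)) \<partial>lborel)"
            by (rule nn_integral_cmult) measurable
          also have "(\<integral>\<^sup>+t. ennreal (h m t * (A b + B b * t + C b * t\<^sup>2 + D b * t ^ 3 + E * t ^ 4)) \<partial>lborel) =
              ennreal (A b + C b * \<sigma> m + E * \<tau> m)"
            using h h0 m0 m2 m4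
          proof (rule nn_integral_poly_even)
            show "(\<forall>t. h m (- t) = h m t) \<or> (B b = 0 \<and> D b = 0)" using symmetric odd by blast
            show "0 \<le> A b + B b * t + C b * t\<^sup>2 + D b * t ^ 3 + E * t ^ 4" for t
              using nonneg(4)[of "b(m := t)"] by (simp only: eq)
          qed (use nonneg \<sigma> \<tau> in auto)
          finally show "(\<integral>\<^sup>+t. ennreal ((\<Prod>u\<in>insert m J. h u ((b(m := t)) u)) * X (b(m := t))) \<partial>lborel) =
              ennreal ((\<Prod>u\<in>J. h u (b u)) * (A b + C b * \<sigma> m + E * \<tau> m))"
            by (simp only: ennreal_mult'[OF P0])
        qed
        finally show ?thesis .
      qed
      \<comment> \<open>The coordinates that are present integrate to one.\<close>
      have const: "(\<integral>\<^sup>+b. ennreal ((\<Prod>u\<in>J. h u (b u)) * c) \<partial>coords J) = ennreal c" if "0 \<le> c" for c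
      proof -
        have "(\<integral>\<^sup>+b. ennreal ((\<Prod>u\<in>J. h u (b u)) * c) \<partial>coords J) = (\<integral>\<^sup>+b. (\<Prod>u\<in>J. ennreal (h u (b u))) * ennreal c \<partial>coords J)"
          by (intro nn_integral_cong) (simp add: ennreal_mult'[OF P0] prod_ennreal h0)
        also have "\<dots> = (\<integral>\<^sup>+b. (\<Prod>u\<in>J. ennreal (h u (b u))) \<partial>coords J) * ennreal c"
        proof (rule nn_integral_multc)
          have "(\<lambda>b. ennreal (\<Prod>u\<in>J. h u (b u))) \<in> borel_measurable (coords J)" using PJ[of J J] by measurable
          then show "(\<lambda>b. \<Prod>u\<in>J. ennreal (h u (b u))) \<in> borel_measurable (coords J)" by (simp add: prod_ennreal h0)
        qed
        also have "(\<integral>\<^sup>+b. (\<Prod>u\<in>J. ennreal (h u (b u))) \<partial>coords J) = (\<Prod>u\<in>J. \<integral>\<^sup>+t. ennreal (h u t) \<partial>lborel)"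
          by (rule lborel_prod.product_nn_integral_prod[OF insert.hyps(1)]) auto
        finally show ?thesis by (simp add: m0)
      qed
      have add: "(\<integral>\<^sup>+b. ennreal ((\<Prod>u\<in>J. h u (b u)) * (X b + Z b)) \<partial>coords J) = ?E J X + ?E J Z"
        if "X \<in> borel_measurable (coords J)" "Z \<in> borel_measurable (coords J)" "\<And>b. 0 \<le> X b" "\<And>b. 0 \<le> Z b" for X Z
      proof -
        have [measurable]: "X \<in> borel_measurable (coords J)" "Z \<in> borel_measurable (coords J)" by fact+
        have "(\<integral>\<^sup>+b. ennreal ((\<Prod>u\<in>J. h u (b u)) * (X b + Z b)) \<partial>coords J) =
          (\<integral>\<^sup>+b. ennreal ((\<Prod>u\<in>J. h u (b u)) * X b) + ennreal ((\<Prod>u\<in>J. h u (b u)) * Z b) \<partial>coords J)"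
          using that(3,4) P0 by (intro nn_integral_cong) (simp add: distrib_left ennreal_plus[symmetric] del: ennreal_plus)
        then show ?thesis using PJ[of J J] by (simp add: nn_integral_add)
      qed
      have scale: "(\<integral>\<^sup>+b. ennreal ((\<Prod>u\<in>J. h u (b u)) * (c * X b)) \<partial>coords J) = ennreal c * ?E J X"
        if "X \<in> borel_measurable (coords J)" "0 \<le> c" for X c
      proof -
        have [measurable]: "X \<in> borel_measurable (coords J)" by fact
        have "(\<integral>\<^sup>+b. ennreal ((\<Prod>u\<in>J. h u (b u)) * (c * X b)) \<partial>coords J) = (\<integral>\<^sup>+b. ennreal c * ennreal ((\<Prod>u\<in>J. h u (b u)) * X b) \<partial>coords J)"
          using that(2) by (intro nn_integral_cong) (simp add: ennreal_mult'[symmetric] mult.left_commute)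
        then show ?thesis using PJ[of J J] by (simp add: nn_integral_cmult)
      qed
      have IH: "\<And>j. ?E J (\<lambda>b. (S J b j)\<^sup>2) = ennreal (s J j)" "?E J (?Y J) = ennreal (\<Sum>j\<in>UNIV. s J j)"
        "?E J (\<lambda>b. (?Y J b)\<^sup>2) = ennreal ((\<Sum>j\<in>UNIV. s J j)\<^sup>2 + 2 * (\<Sum>j\<in>UNIV. (s J j)\<^sup>2) + (\<Sum>u\<in>J. (\<zeta> u) ^ 4 * (\<tau> u - 3 * (\<sigma> u)\<^sup>2)))"
        "0 \<le> (\<Sum>j\<in>UNIV. s J j)\<^sup>2 + 2 * (\<Sum>j\<in>UNIV. (s J j)\<^sup>2) + (\<Sum>u\<in>J. (\<zeta> u) ^ 4 * (\<tau> u - 3 * (\<sigma> u)\<^sup>2))"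
        using insert.IH by auto
      have SS [measurable]: "(\<lambda>b. S J b j) \<in> borel_measurable (coords J)"
        "(\<lambda>b. S (insert m J) b j) \<in> borel_measurable (coords (insert m J))" for j
        by (rule SJ; simp)+
      have one: "?E (insert m J) (\<lambda>b. (S (insert m J) b j)\<^sup>2) = ennreal (s (insert m J) j)" for j
      proof -
        have "?E (insert m J) (\<lambda>b. (S (insert m J) b j)\<^sup>2) =
          (\<integral>\<^sup>+b. ennreal ((\<Prod>u\<in>J. h u (b u)) * ((S J b j)\<^sup>2 + (if j = ?r then (\<zeta> m)\<^sup>2 else 0) * \<sigma> m + 0 * \<tau> m)) \<partial>coords J)"
          by (rule step[where B="\<lambda>b. if j = ?r then 2 * (\<zeta> m * S J b j) else 0" and D="\<lambda>_. 0"])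
            (auto simp: S_ins power2_eq_square algebra_simps)
        also have "\<dots> = (\<integral>\<^sup>+b. ennreal ((\<Prod>u\<in>J. h u (b u)) * ((S J b j)\<^sup>2 + (if j = ?r then \<delta> else 0))) \<partial>coords J)"
          by (intro nn_integral_cong) (simp add: \<delta>_def)
        also have "\<dots> = ennreal (s J j) + ennreal (if j = ?r then \<delta> else 0)"
          using \<delta> by (subst add) (simp_all add: IH const)
        finally show ?thesis using \<delta> s0 by (simp add: s_ins)
      qed
      have s_sum: "(\<Sum>j\<in>UNIV. s (insert m J) j) = (\<Sum>j\<in>UNIV. s J j) + \<delta>"
        by (simp add: s_ins sum.distrib)
      have s_sum0: "0 \<le> (\<Sum>j\<in>UNIV. s J j)" using s0 by (intro sum_nonneg) auto
      have two: "?E (insert m J) (?Y (insert m J)) = ennreal (\<Sum>j\<in>UNIV. s (insert m J) j)"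
      proof -
        have "?E (insert m J) (?Y (insert m J)) =
          (\<integral>\<^sup>+b. ennreal ((\<Prod>u\<in>J. h u (b u)) * (?Y J b + (\<zeta> m)\<^sup>2 * \<sigma> m + 0 * \<tau> m)) \<partial>coords J)"
          by (rule step[where B="\<lambda>b. 2 * (\<zeta> m * S J b ?r)" and D="\<lambda>_. 0"])
            (auto simp: Y_ins intro!: sum_nonneg)
        also have "\<dots> = (\<integral>\<^sup>+b. ennreal ((\<Prod>u\<in>J. h u (b u)) * (?Y J b + \<delta>)) \<partial>coords J)"
          by (simp add: \<delta>_def)
        also have "\<dots> = ennreal (\<Sum>j\<in>UNIV. s J j) + ennreal \<delta>"
          using \<delta> Y0 by (subst add) (simp_all add: IH const)
        finally show ?thesis using \<delta> s_sum0 by (simp add: s_sum)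
      qed
      have sq_sum: "(\<Sum>j\<in>UNIV. (s (insert m J) j)\<^sup>2) = (\<Sum>j\<in>UNIV. (s J j)\<^sup>2) + 2 * \<delta> * s J ?r + \<delta>\<^sup>2"
      proof -
        have "(\<Sum>j\<in>UNIV. (s (insert m J) j)\<^sup>2) = (\<Sum>j\<in>UNIV. (s J j)\<^sup>2 + (if j = ?r then 2 * \<delta> * s J ?r + \<delta>\<^sup>2 else 0))"
          by (rule sum.cong) (auto simp: s_ins power2_eq_square algebra_simps)
        then show ?thesis by (simp add: sum.distrib)
      qed
      let ?Q = "(\<Sum>j\<in>UNIV. s J j)\<^sup>2 + 2 * (\<Sum>j\<in>UNIV. (s J j)\<^sup>2) + (\<Sum>u\<in>J. (\<zeta> u) ^ 4 * (\<tau> u - 3 * (\<sigma> u)\<^sup>2))"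
      let ?Q' = "(\<Sum>j\<in>UNIV. s (insert m J) j)\<^sup>2 + 2 * (\<Sum>j\<in>UNIV. (s (insert m J) j)\<^sup>2) + (\<Sum>u\<in>insert m J. (\<zeta> u) ^ 4 * (\<tau> u - 3 * (\<sigma> u)\<^sup>2))"
      have Q': "?Q' = ?Q + 4 * \<delta> * s J ?r + 2 * \<delta> * (\<Sum>j\<in>UNIV. s J j) + (\<zeta> m) ^ 4 * \<tau> m"
        unfolding s_sum sq_sum using m insert.hyps(1)
        by (simp add: \<delta>_def power2_eq_square power4_eq_xxxx algebra_simps)
      have four: "?E (insert m J) (\<lambda>b. (?Y (insert m J) b)\<^sup>2) = ennreal ?Q'"
      proof -
        have "?E (insert m J) (\<lambda>b. (?Y (insert m J) b)\<^sup>2) =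
          (\<integral>\<^sup>+b. ennreal ((\<Prod>u\<in>J. h u (b u)) * ((?Y J b)\<^sup>2 + (4 * (\<zeta> m)\<^sup>2 * (S J b ?r)\<^sup>2 + 2 * (\<zeta> m)\<^sup>2 * ?Y J b) * \<sigma> m + (\<zeta> m) ^ 4 * \<tau> m)) \<partial>coords J)"
        proof (rule step[where B="\<lambda>b. 4 * (\<zeta> m * S J b ?r) * ?Y J b" and D="\<lambda>b. 4 * (\<zeta> m * S J b ?r) * (\<zeta> m)\<^sup>2"])
          show "(?Y (insert m J) (b(m := t)))\<^sup>2 = (?Y J b)\<^sup>2 + 4 * (\<zeta> m * S J b ?r) * ?Y J b * t +
            (4 * (\<zeta> m)\<^sup>2 * (S J b ?r)\<^sup>2 + 2 * (\<zeta> m)\<^sup>2 * ?Y J b) * t\<^sup>2 + 4 * (\<zeta> m * S J b ?r) * (\<zeta> m)\<^sup>2 * t ^ 3 + (\<zeta> m) ^ 4 * t ^ 4" for b t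
            unfolding Y_ins by (simp add: power2_eq_square power3_eq_cube power4_eq_xxxx algebra_simps)
        qed (auto intro!: add_nonneg_nonneg mult_nonneg_nonneg sum_nonneg)
        also have "\<dots> = (\<integral>\<^sup>+b. ennreal ((\<Prod>u\<in>J. h u (b u)) * ((?Y J b)\<^sup>2 + (4 * \<delta> * (S J b ?r)\<^sup>2 + (2 * \<delta> * ?Y J b + (\<zeta> m) ^ 4 * \<tau> m)))) \<partial>coords J)"
          by (simp add: \<delta>_def algebra_simps)
        also have "\<dots> = ennreal ?Q + (ennreal (4 * \<delta>) * ennreal (s J ?r) + (ennreal (2 * \<delta>) * ennreal (\<Sum>j\<in>UNIV. s J j) + ennreal ((\<zeta> m) ^ 4 * \<tau> m)))"
        proof -
          have t0: "0 \<le> (\<zeta> m) ^ 4 * \<tau> m" using \<tau> by simp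
          show ?thesis
            apply (subst add, measurable)
            subgoal using \<delta> Y0 t0 by (auto intro!: add_nonneg_nonneg mult_nonneg_nonneg)
            apply (subst add, measurable)
            subgoal using \<delta> by simp
            subgoal using \<delta> Y0 t0 by (auto intro!: add_nonneg_nonneg mult_nonneg_nonneg)
            apply (subst add, measurable)
            subgoal using \<delta> Y0 by (auto intro!: mult_nonneg_nonneg)
            subgoal using t0 by simp
            using \<delta> t0 by (simp only: scale SS borel_measurable_power borel_measurable_sum IH const mult_nonneg_nonneg zero_le_numeral)
        qed
        also have "\<dots> = ennreal ?Q'"
          unfolding Q' using IH(4) \<delta> s0[of J ?r] s_sum0 \<tau>[of m]
          by (simp add: ennreal_mult'[symmetric] ennreal_plus[symmetric] add.assoc del: ennreal_plus)
        finally show ?thesis .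
      qed
      have "0 \<le> ?Q'"
        unfolding Q' using IH(4) \<delta> s0[of J ?r] s_sum0 \<tau>[of m] by (auto intro!: add_nonneg_nonneg mult_nonneg_nonneg)
      then show ?thesis using one two four by blast
    qed
  qed
  then show ?thesis using moments[OF assms(1)] by blast
qed

definition half_gauss :: "real \<Rightarrow> nat \<Rightarrow> real \<Rightarrow> real" where
  "half_gauss c m t = (if 0 < t then t ^ m else 0) * exp (- c / 2 * t\<^sup>2)"

lemma half_gauss_nonneg: "0 \<le> half_gauss c m t"
  by (simp add: half_gauss_def)

lemma measurable_half_gauss [measurable]: "half_gauss c m \<in> borel_measurable borel"
  unfolding half_gauss_def by measurable

text \<open>
  The recursion for Gaussian moments, which the two parities of \<open>m\<close> satisfy in the same form.
\<close>

lemma half_gauss_2: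
  "\<exists>k>0. (\<integral>\<^sup>+t. ennreal (half_gauss 2 m t) \<partial>lborel) = ennreal k \<and>
     (\<integral>\<^sup>+t. ennreal (half_gauss 2 (m + 2) t) \<partial>lborel) = ennreal ((real m + 1) / 2 * k)"
proof -
  have eq: "(\<integral>\<^sup>+t. ennreal (half_gauss 2 m t) \<partial>lborel) = ennreal v"
    if "has_bochner_integral lborel (\<lambda>t. indicator {0..} t *\<^sub>R (exp (- t\<^sup>2) * t ^ m)) v" for m v
  proof -
    have "(\<integral>\<^sup>+t. ennreal (indicator {0..} t *\<^sub>R (exp (- t\<^sup>2) * t ^ m)) \<partial>lborel) = ennreal v"
      using that by (subst nn_integral_eq_integral) (auto simp: has_bochner_integral_iff indicator_def)
    moreover have "(\<integral>\<^sup>+t. ennreal (half_gauss 2 m t) \<partial>lborel) = (\<integral>\<^sup>+t. ennreal (indicator {0..} t *\<^sub>R (exp (- t\<^sup>2) * t ^ m)) \<partial>lborel)"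
      by (intro nn_integral_cong_AE AE_I[where N="{0}"]) (auto simp: half_gauss_def indicator_def not_le)
    ultimately show ?thesis by simp
  qed
  show ?thesis
  proof (cases "even m")
    case True
    then obtain k where m: "m = 2 * k" by blast
    let ?v = "\<lambda>k :: nat. sqrt pi / 2 * (fact (2 * k) / (2 ^ (2 * k) * fact k))"
    have "?v (Suc k) = (real m + 1) / 2 * ?v k"
    proof -
      have "fact (2 * Suc k) = (2 * real k + 2) * ((2 * real k + 1) * fact (2 * k))"
        by (simp add: algebra_simps)
      moreover have cancel: "(2 * real k + 2) * ((2 * real k + 1) * F) / (4 * P * ((real k + 1) * f)) = (2 * real k + 1) / 2 * (F / (P * f))"
        if "P \<noteq> 0" "f \<noteq> 0" for F P f :: real
      proof -
        have "(2 * real k + 2) * ((2 * real k + 1) * F) / (4 * P * ((real k + 1) * f)) =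
            (real k + 1) * (2 * (2 * real k + 1) * F) / ((real k + 1) * (4 * P * f))"
          by (simp add: algebra_simps)
        also have "\<dots> = 2 * (2 * real k + 1) * F / (4 * P * f)"
          by (rule mult_divide_mult_cancel_left) simp
        also have "\<dots> = (2 * real k + 1) / 2 * (F / (P * f))"
          using that by (simp add: divide_simps)
        finally show ?thesis .
      qed
      moreover have nonzero: "((2::real) ^ (2 * k) = 0) = False" by simp
      moreover have "fact (Suc k) = (real k + 1) * fact k" "(2::real) ^ (2 * Suc k) = 4 * 2 ^ (2 * k)"
        by (simp_all add: algebra_simps)
      ultimately have "?v (Suc k) = sqrt pi / 2 * ((2 * real k + 1) / 2 * (fact (2 * k) / (2 ^ (2 * k) * fact k)))"
        by (simp only: cancel nonzero fact_nonzero not_False_eq_True)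
      then show ?thesis by (simp add: m)
    qed
    moreover have "m + 2 = 2 * Suc k" by (simp add: m)
    ultimately show ?thesis
      using eq[OF gaussian_moment_even_pos[of k]] eq[OF gaussian_moment_even_pos[of "Suc k"]]
      by (intro exI[of _ "?v k"]) (simp add: m)
  next
    case False
    then obtain k where m: "m = 2 * k + 1" by (rule oddE)
    have "fact (Suc k) / 2 = (real m + 1) / 2 * (fact k / 2)" by (simp add: m field_simps)
    moreover have "m + 2 = 2 * Suc k + 1" by (simp add: m)
    ultimately show ?thesis
      using eq[OF gaussian_moment_odd_pos[of k]] eq[OF gaussian_moment_odd_pos[of "Suc k"]]
      by (intro exI[of _ "fact k / 2"]) (simp add: m)
  qed
qed

lemma half_gauss_moments:
  assumes c: "0 < c"
  shows "\<exists>k>0. (\<integral>\<^sup>+t. ennreal (half_gauss c m t) \<partial>lborel) = ennreal k \<and>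
     (\<integral>\<^sup>+t. ennreal (half_gauss c (m + 2) t) \<partial>lborel) = ennreal ((real m + 1) / c * k)"
proof -
  define r where "r = sqrt (2 / c)"
  have r: "0 < r" "r\<^sup>2 = 2 / c" using c by (simp_all add: r_def)
  have scale: "(\<integral>\<^sup>+t. ennreal (half_gauss c m t) \<partial>lborel) = ennreal (r ^ (m + 1)) * (\<integral>\<^sup>+t. ennreal (half_gauss 2 m t) \<partial>lborel)" for m
  proof -
    have h: "half_gauss c m (0 + r * t) = r ^ m * half_gauss 2 m t" for t
      using r c by (auto simp: half_gauss_def power_mult_distrib zero_less_mult_iff)
    have "(\<integral>\<^sup>+t. ennreal (half_gauss c m t) \<partial>lborel) = ennreal \<bar>r\<bar> * (\<integral>\<^sup>+t. ennreal (half_gauss c m (0 + r * t)) \<partial>lborel)"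
      using r by (intro nn_integral_real_affine) auto
    also have "\<dots> = ennreal r * (\<integral>\<^sup>+t. ennreal (r ^ m) * ennreal (half_gauss 2 m t) \<partial>lborel)"
      unfolding h using r by (simp add: ennreal_mult')
    also have "\<dots> = ennreal r * (ennreal (r ^ m) * (\<integral>\<^sup>+t. ennreal (half_gauss 2 m t) \<partial>lborel))"
      by (subst nn_integral_cmult) auto
    finally show ?thesis using r by (simp add: ennreal_mult' mult.assoc)
  qed
  obtain k where k: "0 < k" "(\<integral>\<^sup>+t. ennreal (half_gauss 2 m t) \<partial>lborel) = ennreal k"
     "(\<integral>\<^sup>+t. ennreal (half_gauss 2 (m + 2) t) \<partial>lborel) = ennreal ((real m + 1) / 2 * k)"
    using half_gauss_2[of m] by blast
  have "r ^ (m + 2 + 1) * ((real m + 1) / 2 * k) = (real m + 1) / c * (r ^ (m + 1) * k)"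
  proof -
    have "r ^ (m + 2 + 1) = r ^ (m + 1) * r\<^sup>2" by (simp add: power_add power2_eq_square)
    then show ?thesis unfolding r(2) by simp
  qed
  then show ?thesis
    using r k c by (intro exI[of _ "r ^ (m + 1) * k"])
      (simp add: scale k(2,3)[simplified] ennreal_mult'[symmetric] del: power_Suc)
qed

text \<open>
  The factors of the measure on the lower triangular group, up to normalization: the diagonal entries have
  scaled chi distributions, whose degrees of freedom decrease along the diagonal, and the other entries are
  normal with variance \<open>1/n\<close>.
\<close>

definition LT_factor :: "nat \<Rightarrow> 'p::{finite,linorder} \<times> 'p \<Rightarrow> real \<Rightarrow> real" where
  "LT_factor n u t = (if fst u = snd u then half_gauss n (n - 1 - pos (fst u)) t else exp (- real n / 2 * t\<^sup>2))"

definition LT_factor_second :: "nat \<Rightarrow> 'p::{finite,linorder} \<times> 'p \<Rightarrow> real" where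
  "LT_factor_second n u = (if fst u = snd u then real n - real (pos (fst u)) else 1) / n"

definition LT_factor_fourth :: "nat \<Rightarrow> 'p::{finite,linorder} \<times> 'p \<Rightarrow> real" where
  "LT_factor_fourth n u = (if fst u = snd u then (real n - real (pos (fst u))) * (real n - real (pos (fst u)) + 2) else 3) / (real n)\<^sup>2"

lemma pos_le_CARD: "pos (j :: 'p::{finite,linorder}) \<le> CARD('p)"
  unfolding pos_def by (rule card_mono) auto

lemma LT_factor_moments:
  fixes u :: "'p::{finite,linorder} \<times> 'p"
  assumes n: "CARD('p) < n"
  shows "\<exists>Z>0. (\<integral>\<^sup>+t. ennreal (LT_factor n u t) \<partial>lborel) = ennreal Z \<and>
    (\<integral>\<^sup>+t. ennreal (LT_factor n u t * t\<^sup>2) \<partial>lborel) = ennreal (LT_factor_second n u * Z) \<and>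
    (\<integral>\<^sup>+t. ennreal (LT_factor n u t * t ^ 4) \<partial>lborel) = ennreal (LT_factor_fourth n u * Z)"
proof -
  have n0: "0 < real n" using n by simp
  have shift: "half_gauss n m t * t ^ i = half_gauss n (m + i) t" for m i t
    by (simp add: half_gauss_def power_add)
  show ?thesis
  proof (cases "fst u = snd u")
    case True
    define m where "m = n - 1 - pos (fst u)"
    have m: "real m + 1 = real n - real (pos (fst u))"
      using n pos_le_CARD[of "fst u"] by (simp add: m_def of_nat_diff)
    obtain k where k: "0 < k" "(\<integral>\<^sup>+t. ennreal (half_gauss n m t) \<partial>lborel) = ennreal k"
      "(\<integral>\<^sup>+t. ennreal (half_gauss n (m + 2) t) \<partial>lborel) = ennreal ((real m + 1) / n * k)"
      using half_gauss_moments[OF n0, of m] by blast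
    obtain k' where k': "0 < k'" "(\<integral>\<^sup>+t. ennreal (half_gauss n (m + 2) t) \<partial>lborel) = ennreal k'"
      "(\<integral>\<^sup>+t. ennreal (half_gauss n (m + 2 + 2) t) \<partial>lborel) = ennreal ((real (m + 2) + 1) / n * k')"
      using half_gauss_moments[OF n0, of "m + 2"] by blast
    have "k' = (real m + 1) / n * k"
      using k k' n0 by (metis ennreal_inj less_imp_le zero_le_divide_iff zero_le_mult_iff of_nat_0_le_iff add_nonneg_nonneg zero_le_one)
    then have "(real (m + 2) + 1) / n * k' = (real m + 1) * (real m + 1 + 2) / (real n)\<^sup>2 * k"
      by (simp add: power2_eq_square algebra_simps)
    moreover have "m + 4 = m + 2 + 2" by simp
    ultimately have "(\<integral>\<^sup>+t. ennreal (half_gauss n (m + 4) t) \<partial>lborel) = ennreal ((real m + 1) * (real m + 1 + 2) / (real n)\<^sup>2 * k)"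
      by (simp only: k'(3))
    show ?thesis
    proof -
      have "LT_factor n u = half_gauss n m" using True by (simp add: fun_eq_iff LT_factor_def m_def)
      moreover have "LT_factor_second n u = (real m + 1) / n" "LT_factor_fourth n u = (real m + 1) * (real m + 1 + 2) / (real n)\<^sup>2"
        using True unfolding LT_factor_second_def LT_factor_fourth_def m by simp_all
      ultimately show ?thesis
        using k \<open>(\<integral>\<^sup>+t. ennreal (half_gauss n (m + 4) t) \<partial>lborel) = _\<close>
        by (intro exI[of _ k]) (simp only: shift simp_thms)
    qed
  next
    case False
    have full: "(\<integral>\<^sup>+t. ennreal (exp (- real n / 2 * t\<^sup>2) * t ^ i) \<partial>lborel) = 2 * (\<integral>\<^sup>+t. ennreal (half_gauss n i t) \<partial>lborel)"
      if "even i" for i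
    proof -
      have sym: "(- t) ^ i = t ^ i" for t :: real using that by simp
      have [measurable]: "(\<lambda>t. ennreal (half_gauss n i t)) \<in> borel_measurable borel" by measurable
      have "(\<integral>\<^sup>+t. ennreal (exp (- real n / 2 * t\<^sup>2) * t ^ i) \<partial>lborel) =
        (\<integral>\<^sup>+t. ennreal (half_gauss n i t) + ennreal (half_gauss n i (- t)) \<partial>lborel)"
        by (intro nn_integral_cong_AE AE_I[where N="{0}"]) (auto simp: half_gauss_def sym not_less mult.commute)
      also have "\<dots> = (\<integral>\<^sup>+t. ennreal (half_gauss n i t) \<partial>lborel) + (\<integral>\<^sup>+t. ennreal (half_gauss n i (- t)) \<partial>lborel)"
        by (rule nn_integral_add) auto
      also have "(\<integral>\<^sup>+t. ennreal (half_gauss n i (- t)) \<partial>lborel) = (\<integral>\<^sup>+t. ennreal (half_gauss n i t) \<partial>lborel)"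
        by (rule nn_integral_lborel_uminus[of "\<lambda>t. ennreal (half_gauss n i t)"]) measurable
      finally show ?thesis by (simp add: mult_2)
    qed
    obtain k where k: "0 < k" "(\<integral>\<^sup>+t. ennreal (half_gauss n 0 t) \<partial>lborel) = ennreal k"
      "(\<integral>\<^sup>+t. ennreal (half_gauss n 2 t) \<partial>lborel) = ennreal (1 / n * k)"
      using half_gauss_moments[OF n0, of 0] by (auto simp del: add_2_eq_Suc')
    obtain k' where k': "0 < k'" "(\<integral>\<^sup>+t. ennreal (half_gauss n 2 t) \<partial>lborel) = ennreal k'"
      "(\<integral>\<^sup>+t. ennreal (half_gauss n 4 t) \<partial>lborel) = ennreal (3 / n * k')"
      using half_gauss_moments[OF n0, of 2] by auto
    have kk: "k' = 1 / n * k"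
      using k k' n0 by (metis ennreal_inj less_imp_le zero_le_divide_1_iff zero_le_mult_iff)
    have two: "2 * ennreal t = ennreal (2 * t)" for t by (simp add: ennreal_mult')
    have f0: "(\<integral>\<^sup>+t. ennreal (exp (- real n / 2 * t\<^sup>2)) \<partial>lborel) = ennreal (2 * k)"
      using full[of 0] by (simp add: k two)
    have f2: "(\<integral>\<^sup>+t. ennreal (exp (- real n / 2 * t\<^sup>2) * t\<^sup>2) \<partial>lborel) = ennreal (1 / n * (2 * k))"
      using full[of 2] by (simp add: k two)
    have f4: "(\<integral>\<^sup>+t. ennreal (exp (- real n / 2 * t\<^sup>2) * t ^ 4) \<partial>lborel) = ennreal (3 / (real n)\<^sup>2 * (2 * k))"
      using full[of 4] by (simp add: k'(3) kk two power2_eq_square)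
    show ?thesis
      using k(1) False f0 f2 f4 by (intro exI[of _ "2 * k"]) (simp only: LT_factor_def LT_factor_second_def LT_factor_fourth_def if_False simp_thms zero_less_mult_iff zero_less_numeral)
  qed
qed

lemma sum_lower:
  fixes g :: "'p::{finite,linorder} \<times> 'p \<Rightarrow> real"
  shows "(\<Sum>u\<in>lower. if fst u = j then g u else 0) = g (j, j) + (\<Sum>k | k < j. g (j, k))"
proof -
  have "(\<Sum>u\<in>lower. if fst u = j then g u else 0) = (\<Sum>u | u \<in> lower \<and> fst u = j. g u)"
    by (simp add: sum.inter_filter)
  also have "{u. u \<in> lower \<and> fst u = j} = Pair j ` {k. k \<le> j}" by (auto simp: lower_def)
  also have "(\<Sum>u\<in>Pair j ` {k. k \<le> j}. g u) = (\<Sum>k | k \<le> j. g (j, k))"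
    by (simp add: sum.reindex inj_on_def)
  also have "{k. k \<le> j} = insert j {k. k < j}" by auto
  finally show ?thesis by simp
qed

lemma prod_lower_diag:
  fixes g :: "'p::{finite,linorder} \<times> 'p \<Rightarrow> real"
  shows "(\<Prod>u\<in>lower. if fst u = snd u then g u else 1) = (\<Prod>j\<in>UNIV. g (j, j))"
proof -
  have "(\<Prod>u\<in>lower. if fst u = snd u then g u else 1) = (\<Prod>u | u \<in> lower \<and> fst u = snd u. g u)"
    by (simp add: prod.inter_filter)
  also have "{u. u \<in> lower \<and> fst u = snd u} = (\<lambda>j :: 'p. (j, j)) ` UNIV" by (auto simp: lower_def)
  finally show ?thesis by (simp add: prod.reindex inj_on_def)
qed

lemma sum_lower_diag:
  fixes g :: "'p::{finite,linorder} \<times> 'p \<Rightarrow> real"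
  shows "(\<Sum>u\<in>lower. if fst u = snd u then g u else 0) = (\<Sum>j\<in>UNIV. g (j, j))"
proof -
  have "(\<Sum>u\<in>lower. if fst u = snd u then g u else 0) = (\<Sum>u | u \<in> lower \<and> fst u = snd u. g u)"
    by (simp add: sum.inter_filter)
  also have "{u. u \<in> lower \<and> fst u = snd u} = (\<lambda>j :: 'p. (j, j)) ` UNIV" by (auto simp: lower_def)
  finally show ?thesis by (simp add: sum.reindex inj_on_def)
qed

lemma LT_weight_factor:
  fixes b :: "'p::{finite,linorder} \<times> 'p \<Rightarrow> real"
  assumes n: "CARD('p) < n"
  shows "LT.weight n (mat_of lower b) * ennreal (exp (- real n / 2 * trace (transpose (mat_of lower b) ** mat_of lower b)) * c) =
    ennreal ((\<Prod>u\<in>lower. LT_factor n u (b u)) * c)"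
proof -
  let ?B = "mat_of lower b :: 'p sqmat"
  let ?d = "\<lambda>j. if 0 < b (j, j) then b (j, j) ^ (n - 1 - pos j) else 0"
  have B: "?B $ j $ j = b (j, j)" for j by (simp add: mat_of_nth lower_def)
  have LT: "?B \<in> LTp \<longleftrightarrow> (\<forall>j. 0 < b (j, j))" by (auto simp: LTp_def mat_of_nth lower_def)
  have "(\<Prod>u\<in>lower. LT_factor n u (b u)) =
      (\<Prod>u\<in>lower. (if fst u = snd u then (if 0 < b u then b u ^ (n - 1 - pos (fst u)) else 0) else 1) * exp (- real n / 2 * (b u)\<^sup>2))"
    by (rule prod.cong) (auto simp: LT_factor_def half_gauss_def)
  also have "\<dots> = (\<Prod>j\<in>UNIV. ?d j) * exp (\<Sum>u\<in>lower. - real n / 2 * (b u)\<^sup>2)"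
    by (simp add: prod.distrib prod_lower_diag exp_sum cong: if_cong)
  also have "(\<Sum>u\<in>lower. - real n / 2 * (b u)\<^sup>2) = - real n / 2 * trace (transpose ?B ** ?B)"
    by (simp add: LT.trace_mat_of sum_distrib_left)
  finally have factor: "(\<Prod>u\<in>lower. LT_factor n u (b u)) = (\<Prod>j\<in>UNIV. ?d j) * exp (- real n / 2 * trace (transpose ?B ** ?B))" .
  show ?thesis
  proof (cases "?B \<in> LTp")
    case True
    then have pos: "0 < b (j, j)" for j using LT by blast
    have "LT_density ?B * \<bar>det ?B\<bar> ^ (n - 1) = (\<Prod>j\<in>UNIV. ?d j)"
    proof -
      have "LT_density ?B * \<bar>det ?B\<bar> ^ (n - 1) = (\<Prod>j\<in>UNIV. b (j, j) ^ (n - 1)) / (\<Prod>j\<in>UNIV. b (j, j) ^ Defs.pos j)"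
        using det_LTp_pos[OF True] by (simp add: LT_density_def det_LTp[OF True] B prod_power_distrib)
      also have "\<dots> = (\<Prod>j\<in>UNIV. b (j, j) ^ (n - 1) / b (j, j) ^ Defs.pos j)"
        by (simp add: prod_dividef)
      also have "\<dots> = (\<Prod>j\<in>UNIV. ?d j)"
      proof (rule prod.cong)
        fix j :: 'p
        have "Defs.pos j \<le> n - 1" using n pos_le_CARD[of j] by simp
        then show "b (j, j) ^ (n - 1) / b (j, j) ^ Defs.pos j = ?d j"
          using pos[of j] power_diff[of "b (j, j)" "Defs.pos j" "n - 1"] by simp
      qed simp
      finally show ?thesis .
    qed
    moreover have "0 \<le> (\<Prod>j\<in>UNIV. ?d j)" by (intro prod_nonneg ballI) (simp add: pos less_imp_le)
    ultimately show ?thesis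
      using True unfolding LT.weight_def factor by (simp add: ennreal_mult'[symmetric] mult.assoc)
  next
    case False
    then obtain j where "\<not> 0 < b (j, j)" using LT by blast
    then have "(\<Prod>j\<in>UNIV. ?d j) = 0" by (intro prod_zero) auto
    then have zero: "(\<Prod>u\<in>lower. LT_factor n u (b u)) = 0" unfolding factor by (simp only: mult_zero_left)
    show ?thesis using False unfolding LT.weight_def zero by simp
  qed
qed

text \<open>The contribution of a single observation to \<open>LT_stat\<close>.\<close>

definition LT_form :: "nat \<Rightarrow> (real, 'p::{finite,linorder}) vec \<Rightarrow> real" where
  "LT_form n v = (let n = real n; p = real CARD('p) in
      (n + p + 2) * (n + p) * norm v ^ 4
      - 2 * (n + p + 2) * (\<Sum>j\<in>UNIV. \<Sum>k\<in>UNIV. real (max (pos j) (pos k)) * (v $ j)\<^sup>2 * (v $ k)\<^sup>2)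
      - 2 * (n + p) * (\<Sum>j\<in>UNIV. \<Sum>k\<in>UNIV. real (min (pos j) (pos k)) * (v $ j)\<^sup>2 * (v $ k)\<^sup>2)
      + 4 * (\<Sum>j\<in>UNIV. real (pos j) * (v $ j)\<^sup>2)\<^sup>2)"

lemma LT_stat_eq_sum: "LT_stat z = (\<Sum>i\<in>(UNIV :: 'n::finite set). LT_form CARD('n) (z i))"
  by (simp add: LT_stat_def LT_form_def Let_def sum.distrib sum_subtractf sum_distrib_left)

lemma card_greater: "real (card {j :: 'p::{finite,linorder}. k < j}) = real CARD('p) - real (pos k)"
proof -
  have "{j. k < j} = UNIV - {j. j \<le> k}" by auto
  then have "card {j. k < j} = CARD('p) - pos k" by (simp add: card_Diff_subset pos_def)
  then show ?thesis using pos_le_CARD[of k] by (simp add: of_nat_diff)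
qed

lemma pos_max: "max (pos j) (pos k) = pos (max j k)"
  using pos_le[of j k] pos_le[of k j] by (auto simp: max_def)

text \<open>
  The variables \<open>x k\<close> stand for the squared coordinates of \<open>v\<close>, and \<open>q j\<close> is \<open>n\<close> times the second moment of the
  coordinate \<open>j\<close> of \<open>B v\<close>.  The sums over \<open>k < j\<close> turn into numbers of coordinates beyond a given one, whence
  the maxima; the minima enter with \<open>max + min\<close> from the mixed term of a square.
\<close>

lemma LT_algebra:
  fixes x :: "'p::{finite,linorder} \<Rightarrow> real" and n :: real
  defines "p \<equiv> real CARD('p)"
    and "q j \<equiv> (\<Sum>k | k < j. x k) + (n - real (pos j)) * x j"
  shows "(\<Sum>j\<in>UNIV. q j)\<^sup>2 + 2 * (\<Sum>j\<in>UNIV. (q j)\<^sup>2) +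
      (\<Sum>j\<in>UNIV. (x j)\<^sup>2 * ((n - real (pos j)) * (n - real (pos j) + 2) - 3 * (n - real (pos j))\<^sup>2)) =
    (n + p + 2) * (n + p) * (\<Sum>j\<in>UNIV. x j)\<^sup>2
      - 2 * (n + p + 2) * (\<Sum>j\<in>UNIV. \<Sum>k\<in>UNIV. real (max (pos j) (pos k)) * x j * x k)
      - 2 * (n + p) * (\<Sum>j\<in>UNIV. \<Sum>k\<in>UNIV. real (min (pos j) (pos k)) * x j * x k)
      + 4 * (\<Sum>j\<in>UNIV. real (pos j) * x j)\<^sup>2"
proof -
  let ?X = "\<Sum>j\<in>UNIV. x j"
  let ?K = "\<Sum>j\<in>UNIV. real (pos j) * x j"
  let ?Max = "\<Sum>j\<in>UNIV. \<Sum>k\<in>UNIV. real (max (pos j) (pos k)) * x j * x k"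
  let ?Min = "\<Sum>j\<in>UNIV. \<Sum>k\<in>UNIV. real (min (pos j) (pos k)) * x j * x k"
  let ?s = "\<lambda>j. \<Sum>k | k < j. x k"
  have s: "?s j = (\<Sum>k\<in>UNIV. of_bool (k < j) * x k)" for j
    by (simp add: sum.inter_filter[symmetric] of_bool_def if_distrib[of "\<lambda>y. y * _"] cong: if_cong)
  have count: "(\<Sum>j\<in>UNIV. of_bool (k < j)) = p - real (pos k)" for k :: 'p
    by (simp add: card_greater[symmetric] p_def of_bool_def sum.If_cases)
  have "(\<Sum>j\<in>UNIV. ?s j) = (\<Sum>k\<in>UNIV. \<Sum>j\<in>UNIV. of_bool (k < j) * x k)"
    unfolding s by (rule sum.swap)
  also have "\<dots> = p * ?X - ?K"
    by (simp add: sum_distrib_right[symmetric] count left_diff_distrib sum_subtractf sum_distrib_left)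
  finally have sum_q: "(\<Sum>j\<in>UNIV. q j) = (n + p) * ?X - 2 * ?K"
    by (simp add: q_def sum.distrib left_diff_distrib sum_subtractf sum_distrib_left[symmetric] algebra_simps)
  have XX: "?X\<^sup>2 = (\<Sum>k\<in>UNIV. \<Sum>l\<in>UNIV. x k * x l)"
    by (simp only: power2_eq_square sum_product)
  have "(\<Sum>j\<in>UNIV. (?s j)\<^sup>2) = (\<Sum>j\<in>UNIV. \<Sum>k\<in>UNIV. \<Sum>l\<in>UNIV. of_bool (max k l < j) * (x k * x l))"
    unfolding s power2_eq_square sum_product by (intro sum.cong refl) auto
  also have "\<dots> = (\<Sum>k\<in>UNIV. \<Sum>j\<in>UNIV. \<Sum>l\<in>UNIV. of_bool (max k l < j) * (x k * x l))"
    by (rule sum.swap)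
  also have "\<dots> = (\<Sum>k\<in>UNIV. \<Sum>l\<in>UNIV. \<Sum>j\<in>UNIV. of_bool (max k l < j) * (x k * x l))"
    by (intro sum.cong refl sum.swap)
  also have "\<dots> = (\<Sum>k\<in>UNIV. \<Sum>l\<in>UNIV. p * (x k * x l) - real (max (pos k) (pos l)) * x k * x l)"
    unfolding sum_distrib_right[symmetric] count pos_max by (simp add: left_diff_distrib mult.assoc)
  also have "\<dots> = p * ?X\<^sup>2 - ?Max"
    unfolding XX by (simp only: sum_subtractf sum_distrib_left)
  finally have sq_s: "(\<Sum>j\<in>UNIV. (?s j)\<^sup>2) = p * ?X\<^sup>2 - ?Max" .
  have split: "(\<Sum>j\<in>UNIV. \<Sum>k\<in>UNIV. (n - real (max (pos j) (pos k))) * x j * x k) =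
      2 * (\<Sum>j\<in>UNIV. (n - real (pos j)) * x j * ?s j) + (\<Sum>j\<in>UNIV. (n - real (pos j)) * (x j)\<^sup>2)"
  proof -
    let ?T = "\<lambda>j k. (n - real (pos j)) * x j * (of_bool (k < j) * x k)"
    have "(n - real (max (pos j) (pos k))) * x j * x k = ?T j k + ?T k j + (if k = j then (n - real (pos j)) * (x j)\<^sup>2 else 0)" for j k
      by (cases j k rule: linorder_cases) (auto simp: max_def power2_eq_square dest: pos_less)
    then have "(\<Sum>j\<in>UNIV. \<Sum>k\<in>UNIV. (n - real (max (pos j) (pos k))) * x j * x k) =
       (\<Sum>j\<in>UNIV. \<Sum>k\<in>UNIV. ?T j k) + (\<Sum>j\<in>UNIV. \<Sum>k\<in>UNIV. ?T k j) + (\<Sum>j\<in>UNIV. (n - real (pos j)) * (x j)\<^sup>2)"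
      by (simp add: sum.distrib)
    also have "(\<Sum>j\<in>UNIV. \<Sum>k\<in>UNIV. ?T k j) = (\<Sum>j\<in>UNIV. \<Sum>k\<in>UNIV. ?T j k)" by (rule sum.swap)
    also have "(\<Sum>j\<in>UNIV. \<Sum>k\<in>UNIV. ?T j k) = (\<Sum>j\<in>UNIV. (n - real (pos j)) * x j * ?s j)"
      unfolding s by (simp only: sum_distrib_left)
    finally show ?thesis by simp
  qed
  have nMax: "(\<Sum>j\<in>UNIV. \<Sum>k\<in>UNIV. (n - real (max (pos j) (pos k))) * x j * x k) = n * ?X\<^sup>2 - ?Max"
    unfolding XX by (simp only: left_diff_distrib sum_subtractf sum_distrib_left mult.assoc)
  have XK: "2 * (?X * ?K) = ?Max + ?Min"
  proof -
    have "real (max (pos j) (pos k)) * x j * x k + real (min (pos j) (pos k)) * x j * x k =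
        x j * (real (pos k) * x k) + real (pos j) * x j * x k" for j k
      by (auto simp: max_def min_def algebra_simps)
    then have "?Max + ?Min = (\<Sum>j\<in>UNIV. \<Sum>k\<in>UNIV. x j * (real (pos k) * x k) + real (pos j) * x j * x k)"
      by (simp only: sum.distrib[symmetric])
    also have "\<dots> = ?X * ?K + ?K * ?X" by (simp only: sum.distrib sum_product)
    finally show ?thesis by simp
  qed
  have "(\<Sum>j\<in>UNIV. (q j)\<^sup>2) = (\<Sum>j\<in>UNIV. (?s j)\<^sup>2) + 2 * (\<Sum>j\<in>UNIV. (n - real (pos j)) * x j * ?s j) +
      (\<Sum>j\<in>UNIV. (n - real (pos j))\<^sup>2 * (x j)\<^sup>2)"
    unfolding q_def by (simp add: power2_sum sum.distrib sum_distrib_left power_mult_distrib mult_ac)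
  then have "2 * (\<Sum>j\<in>UNIV. (q j)\<^sup>2) +
      (\<Sum>j\<in>UNIV. (x j)\<^sup>2 * ((n - real (pos j)) * (n - real (pos j) + 2) - 3 * (n - real (pos j))\<^sup>2)) =
    2 * (\<Sum>j\<in>UNIV. (?s j)\<^sup>2) + 4 * (\<Sum>j\<in>UNIV. (n - real (pos j)) * x j * ?s j) + 2 * (\<Sum>j\<in>UNIV. (n - real (pos j)) * (x j)\<^sup>2)"
  proof -
    have "2 * (\<Sum>j\<in>UNIV. (n - real (pos j))\<^sup>2 * (x j)\<^sup>2) +
      (\<Sum>j\<in>UNIV. (x j)\<^sup>2 * ((n - real (pos j)) * (n - real (pos j) + 2) - 3 * (n - real (pos j))\<^sup>2)) =
      2 * (\<Sum>j\<in>UNIV. (n - real (pos j)) * (x j)\<^sup>2)"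
      unfolding sum_distrib_left sum.distrib[symmetric]
      by (intro sum.cong refl) (simp add: power2_eq_square algebra_simps)
    then show ?thesis using \<open>(\<Sum>j\<in>UNIV. (q j)\<^sup>2) = _\<close> by simp
  qed
  also have "\<dots> = 2 * (p * ?X\<^sup>2 - ?Max) + 2 * (n * ?X\<^sup>2 - ?Max)"
    using split unfolding nMax sq_s by simp
  finally have rows: "2 * (\<Sum>j\<in>UNIV. (q j)\<^sup>2) +
      (\<Sum>j\<in>UNIV. (x j)\<^sup>2 * ((n - real (pos j)) * (n - real (pos j) + 2) - 3 * (n - real (pos j))\<^sup>2)) =
    2 * (p * ?X\<^sup>2 - ?Max) + 2 * (n * ?X\<^sup>2 - ?Max)" .
  have "((n + p) * ?X - 2 * ?K)\<^sup>2 = (n + p)\<^sup>2 * ?X\<^sup>2 - 2 * (n + p) * (2 * (?X * ?K)) + 4 * ?K\<^sup>2"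
    by (simp add: power2_eq_square algebra_simps)
  also have "\<dots> = (n + p)\<^sup>2 * ?X\<^sup>2 - 2 * (n + p) * (?Max + ?Min) + 4 * ?K\<^sup>2" unfolding XK ..
  finally have "(\<Sum>j\<in>UNIV. q j)\<^sup>2 = (n + p)\<^sup>2 * ?X\<^sup>2 - 2 * (n + p) * (?Max + ?Min) + 4 * ?K\<^sup>2"
    unfolding sum_q .
  then show ?thesis using rows by (simp add: power2_eq_square algebra_simps)
qed

lemma LT_form_rows:
  fixes v :: "(real, 'p::{finite,linorder}) vec" and n :: nat
  defines "q j \<equiv> (\<Sum>k | k < j. (v $ k)\<^sup>2) + (real n - real (pos j)) * (v $ j)\<^sup>2"
  shows "LT_form n v = (\<Sum>j\<in>UNIV. q j)\<^sup>2 + 2 * (\<Sum>j\<in>UNIV. (q j)\<^sup>2) +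
    (\<Sum>j\<in>UNIV. ((v $ j)\<^sup>2)\<^sup>2 * ((real n - real (pos j)) * (real n - real (pos j) + 2) - 3 * (real n - real (pos j))\<^sup>2))"
proof -
  have "(norm v)\<^sup>2 = (\<Sum>j\<in>UNIV. (v $ j)\<^sup>2)"
    unfolding power2_norm_eq_inner inner_vec_def by (simp add: power2_eq_square)
  then have "((norm v)\<^sup>2)\<^sup>2 = (\<Sum>j\<in>UNIV. (v $ j)\<^sup>2)\<^sup>2" by simp
  then have norm4: "norm v ^ 4 = (\<Sum>j\<in>UNIV. (v $ j)\<^sup>2)\<^sup>2" by (simp add: power_mult[symmetric])
  show ?thesis
    unfolding q_def LT_algebra LT_form_def Let_def norm4 ..
qed

text \<open>
  The only negative terms are compensated by the squares of the rows.
\<close>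

lemma LT_form_nonneg:
  fixes v :: "(real, 'p::{finite,linorder}) vec"
  assumes n: "CARD('p) < n"
  shows "0 \<le> LT_form n v"
proof -
  define q where "q j = (\<Sum>k | k < j. (v $ k)\<^sup>2) + (real n - real (pos j)) * (v $ j)\<^sup>2" for j
  have d: "0 \<le> real n - real (pos j)" for j :: 'p using n pos_le_CARD[of j] by simp
  have "0 \<le> 2 * (q j)\<^sup>2 + ((v $ j)\<^sup>2)\<^sup>2 * ((real n - real (pos j)) * (real n - real (pos j) + 2) - 3 * (real n - real (pos j))\<^sup>2)" for j
  proof -
    have "(real n - real (pos j)) * (v $ j)\<^sup>2 \<le> q j" by (simp add: q_def sum_nonneg)
    then have "((real n - real (pos j)) * (v $ j)\<^sup>2)\<^sup>2 \<le> (q j)\<^sup>2" using d by (intro power_mono) auto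
    moreover have "0 \<le> 2 * (real n - real (pos j)) * ((v $ j)\<^sup>2)\<^sup>2" using d by simp
    ultimately show ?thesis by (simp add: power2_eq_square algebra_simps)
  qed
  then have "0 \<le> (\<Sum>j\<in>UNIV. q j)\<^sup>2 + (\<Sum>j\<in>UNIV. 2 * (q j)\<^sup>2 + ((v $ j)\<^sup>2)\<^sup>2 * ((real n - real (pos j)) * (real n - real (pos j) + 2) - 3 * (real n - real (pos j))\<^sup>2))"
    by (intro add_nonneg_nonneg[OF zero_le_power2] sum_nonneg)
  then show ?thesis
    unfolding LT_form_rows q_def[symmetric] by (simp add: sum.distrib sum_distrib_left)
qed

text \<open>
  The coordinates of \<open>B v\<close> are linear forms in different entries of \<open>B\<close>, and only the diagonal entry in each has
  an asymmetric law, as required by \<open>nn_integral_quartic\<close>.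
\<close>

lemma LT_fourth_moment:
  assumes n: "CARD('p::{finite,linorder}) < n"
  shows "\<exists>w>0. \<forall>v :: (real, 'p) vec. LT.fourth_moment n v = ennreal w * ennreal (LT_form n v)"
proof -
  have n0: "0 < real n" using n by simp
  have "\<forall>u :: 'p \<times> 'p. \<exists>Z. 0 < Z \<and> (\<integral>\<^sup>+t. ennreal (LT_factor n u t) \<partial>lborel) = ennreal Z \<and>
    (\<integral>\<^sup>+t. ennreal (LT_factor n u t * t\<^sup>2) \<partial>lborel) = ennreal (LT_factor_second n u * Z) \<and>
    (\<integral>\<^sup>+t. ennreal (LT_factor n u t * t ^ 4) \<partial>lborel) = ennreal (LT_factor_fourth n u * Z)"
    by (intro allI LT_factor_moments[OF n])
  from choice[OF this] obtain Z where Z': "\<forall>u :: 'p \<times> 'p. 0 < Z u \<and> (\<integral>\<^sup>+t. ennreal (LT_factor n u t) \<partial>lborel) = ennreal (Z u) \<and>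
    (\<integral>\<^sup>+t. ennreal (LT_factor n u t * t\<^sup>2) \<partial>lborel) = ennreal (LT_factor_second n u * Z u) \<and>
    (\<integral>\<^sup>+t. ennreal (LT_factor n u t * t ^ 4) \<partial>lborel) = ennreal (LT_factor_fourth n u * Z u)"
    by blast
  have Z: "0 < Z u" "(\<integral>\<^sup>+t. ennreal (LT_factor n u t) \<partial>lborel) = ennreal (Z u)"
    "(\<integral>\<^sup>+t. ennreal (LT_factor n u t * t\<^sup>2) \<partial>lborel) = ennreal (LT_factor_second n u * Z u)"
    "(\<integral>\<^sup>+t. ennreal (LT_factor n u t * t ^ 4) \<partial>lborel) = ennreal (LT_factor_fourth n u * Z u)" for u
    using spec[OF Z', of u] by (simp_all only: simp_thms)
  define h where "h u t = LT_factor n u t / Z u" for u t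
  have h [measurable]: "h u \<in> borel_measurable borel" for u
    unfolding h_def LT_factor_def by measurable
  have factor0: "0 \<le> LT_factor n u t" for u :: "'p \<times> 'p" and t
    by (simp add: LT_factor_def half_gauss_nonneg)
  have h0: "0 \<le> h u t" for u t using factor0 Z(1) by (simp add: h_def less_imp_le)
  have norm: "(\<integral>\<^sup>+t. ennreal (h u t * g t) \<partial>lborel) = ennreal c"
    if [measurable]: "g \<in> borel_measurable borel" and "(\<integral>\<^sup>+t. ennreal (LT_factor n u t * g t) \<partial>lborel) = ennreal (c * Z u)" "0 \<le> c"
    for u g c
  proof -
    have [measurable]: "LT_factor n u \<in> borel_measurable borel" unfolding LT_factor_def by measurable
    have "(\<integral>\<^sup>+t. ennreal (h u t * g t) \<partial>lborel) = (\<integral>\<^sup>+t. ennreal (1 / Z u) * ennreal (LT_factor n u t * g t) \<partial>lborel)"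
      using Z(1)[of u] by (intro nn_integral_cong) (simp add: h_def ennreal_mult'[symmetric])
    also have "\<dots> = ennreal (1 / Z u) * ennreal (c * Z u)"
      by (subst nn_integral_cmult) (auto simp: that(2))
    finally show ?thesis using Z(1)[of u] that(3) by (simp add: ennreal_mult'[symmetric])
  qed
  have d: "0 \<le> real n - real (pos j)" for j :: 'p
    using n pos_le_CARD[of j] by simp
  have var0: "0 \<le> LT_factor_second n u" and kurt0: "0 \<le> LT_factor_fourth n u" for u :: "'p \<times> 'p"
    using d by (auto simp: LT_factor_second_def LT_factor_fourth_def)
  define w where "w = (\<Prod>u\<in>lower. Z u) / (real n)\<^sup>2"
  have "0 < (\<Prod>u\<in>lower. Z u)" using Z(1) by (intro prod_pos) auto
  then have w: "0 < w" using n0 by (simp add: w_def)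
  have "LT.fourth_moment n v = ennreal w * ennreal (LT_form n v)" for v :: "(real, 'p) vec"
  proof -
    let ?S = "\<lambda>b j. \<Sum>u\<in>lower. if fst u = j then v $ snd u * b u else 0"
    let ?s = "\<lambda>j. \<Sum>u\<in>lower. if fst u = j then (v $ snd u)\<^sup>2 * LT_factor_second n u else 0"
    have row: "(mat_of lower b *v v) $ j = ?S b j" for b j
    proof -
      have "(mat_of lower b *v v) $ j = (\<Sum>k | k \<le> j. b (j, k) * v $ k)"
        by (simp add: matrix_vector_mult_def mat_of_nth lower_def sum.If_cases if_distrib[of "\<lambda>y. y * _"] cong: if_cong)
      also have "{k. k \<le> j} = insert j {k. k < j}" by auto
      finally show ?thesis by (simp add: sum_lower mult.commute)
    qed
    have norm4: "norm (mat_of lower b *v v) ^ 4 = (\<Sum>j\<in>UNIV. (?S b j)\<^sup>2)\<^sup>2" for b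
    proof -
      have "(norm (mat_of lower b *v v))\<^sup>2 = (\<Sum>j\<in>UNIV. (?S b j)\<^sup>2)"
        unfolding power2_norm_eq_inner inner_vec_def row by (simp add: power2_eq_square)
      then have "((norm (mat_of lower b *v v))\<^sup>2)\<^sup>2 = (\<Sum>j\<in>UNIV. (?S b j)\<^sup>2)\<^sup>2" by (simp only:)
      then show ?thesis by (simp add: power_mult[symmetric])
    qed
    have "LT.fourth_moment n v = (\<integral>\<^sup>+b. ennreal ((\<Prod>u\<in>lower. LT_factor n u (b u)) * (\<Sum>j\<in>UNIV. (?S b j)\<^sup>2)\<^sup>2) \<partial>coords lower)"
      unfolding LT.fourth_moment_def LT.matrix_mean_def LT_weight_factor[OF n] norm4 ..
    also have "\<dots> = (\<integral>\<^sup>+b. ennreal (\<Prod>u\<in>lower. Z u) * ennreal ((\<Prod>u\<in>lower. h u (b u)) * (\<Sum>j\<in>UNIV. (?S b j)\<^sup>2)\<^sup>2) \<partial>coords lower)"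
    proof (rule nn_integral_cong)
      fix b
      have "LT_factor n u t = Z u * h u t" for u t using Z(1)[of u] by (simp add: h_def)
      then have "(\<Prod>u\<in>lower. LT_factor n u (b u)) = (\<Prod>u\<in>lower. Z u) * (\<Prod>u\<in>lower. h u (b u))"
        by (simp add: prod.distrib)
      then show "ennreal ((\<Prod>u\<in>lower. LT_factor n u (b u)) * (\<Sum>j\<in>UNIV. (?S b j)\<^sup>2)\<^sup>2) =
          ennreal (\<Prod>u\<in>lower. Z u) * ennreal ((\<Prod>u\<in>lower. h u (b u)) * (\<Sum>j\<in>UNIV. (?S b j)\<^sup>2)\<^sup>2)"
        using \<open>0 < (\<Prod>u\<in>lower. Z u)\<close> by (simp add: ennreal_mult'[symmetric] mult.assoc)
    qed
    also have "\<dots> = ennreal (\<Prod>u\<in>lower. Z u) * (\<integral>\<^sup>+b. ennreal ((\<Prod>u\<in>lower. h u (b u)) * (\<Sum>j\<in>UNIV. (?S b j)\<^sup>2)\<^sup>2) \<partial>coords lower)"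
    proof (rule nn_integral_cmult)
      have "(\<lambda>b. \<Prod>u\<in>lower. h u (b u)) \<in> borel_measurable (coords lower)"
        by (intro borel_measurable_prod measurable_compose[OF _ h]) (auto intro!: measurable_PiM_lborel_component[where f="\<lambda>x. x"])
      moreover have "(\<lambda>b. ?S b j) \<in> borel_measurable (coords lower)" for j
        by (intro borel_measurable_sum) (auto intro!: borel_measurable_times measurable_PiM_lborel_component[where f="\<lambda>x. x" and I=lower])
      ultimately show "(\<lambda>b. ennreal ((\<Prod>u\<in>lower. h u (b u)) * (\<Sum>j\<in>UNIV. (?S b j)\<^sup>2)\<^sup>2)) \<in> borel_measurable (coords lower)"
        by measurable
    qed
    also have "(\<integral>\<^sup>+b. ennreal ((\<Prod>u\<in>lower. h u (b u)) * (\<Sum>j\<in>UNIV. (?S b j)\<^sup>2)\<^sup>2) \<partial>coords lower) =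
        ennreal ((\<Sum>j\<in>UNIV. ?s j)\<^sup>2 + 2 * (\<Sum>j\<in>UNIV. (?s j)\<^sup>2) +
          (\<Sum>u\<in>lower. (v $ snd u) ^ 4 * (LT_factor_fourth n u - 3 * (LT_factor_second n u)\<^sup>2)))"
    proof (rule nn_integral_quartic[where row=fst and symm="\<lambda>u. fst u \<noteq> snd u"])
      show "(\<integral>\<^sup>+t. ennreal (h u t) \<partial>lborel) = 1" for u
        using norm[of "\<lambda>_. 1" u 1] Z(2)[of u] by simp
      show "(\<integral>\<^sup>+t. ennreal (h u t * t\<^sup>2) \<partial>lborel) = ennreal (LT_factor_second n u)" for u
        by (rule norm) (use Z(3) var0 in auto)
      show "(\<integral>\<^sup>+t. ennreal (h u t * t ^ 4) \<partial>lborel) = ennreal (LT_factor_fourth n u)" for u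
        by (rule norm) (use Z(4) kurt0 in auto)
      show "h u (- t) = h u t" if "fst u \<noteq> snd u" for u t
        using that by (simp add: h_def LT_factor_def)
    qed (use h h0 var0 kurt0 in \<open>auto intro: prod_eqI\<close>)
    also have "(\<Sum>j\<in>UNIV. ?s j)\<^sup>2 + 2 * (\<Sum>j\<in>UNIV. (?s j)\<^sup>2) +
          (\<Sum>u\<in>lower. (v $ snd u) ^ 4 * (LT_factor_fourth n u - 3 * (LT_factor_second n u)\<^sup>2)) = LT_form n v / (real n)\<^sup>2"
    proof -
      let ?x = "\<lambda>j. (v $ j)\<^sup>2"
      let ?q = "\<lambda>j. (\<Sum>k | k < j. ?x k) + (real n - real (pos j)) * ?x j"
      have s: "?s j = ?q j / n" for j
      proof -
        have "(\<Sum>k | k < j. ?x k * LT_factor_second n (j, k)) = (\<Sum>k | k < j. ?x k) / n"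
          unfolding sum_divide_distrib by (rule sum.cong) (auto simp: LT_factor_second_def)
        then show ?thesis
          unfolding sum_lower snd_conv by (simp add: LT_factor_second_def[of n "(j, j)"] add_divide_distrib)
      qed
      have "(\<Sum>u\<in>lower. (v $ snd u) ^ 4 * (LT_factor_fourth n u - 3 * (LT_factor_second n u)\<^sup>2)) =
        (\<Sum>u\<in>lower. if fst u = snd u then (?x (snd u))\<^sup>2 * ((real n - real (pos (fst u))) * (real n - real (pos (fst u)) + 2)
           - 3 * (real n - real (pos (fst u)))\<^sup>2) / (real n)\<^sup>2 else 0)"
        by (intro sum.cong refl)
          (auto simp: LT_factor_fourth_def LT_factor_second_def power_divide diff_divide_distrib right_diff_distrib power_mult[symmetric])
      then have excess: "(\<Sum>u\<in>lower. (v $ snd u) ^ 4 * (LT_factor_fourth n u - 3 * (LT_factor_second n u)\<^sup>2)) =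
        (\<Sum>j\<in>UNIV. (?x j)\<^sup>2 * ((real n - real (pos j)) * (real n - real (pos j) + 2) - 3 * (real n - real (pos j))\<^sup>2)) / (real n)\<^sup>2"
        unfolding sum_lower_diag by (simp add: sum_divide_distrib)
      have "(\<Sum>j\<in>UNIV. ?s j)\<^sup>2 + 2 * (\<Sum>j\<in>UNIV. (?s j)\<^sup>2) + (\<Sum>u\<in>lower. (v $ snd u) ^ 4 * (LT_factor_fourth n u - 3 * (LT_factor_second n u)\<^sup>2)) =
        ((\<Sum>j\<in>UNIV. ?q j)\<^sup>2 + 2 * (\<Sum>j\<in>UNIV. (?q j)\<^sup>2) +
          (\<Sum>j\<in>UNIV. (?x j)\<^sup>2 * ((real n - real (pos j)) * (real n - real (pos j) + 2) - 3 * (real n - real (pos j))\<^sup>2))) / (real n)\<^sup>2"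
        unfolding s excess power_divide sum_divide_distrib[symmetric] by (simp add: add_divide_distrib)
      also have "\<dots> = LT_form n v / (real n)\<^sup>2"
        unfolding LT_form_rows ..
      finally show ?thesis .
    qed
    also have "ennreal (\<Prod>u\<in>lower. Z u) * ennreal (LT_form n v / (real n)\<^sup>2) = ennreal w * ennreal (LT_form n v)"
    proof -
      have "0 \<le> (\<Prod>u\<in>lower. Z u)" using \<open>0 < (\<Prod>u\<in>lower. Z u)\<close> by simp
      then show ?thesis using w by (simp add: ennreal_mult'[symmetric] w_def)
    qed
    finally show ?thesis .
  qed
  then show ?thesis using w by blast
qed

section \<open>Conditional means for the two groups\<close>

lemma GL_conditional_means:
  assumes n: "CARD('p::{finite,linorder}) < CARD('n::finite)"
  obtains \<alpha> \<beta> \<gamma> :: real where "0 \<le> \<alpha>" "0 < \<beta>" "0 \<le> \<gamma>"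
    "\<And>R :: ('n::finite \<Rightarrow> (real, 'p::{finite,linorder}) vec) set. invariant_set GLp R \<Longrightarrow>
      (\<integral>\<^sup>+x. indicator R x * (ennreal (sum_norm4 x) * ennreal (gauss x)) \<partial>samples) =
      (\<integral>\<^sup>+x. indicator R x * (ennreal (\<alpha> + \<beta> * GL_stat (standardized x)) * ennreal (gauss x)) \<partial>samples)"
    "\<And>R :: ('n::finite \<Rightarrow> (real, 'p::{finite,linorder}) vec) set. invariant_set GLp R \<Longrightarrow>
      (\<integral>\<^sup>+x. indicator R x * (ennreal (sum_norm2 x) * ennreal (gauss x)) \<partial>samples) =
      (\<integral>\<^sup>+x. indicator R x * (ennreal \<gamma> * ennreal (gauss x)) \<partial>samples)"
proof -
  define e :: "(real, 'p) vec" where "e = axis (SOME i. True) 1"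
  have e: "norm e = 1" by (simp add: e_def)
  obtain w where w: "GL.fourth_moment CARD('n) e = ennreal w" "0 < w"
    using ennreal_eq_positive[OF GL_fourth_moment_bounds[OF n e]] by (elim exE conjE) (rule that)
  show thesis
  proof (rule GL.conditional_means[OF n w(2), of "\<lambda>v. norm v ^ 4"])
    show "GL.fourth_moment CARD('n) v = ennreal w * ennreal (norm v ^ 4)" for v :: "(real, 'p) vec"
      using GL_fourth_moment[OF e, of "CARD('n)" v] by (simp only: w(1))
    show "norm (standardized (\<lambda>i. a + B *v x i) i) ^ 4 = norm (standardized x i) ^ 4"
      if "B \<in> GLp" "positive_definite (sample_cov x)" for a and B :: "'p sqmat" and i and x :: "'n \<Rightarrow> (real, 'p) vec"
      using that by (simp add: norm_standardized_affine GLp_def)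
  qed (auto intro: that simp: GL_stat_def)
qed

lemma LT_conditional_means:
  assumes n: "CARD('p::{finite,linorder}) < CARD('n::finite)"
  obtains \<alpha> \<beta> \<gamma> :: real where "0 \<le> \<alpha>" "0 < \<beta>" "0 \<le> \<gamma>"
    "\<And>R :: ('n::finite \<Rightarrow> (real, 'p::{finite,linorder}) vec) set. invariant_set LTp R \<Longrightarrow>
      (\<integral>\<^sup>+x. indicator R x * (ennreal (sum_norm4 x) * ennreal (gauss x)) \<partial>samples) =
      (\<integral>\<^sup>+x. indicator R x * (ennreal (\<alpha> + \<beta> * LT_stat (standardized x)) * ennreal (gauss x)) \<partial>samples)"
    "\<And>R :: ('n::finite \<Rightarrow> (real, 'p::{finite,linorder}) vec) set. invariant_set LTp R \<Longrightarrow>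
      (\<integral>\<^sup>+x. indicator R x * (ennreal (sum_norm2 x) * ennreal (gauss x)) \<partial>samples) =
      (\<integral>\<^sup>+x. indicator R x * (ennreal \<gamma> * ennreal (gauss x)) \<partial>samples)"
proof -
  obtain w where w: "0 < w" "\<And>v :: (real, 'p) vec. LT.fourth_moment CARD('n) v = ennreal w * ennreal (LT_form CARD('n) v)"
    using LT_fourth_moment[OF n] by blast
  show thesis
  proof (rule LT.conditional_means[OF n w(1), of "LT_form CARD('n)"])
    show "(LT_form CARD('n) :: (real, 'p) vec \<Rightarrow> real) \<in> borel_measurable borel"
      unfolding LT_form_def Let_def by measurable
    show "0 \<le> LT_form CARD('n) v" for v :: "(real, 'p) vec" by (rule LT_form_nonneg[OF n])
    show "LT_form CARD('n) (standardized (\<lambda>i. a + B *v x i) i) = LT_form CARD('n) (standardized x i)"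
      if "B \<in> LTp" "positive_definite (sample_cov x)" for a and B :: "'p sqmat" and i and x :: "'n \<Rightarrow> (real, 'p) vec"
      using that by (simp add: standardized_affine_LTp)
  qed (auto intro: that w simp: LT_stat_eq_sum)
qed

text \<open>
  The mixing measure \<open>\<omega>\<close> has finite total mass, because \<open>gauss\<close> is integrable and has the same positive
  average over all orbits.
\<close>

lemma (in matrix_group) nn_integral_finite_of_orbits:
  fixes F :: "('n::finite \<Rightarrow> (real, 'p) vec) \<Rightarrow> ennreal"
  assumes n: "CARD('p) < CARD('n)" and F: "F \<in> borel_measurable samples" and C: "C < \<infinity>"
    and le: "\<And>z. std_sample z \<Longrightarrow> orbit_integral F z \<le> C"
  shows "(\<integral>\<^sup>+x. F x \<partial>samples) < \<infinity>"
proof -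
  let ?S = "samples :: ('n \<Rightarrow> (real, 'p) vec) measure"
  obtain \<omega> :: "('n \<Rightarrow> (real, 'p) vec) \<Rightarrow> ennreal" where \<omega>: "\<omega> \<in> borel_measurable ?S"
    "\<And>F. F \<in> borel_measurable samples \<Longrightarrow>
      (\<integral>\<^sup>+x. F x \<partial>?S) = (\<integral>\<^sup>+y. \<omega> y * orbit_integral F (standardized y) \<partial>?S)"
    "\<And>y. \<not> positive_definite (sample_cov y) \<Longrightarrow> \<omega> y = 0"
    by (rule disintegration[OF n]) blast
  note [measurable] = \<omega>(1)
  let ?one = "group_mean CARD('n) (\<lambda>_ _. 1)"
  have std: "\<omega> y = 0 \<or> std_sample (standardized y)" for y
    using \<omega>(3) std_sample_standardized by blast
  have "(\<integral>\<^sup>+x. 1 * ennreal (gauss x) \<partial>?S) = (\<integral>\<^sup>+y. \<omega> y * orbit_integral (\<lambda>x. 1 * ennreal (gauss x)) (standardized y) \<partial>?S)"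
    by (rule \<omega>(2)) measurable
  also have "\<dots> = (\<integral>\<^sup>+y. \<omega> y * ?one \<partial>?S)"
  proof (rule nn_integral_cong)
    fix y
    show "\<omega> y * orbit_integral (\<lambda>x. 1 * ennreal (gauss x)) (standardized y) = \<omega> y * ?one"
      using std[of y] orbit_integral_gauss[of "standardized y" "\<lambda>_. 1"] by auto
  qed
  also have "\<dots> = (\<integral>\<^sup>+y. \<omega> y \<partial>?S) * ?one" by (rule nn_integral_multc) measurable
  finally have "(\<integral>\<^sup>+y. \<omega> y \<partial>?S) * ?one < \<infinity>"
    using nn_integral_gauss(1)[where 'n='n and 'p='p] by simp
  then have fin: "(\<integral>\<^sup>+y. \<omega> y \<partial>?S) < \<infinity>"
    using group_mean_bounds(2)[OF n] by (auto simp: ennreal_mult_less_top)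
  have "(\<integral>\<^sup>+x. F x \<partial>?S) = (\<integral>\<^sup>+y. \<omega> y * orbit_integral F (standardized y) \<partial>?S)"
    by (rule \<omega>(2)[OF F])
  also have "\<dots> \<le> (\<integral>\<^sup>+y. \<omega> y * C \<partial>?S)"
  proof (rule nn_integral_mono)
    fix y
    show "\<omega> y * orbit_integral F (standardized y) \<le> \<omega> y * C"
      using std[of y] le[of "standardized y"] by (auto intro: mult_left_mono)
  qed
  also have "\<dots> = (\<integral>\<^sup>+y. \<omega> y \<partial>?S) * C" by (rule nn_integral_multc) measurable
  also have "\<dots> < \<infinity>" using fin C by (simp add: ennreal_mult_less_top)
  finally show ?thesis .
qed

section \<open>The law of the sample\<close>

lemma sets_samples: "sets (\<Pi>\<^sub>M i\<in>UNIV. borel) = sets (samples :: ('n::finite \<Rightarrow> real^'p) measure)"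
  by (intro sets_PiM_cong) auto

lemma invariant_region_iff:
  fixes R :: "('n::finite \<Rightarrow> real^'p) set"
  assumes G: "G \<subseteq> GLp" and R: "invariant_region G R" and B: "B \<in> G"
  shows "(\<lambda>i. a + B *v x i) \<in> R \<longleftrightarrow> x \<in> R"
proof
  have image: "(\<lambda>x i. a + B *v x i) ` R = R" using R B by (simp add: invariant_region_def)
  have inv: "invertible B" using G B by (auto simp: GLp_def)
  show "(\<lambda>i. a + B *v x i) \<in> R" if "x \<in> R" using image that by blast
  assume "(\<lambda>i. a + B *v x i) \<in> R"
  then obtain y where y: "y \<in> R" "(\<lambda>i. a + B *v x i) = (\<lambda>i. a + B *v y i)" using image by blast
  have "x i = y i" for i
  proof -
    have "B *v x i = B *v y i" using fun_cong[OF y(2), of i] by simp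
    then have "matrix_inv B *v (B *v x i) = matrix_inv B *v (B *v y i)" by simp
    then show ?thesis by (simp add: matrix_vector_mul_assoc matrix_inv_mult[OF inv])
  qed
  then show "x \<in> R" using y(1) by (metis ext)
qed

lemma invariant_set_invariant_region:
  fixes R :: "('n::finite \<Rightarrow> real^'p) set"
  assumes "G \<subseteq> GLp" "invariant_region G R"
  shows "invariant_set G R"
  using assms(2) invariant_region_iff[OF assms] sets_samples
  by (auto simp: invariant_set_def invariant_region_def)

text \<open>
  The power of the region \<open>E\<close> at \<open>a = 0\<close> and \<open>B = I\<close>; see \<open>measure_sample_law\<close>.
\<close>

definition power_fun :: "(real^'p \<Rightarrow> real \<Rightarrow> real) \<Rightarrow> ('n::finite \<Rightarrow> real^'p) set \<Rightarrow> real \<Rightarrow> real" where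
  "power_fun f E \<theta> = (\<integral>x. indicator E x * (\<Prod>i\<in>UNIV. f (x i) \<theta>) \<partial>samples)"

lemma nn_integral_density_prod:
  fixes h :: "real^'p \<Rightarrow> real"
  assumes "is_density h"
  shows "(\<integral>\<^sup>+x. ennreal (\<Prod>i\<in>UNIV. h (x i)) \<partial>(samples :: ('n::finite \<Rightarrow> real^'p) measure)) = 1"
proof -
  have h: "h \<in> borel_measurable borel" "\<And>x. 0 \<le> h x" "(\<integral>\<^sup>+x. ennreal (h x) \<partial>lborel) = 1"
    using assms by (auto simp: is_density_def)
  have "(\<integral>\<^sup>+x. ennreal (\<Prod>i\<in>UNIV. h (x i)) \<partial>(samples :: ('n \<Rightarrow> real^'p) measure)) =
      (\<integral>\<^sup>+x. (\<Prod>i\<in>UNIV. ennreal (h (x i))) \<partial>(samples :: ('n \<Rightarrow> real^'p) measure))"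
    by (simp add: prod_ennreal h)
  also have "\<dots> = (\<Prod>i\<in>(UNIV :: 'n set). (\<integral>\<^sup>+x. ennreal (h x) \<partial>lborel))"
    by (rule lborel_prod.product_nn_integral_prod) (use h in auto)
  finally show ?thesis by (simp add: h)
qed

text \<open>
  The substitution \<open>x = a + B y\<close> turns the law of the sample into that with \<open>a = 0\<close> and \<open>B = I\<close>.
\<close>

lemma measure_sample_law:
  fixes f :: "real^'p \<Rightarrow> real \<Rightarrow> real" and R :: "('n::finite \<Rightarrow> real^'p) set"
  assumes dens: "is_density (\<lambda>x. f x \<theta>)" and B: "B \<in> GLp" and R [measurable]: "R \<in> sets samples"
  shows "measure (sample_law f \<theta> a B) R = power_fun f {x. (\<lambda>i. a + B *v x i) \<in> R} \<theta>"
proof -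
  let ?S = "samples :: ('n \<Rightarrow> real^'p) measure"
  have inv: "invertible B" "det B \<noteq> 0" using B by (auto simp: GLp_def invertible_det_nz)
  have [measurable]: "(\<lambda>x. f x \<theta>) \<in> borel_measurable borel" and f0: "\<And>x. 0 \<le> f x \<theta>"
    and f1: "(\<integral>\<^sup>+x. ennreal (f x \<theta>) \<partial>lborel) = 1"
    using dens by (auto simp: is_density_def)
  define g where "g x = affine_density f a B \<theta> x" for x
  have g0: "0 \<le> g x" for x using f0 by (simp add: g_def affine_density_def)
  have g [measurable]: "g \<in> borel_measurable borel" unfolding g_def affine_density_def by measurable
  have gB: "g (a + B *v x) = f x \<theta> / \<bar>det B\<bar>" for x
    by (simp add: g_def affine_density_def matrix_vector_mul_assoc matrix_inv_mult[OF inv(1)])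
  have g1: "(\<integral>\<^sup>+x. ennreal (g x) \<partial>lborel) = 1"
  proof -
    have "(\<integral>\<^sup>+x. ennreal (g x) \<partial>lborel) = ennreal \<bar>det B\<bar> * (\<integral>\<^sup>+x. ennreal (g (a + B *v x)) \<partial>lborel)"
      by (rule nn_integral_lborel_affine[OF inv(2)]) measurable
    also have "\<dots> = (\<integral>\<^sup>+x. ennreal \<bar>det B\<bar> * ennreal (g (a + B *v x)) \<partial>lborel)"
      by (rule nn_integral_cmult[symmetric]) measurable
    also have "\<dots> = (\<integral>\<^sup>+x. ennreal (f x \<theta>) \<partial>lborel)"
      using inv(2) f0 by (intro nn_integral_cong) (simp add: gB ennreal_mult'[symmetric])
    finally show ?thesis by (simp add: f1)
  qed
  let ?D = "density lborel (\<lambda>x. ennreal (g x))"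
  interpret D: prob_space ?D
    by (rule prob_spaceI) (simp add: emeasure_density g1)
  interpret PD: product_sigma_finite "\<lambda>_ :: 'n. ?D" ..
  have "density ?S (\<lambda>x. \<Prod>i\<in>UNIV. ennreal (g (x i))) = Pi\<^sub>M UNIV (\<lambda>_. ?D)"
  proof (rule PD.PiM_eqI)
    show "sets (density ?S (\<lambda>x. \<Prod>i\<in>UNIV. ennreal (g (x i)))) = sets (Pi\<^sub>M UNIV (\<lambda>_. ?D))"
      by (simp, intro sets_PiM_cong) auto
    fix A :: "'n \<Rightarrow> (real^'p) set" assume A: "\<And>i. i \<in> UNIV \<Longrightarrow> A i \<in> sets ?D"
    then have [measurable]: "A i \<in> sets borel" for i by simp
    have PA [measurable]: "Pi\<^sub>E UNIV A \<in> sets ?S" using A by (intro sets_PiM_I_finite) auto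
    have [measurable]: "(\<lambda>x. \<Prod>i\<in>UNIV. ennreal (g (x i))) \<in> borel_measurable ?S" by measurable
    have "emeasure (density ?S (\<lambda>x. \<Prod>i\<in>UNIV. ennreal (g (x i)))) (Pi\<^sub>E UNIV A) =
        (\<integral>\<^sup>+x. (\<Prod>i\<in>UNIV. ennreal (g (x i))) * indicator (Pi\<^sub>E UNIV A) x \<partial>?S)"
      by (rule emeasure_density) measurable
    also have "\<dots> = (\<integral>\<^sup>+x. (\<Prod>i\<in>UNIV. ennreal (g (x i)) * indicator (A i) (x i)) \<partial>?S)"
    proof (rule nn_integral_cong)
      fix x :: "'n \<Rightarrow> real^'p"
      have "indicator (Pi\<^sub>E UNIV A) x = (\<Prod>i\<in>UNIV. indicator (A i) (x i) :: ennreal)"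
      proof (cases "\<forall>i. x i \<in> A i")
        case False
        then obtain i where i: "x i \<notin> A i" by blast
        then have "(\<Prod>i\<in>UNIV. indicator (A i) (x i) :: ennreal) = 0"
          by (intro prod_zero bexI[of _ i]) auto
        moreover have "x \<notin> Pi\<^sub>E UNIV A" using i by (auto simp: PiE_def)
        ultimately show ?thesis by (simp only: indicator_simps not_False_eq_True)
      qed (auto simp: PiE_def)
      then show "(\<Prod>i\<in>UNIV. ennreal (g (x i))) * indicator (Pi\<^sub>E UNIV A) x = (\<Prod>i\<in>UNIV. ennreal (g (x i)) * indicator (A i) (x i))"
        by (simp add: prod.distrib)
    qed
    also have "\<dots> = (\<Prod>i\<in>UNIV. \<integral>\<^sup>+x. ennreal (g x) * indicator (A i) x \<partial>lborel)"
      by (rule lborel_prod.product_nn_integral_prod) auto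
    finally show "emeasure (density ?S (\<lambda>x. \<Prod>i\<in>UNIV. ennreal (g (x i)))) (Pi\<^sub>E UNIV A) = (\<Prod>i\<in>UNIV. emeasure ?D (A i))"
      by (simp add: emeasure_density)
  qed simp
  then have law: "(sample_law f \<theta> a B :: ('n \<Rightarrow> real^'p) measure) = density ?S (\<lambda>x. \<Prod>i\<in>UNIV. ennreal (g (x i)))"
    by (simp add: sample_law_def g_def[symmetric])
  let ?E = "{x. (\<lambda>i. a + B *v x i) \<in> R}"
  have "(\<lambda>x. (\<lambda>i. a + B *v x i)) -` R \<inter> space ?S \<in> sets ?S"
    by (rule measurable_sets[OF _ R]) measurable
  then have [measurable]: "?E \<in> sets ?S" by (simp add: vimage_def space_PiM)
  have "emeasure (sample_law f \<theta> a B) R = (\<integral>\<^sup>+x. (\<Prod>i\<in>UNIV. ennreal (g (x i))) * indicator R x \<partial>?S)"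
    unfolding law by (rule emeasure_density) measurable
  also have "\<dots> = ennreal (\<bar>det B\<bar> ^ CARD('n)) * (\<integral>\<^sup>+x. (\<Prod>i\<in>UNIV. ennreal (g (a + B *v x i))) * indicator R (\<lambda>i. a + B *v x i) \<partial>?S)"
    by (rule nn_integral_samples_affine[OF inv(2), where a="\<lambda>_. a"]) measurable
  also have "\<dots> = (\<integral>\<^sup>+x. ennreal (\<bar>det B\<bar> ^ CARD('n)) * ((\<Prod>i\<in>UNIV. ennreal (g (a + B *v x i))) * indicator R (\<lambda>i. a + B *v x i)) \<partial>?S)"
    by (rule nn_integral_cmult[symmetric]) measurable
  also have "\<dots> = (\<integral>\<^sup>+x. ennreal (indicator ?E x * (\<Prod>i\<in>UNIV. f (x i) \<theta>)) \<partial>?S)"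
  proof (rule nn_integral_cong)
    fix x :: "'n \<Rightarrow> real^'p"
    have "(\<Prod>i\<in>UNIV. ennreal (g (a + B *v x i))) = ennreal ((\<Prod>i\<in>UNIV. f (x i) \<theta>) / \<bar>det B\<bar> ^ CARD('n))"
      using f0 by (simp add: gB prod_ennreal prod_dividef)
    then have "ennreal (\<bar>det B\<bar> ^ CARD('n)) * (\<Prod>i\<in>UNIV. ennreal (g (a + B *v x i))) = ennreal (\<Prod>i\<in>UNIV. f (x i) \<theta>)"
      using inv(2) by (simp add: ennreal_mult'[symmetric])
    then show "ennreal (\<bar>det B\<bar> ^ CARD('n)) * ((\<Prod>i\<in>UNIV. ennreal (g (a + B *v x i))) * indicator R (\<lambda>i. a + B *v x i)) =
        ennreal (indicator ?E x * (\<Prod>i\<in>UNIV. f (x i) \<theta>))"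
      by (simp add: mult.assoc[symmetric] indicator_def)
  qed
  finally have "emeasure (sample_law f \<theta> a B) R = (\<integral>\<^sup>+x. ennreal (indicator ?E x * (\<Prod>i\<in>UNIV. f (x i) \<theta>)) \<partial>?S)" .
  moreover have "power_fun f ?E \<theta> = enn2real (\<integral>\<^sup>+x. ennreal (indicator ?E x * (\<Prod>i\<in>UNIV. f (x i) \<theta>)) \<partial>?S)"
    unfolding power_fun_def using f0 by (intro integral_eq_nn_integral) (auto intro!: mult_nonneg_nonneg prod_nonneg)
  ultimately show ?thesis by (simp add: measure_def)
qed

section \<open>Differentiating the power functions\<close>

text \<open>
  Applied to the difference quotients of the densities: it bounds the difference quotient of the likelihood,
  uniformly in \<open>t\<close>, by a polynomial in their common bound \<open>d\<close>.
\<close>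

lemma abs_prod_one_plus_le:
  fixes r :: "'a \<Rightarrow> real"
  assumes "finite A" "0 \<le> t" "t \<le> 1" "\<And>i. i \<in> A \<Longrightarrow> \<bar>r i\<bar> \<le> d" "0 \<le> d"
  shows "\<bar>(\<Prod>i\<in>A. 1 + t * r i) - 1\<bar> \<le> t * ((1 + d) ^ card A - 1)"
  using assms
proof (induction A rule: finite_induct)
  case (insert j A)
  let ?P = "\<Prod>i\<in>A. 1 + t * r i"
  have IH: "\<bar>?P - 1\<bar> \<le> t * ((1 + d) ^ card A - 1)" using insert by simp
  have rj: "\<bar>r j\<bar> \<le> d" using insert.prems by simp
  have one: "1 \<le> (1 + d) ^ card A" using insert.prems by simp
  have tr: "\<bar>t * r j\<bar> \<le> t * d" using rj insert.prems by (simp add: abs_mult mult_left_mono)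
  have "t * d \<le> d" using insert.prems by (simp add: mult_left_le_one_le)
  then have f: "\<bar>1 + t * r j\<bar> \<le> 1 + d" using tr by linarith
  have "(\<Prod>i\<in>insert j A. 1 + t * r i) - 1 = (?P - 1) * (1 + t * r j) + t * r j"
    using insert.hyps by (simp add: algebra_simps)
  then have "\<bar>(\<Prod>i\<in>insert j A. 1 + t * r i) - 1\<bar> \<le> \<bar>?P - 1\<bar> * \<bar>1 + t * r j\<bar> + \<bar>t * r j\<bar>"
    by (metis abs_mult abs_triangle_ineq)
  also have "\<dots> \<le> t * ((1 + d) ^ card A - 1) * (1 + d) + t * d"
    using IH f tr one insert.prems by (intro add_mono mult_mono) auto
  also have "\<dots> = t * ((1 + d) ^ card (insert j A) - 1)"
    using insert.hyps by (simp add: algebra_simps)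
  finally show ?case .
qed simp

lemma one_plus_power_le:
  fixes d :: real
  assumes "0 \<le> d"
  shows "(1 + d) ^ n \<le> 2 ^ n * (1 + d ^ n)"
proof (cases "d \<le> 1")
  case True
  then have "(1 + d) ^ n \<le> 2 ^ n" using assms by (intro power_mono) auto
  also have "\<dots> \<le> 2 ^ n * (1 + d ^ n)" using assms by simp
  finally show ?thesis .
next
  case False
  then have "(1 + d) ^ n \<le> (2 * d) ^ n" by (intro power_mono) auto
  also have "\<dots> \<le> 2 ^ n * (1 + d ^ n)" by (simp add: power_mult_distrib)
  finally show ?thesis .
qed

text \<open>
  The argument \<open>N\<close> serves to fix the type of the indices of a sample.
\<close>

locale normal_alternatives =
  fixes f :: "(real, 'p::{finite,linorder}) vec \<Rightarrow> real \<Rightarrow> real" and p\<^sub>0 p\<^sub>1 p\<^sub>2 \<epsilon> :: real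
    and N :: "'n::finite itself"
  assumes n: "CARD('p) < CARD('n)"
    and dens: "\<And>\<theta>. \<theta> \<ge> 0 \<Longrightarrow> is_density (\<lambda>x. f x \<theta>)"
    and null: "\<And>x. f x 0 = (2 * pi) powr (- real CARD('p) / 2) * exp (- ((norm x)\<^sup>2 / 2))"
    and C1: "log_C1 f"
    and p\<^sub>0: "p\<^sub>0 > 0"
    and score: "\<And>x. d_theta f x 0 / f x 0 = p\<^sub>0 * norm x ^ 4 + p\<^sub>1 * (norm x)\<^sup>2 + p\<^sub>2"
    and \<epsilon>: "\<epsilon> > 0"
    and dominated: "(\<integral>\<^sup>+B\<in>GLp. (\<integral>\<^sup>+a. g_sup TYPE('n) f a B \<epsilon> ^ CARD('n) *
            ennreal (exp (- real CARD('n) / 2 * (norm a)\<^sup>2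
                          - real CARD('n) / 2 * trace (transpose B ** B)) *
                     \<bar>det B\<bar> ^ (CARD('n) - CARD('p) - 1)) \<partial>lborel) \<partial>lborel) < \<infinity>"
begin

lemma f_pos: "0 \<le> \<theta> \<Longrightarrow> 0 < f x \<theta>"
  using C1 by (simp add: log_C1_def)

lemma f_measurable: "0 \<le> \<theta> \<Longrightarrow> (\<lambda>x. f x \<theta>) \<in> borel_measurable borel"
  using dens by (simp add: is_density_def)

lemma f_derivative:
  assumes "0 \<le> \<theta>"
  shows "(f x has_field_derivative d_theta f x \<theta>) (at \<theta> within {0..})"
proof -
  have "(\<lambda>\<theta>. ln (f x \<theta>)) differentiable (at \<theta> within {0..})"
    using C1 assms by (simp add: log_C1_def differentiable_on_def)
  then obtain D where "((\<lambda>\<theta>. ln (f x \<theta>)) has_field_derivative D) (at \<theta> within {0..})"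
    by (auto simp: real_differentiable_def)
  then have "((\<lambda>\<theta>. exp (ln (f x \<theta>))) has_field_derivative exp (ln (f x \<theta>)) * D) (at \<theta> within {0..})"
    by (rule DERIV_chain2[OF DERIV_exp])
  then have "(f x has_field_derivative exp (ln (f x \<theta>)) * D) (at \<theta> within {0..})"
    by (rule has_field_derivative_transform_within[OF _ zero_less_one]) (use assms f_pos in auto)
  then have "f x differentiable (at \<theta> within {0..})" by (auto simp: real_differentiable_def)
  then have "(f x has_vector_derivative d_theta f x \<theta>) (at \<theta> within {0..})"
    unfolding d_theta_def by (simp only: vector_derivative_works)
  then show ?thesis by (simp add: has_real_derivative_iff_has_vector_derivative)
qed

definition quot :: "real \<Rightarrow> (real, 'p) vec \<Rightarrow> real" where
  "quot \<theta> x = (f x \<theta> - f x 0) / (\<theta> * f x 0)"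

lemma f_eq_quot: "0 < \<theta> \<Longrightarrow> f x \<theta> = f x 0 * (1 + \<theta> * quot \<theta> x)"
  using f_pos[of 0 x] by (simp add: quot_def field_simps)

lemma quot_measurable: "0 \<le> \<theta> \<Longrightarrow> quot \<theta> \<in> borel_measurable borel"
  unfolding quot_def using f_measurable[of \<theta>] f_measurable[of 0] by measurable

text \<open>
  The difference quotients, rather than the derivatives, serve to dominate the integrands; by the mean
  value theorem they too are bounded by \<open>g_sup\<close>, and they are measurable.
\<close>

lemma quot_le_g_sup:
  assumes \<theta>: "0 < \<theta>" "\<theta> \<le> \<epsilon>" and z: "norm z \<le> sqrt CARD('n)"
  shows "ennreal \<bar>quot \<theta> (a + B *v z)\<bar> \<le> g_sup TYPE('n) f a B \<epsilon>"
proof -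
  let ?x = "a + B *v z"
  have "\<exists>\<xi>\<in>{0..\<theta>}. f ?x \<theta> - f ?x 0 = (\<theta> - 0) * d_theta f ?x \<xi>"
  proof (rule mvt_very_simple)
    fix t assume t: "0 \<le> t" "t \<le> \<theta>"
    then show "(f ?x has_derivative (\<lambda>h. h * d_theta f ?x t)) (at t within {0..\<theta>})"
      using f_derivative[of t ?x, THEN has_field_derivative_subset, of "{0..\<theta>}"]
      by (simp add: has_field_derivative_def mult_commute_abs)
  qed (use \<theta> in simp)
  then obtain \<xi> where \<xi>: "\<xi> \<in> {0..\<theta>}" "f ?x \<theta> - f ?x 0 = \<theta> * d_theta f ?x \<xi>" by auto
  then have "\<bar>quot \<theta> ?x\<bar> = \<bar>d_theta f ?x \<xi>\<bar> / f ?x 0"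
    using \<theta> f_pos[of 0 ?x] by (simp add: quot_def abs_mult abs_divide)
  moreover have "ennreal (\<bar>d_theta f ?x \<xi>\<bar> / f ?x 0) \<le> g_sup TYPE('n) f a B \<epsilon>"
    unfolding g_sup_def using \<xi>(1) \<theta> z
    by (intro SUP_upper2[of "(z, \<xi>)"]) auto
  ultimately show ?thesis by simp
qed

definition null_const :: real where
  "null_const = ((2 * pi) powr (- real CARD('p) / 2)) ^ CARD('n)"

lemma null_const_pos: "0 < null_const"
  by (simp add: null_const_def)

lemma prod_null: "(\<Prod>i\<in>UNIV. f (x i) 0) = null_const * gauss (x :: 'n \<Rightarrow> (real, 'p) vec)"
  by (simp add: null null_const_def gauss_def prod.distrib exp_sum[symmetric] sum_negf sum_divide_distrib)

lemma prod_integrable: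
  assumes "0 \<le> \<theta>"
  shows "integrable samples (\<lambda>x :: 'n \<Rightarrow> (real, 'p) vec. \<Prod>i\<in>UNIV. f (x i) \<theta>)"
proof (rule integrableI_nonneg)
  have [measurable]: "(\<lambda>x. f x \<theta>) \<in> borel_measurable borel" by (rule f_measurable[OF assms])
  show "(\<lambda>x :: 'n \<Rightarrow> (real, 'p) vec. \<Prod>i\<in>UNIV. f (x i) \<theta>) \<in> borel_measurable samples" by measurable
  show "AE x :: 'n \<Rightarrow> (real, 'p) vec in samples. 0 \<le> (\<Prod>i\<in>UNIV. f (x i) \<theta>)"
    using f_pos[OF assms] by (intro AE_I2 prod_nonneg) (simp add: less_imp_le)
  show "(\<integral>\<^sup>+x. ennreal (\<Prod>i\<in>UNIV. f (x i) \<theta>) \<partial>(samples :: ('n \<Rightarrow> (real, 'p) vec) measure)) < \<infinity>"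
    by (subst nn_integral_density_prod[OF dens[OF assms]]) simp
qed

text \<open>
  The derivative of the likelihood at \<open>\<theta> = 0\<close>; see \<open>likelihood_quotient_tendsto\<close>.
\<close>

definition slope_density :: "('n \<Rightarrow> (real, 'p) vec) \<Rightarrow> real" where
  "slope_density x = null_const * gauss x * (p\<^sub>0 * sum_norm4 x + p\<^sub>1 * sum_norm2 x + CARD('n) * p\<^sub>2)"

text \<open>
  The derivative of the power function at \<open>\<theta> = 0\<close>; see \<open>power_fun_derivative\<close>.
\<close>

definition slope :: "('n \<Rightarrow> (real, 'p) vec) set \<Rightarrow> real" where
  "slope E = (\<integral>x. indicator E x * slope_density x \<partial>samples)"

lemma likelihood_quotient_tendsto:
  fixes x :: "'n \<Rightarrow> (real, 'p) vec"
  shows "((\<lambda>\<theta>. ((\<Prod>i\<in>UNIV. f (x i) \<theta>) - (\<Prod>i\<in>UNIV. f (x i) 0)) / \<theta>) \<longlongrightarrow> slope_density x) (at_right 0)"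
proof -
  have "((\<lambda>\<theta>. \<Sum>i\<in>UNIV. ln (f (x i) \<theta>)) has_field_derivative (\<Sum>i\<in>UNIV. d_theta f (x i) 0 / f (x i) 0)) (at 0 within {0..})"
    using f_derivative[of 0] f_pos[of 0] by (intro DERIV_sum) (auto intro!: derivative_eq_intros)
  then have d: "((\<lambda>\<theta>. exp (\<Sum>i\<in>UNIV. ln (f (x i) \<theta>))) has_field_derivative
      exp (\<Sum>i\<in>UNIV. ln (f (x i) 0)) * (\<Sum>i\<in>UNIV. d_theta f (x i) 0 / f (x i) 0)) (at 0 within {0..})"
    by (rule DERIV_chain2[OF DERIV_exp])
  have e: "exp (\<Sum>i\<in>UNIV. ln (f (x i) \<theta>)) = (\<Prod>i\<in>UNIV. f (x i) \<theta>)" if "0 \<le> \<theta>" for \<theta>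
    using f_pos[OF that] by (simp add: exp_sum)
  have "((\<lambda>\<theta>. \<Prod>i\<in>UNIV. f (x i) \<theta>) has_field_derivative
      (\<Prod>i\<in>UNIV. f (x i) 0) * (\<Sum>i\<in>UNIV. d_theta f (x i) 0 / f (x i) 0)) (at 0 within {0..})"
    by (rule has_field_derivative_transform_within[OF d[unfolded e[OF order_refl]] zero_less_one]) (simp_all add: e)
  moreover have "(\<Prod>i\<in>UNIV. f (x i) 0) * (\<Sum>i\<in>UNIV. d_theta f (x i) 0 / f (x i) 0) = slope_density x"
    by (simp add: score prod_null slope_density_def sum_norm4_def sum_norm2_def sum.distrib sum_distrib_left)
  ultimately show ?thesis
    by (simp add: has_field_derivative_iff at_within_Ici_at_right)
qed

text \<open>
  The hypothesis of domination, transported from the group to the sample space: only standardized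
  samples, whose observations have norm at most \<open>sqrt n\<close>, are needed as base points of orbits.
\<close>

lemma dominating_integrable:
  fixes D :: "('n \<Rightarrow> (real, 'p) vec) \<Rightarrow> ennreal"
  assumes [measurable]: "D \<in> borel_measurable samples"
    and D: "\<And>a B (z :: 'n \<Rightarrow> (real, 'p) vec). (\<And>i. norm (z i) \<le> sqrt CARD('n)) \<Longrightarrow> D (\<lambda>i. a + B *v z i) \<le> g_sup TYPE('n) f a B \<epsilon>"
  shows "(\<integral>\<^sup>+x. D x ^ CARD('n) * ennreal (gauss x) \<partial>samples) < \<infinity>"
proof (rule GL.nn_integral_finite_of_orbits[OF n _ dominated])
  let ?n = "CARD('n)"
  fix z :: "'n \<Rightarrow> (real, 'p) vec" assume z: "std_sample z"
  let ?\<Phi> = "\<lambda>a B. D (\<lambda>i. a + B *v z i) ^ ?n"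
  let ?F = "\<lambda>B. GL.weight ?n B * (\<integral>\<^sup>+a. ?\<Phi> a B * ennreal (GL.null_weight ?n a B) \<partial>lborel)"
  have "GL.orbit_integral (\<lambda>x. D x ^ ?n * ennreal (gauss x)) z = GL.group_mean ?n ?\<Phi>"
    by (rule GL.orbit_integral_gauss[OF z])
  also have "\<dots> = (\<integral>\<^sup>+B. ?F B \<partial>lborel)"
    unfolding GL.group_mean_def by (subst lborel_eq_distr_matrix) (simp add: nn_integral_distr mat_of_def)
  also have "\<dots> \<le> (\<integral>\<^sup>+B\<in>GLp. (\<integral>\<^sup>+a. g_sup TYPE('n) f a B \<epsilon> ^ CARD('n) *
            ennreal (exp (- real CARD('n) / 2 * (norm a)\<^sup>2
                          - real CARD('n) / 2 * trace (transpose B ** B)) *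
                     \<bar>det B\<bar> ^ (CARD('n) - CARD('p) - 1)) \<partial>lborel) \<partial>lborel)"
  proof (rule nn_integral_mono)
    fix B :: "'p sqmat"
    show "?F B \<le> (\<integral>\<^sup>+a. g_sup TYPE('n) f a B \<epsilon> ^ CARD('n) *
            ennreal (exp (- real CARD('n) / 2 * (norm a)\<^sup>2
                          - real CARD('n) / 2 * trace (transpose B ** B)) *
                     \<bar>det B\<bar> ^ (CARD('n) - CARD('p) - 1)) \<partial>lborel) * indicator GLp B"
    proof (cases "B \<in> GLp")
      case True
      have det: "det B \<noteq> 0" using True by (simp add: GLp_def invertible_det_nz)
      have "?n - 1 = (?n - CARD('p) - 1) + CARD('p)" using n by simp
      then have "\<bar>det B\<bar> ^ (?n - 1) = \<bar>det B\<bar> ^ (?n - CARD('p) - 1) * \<bar>det B\<bar> ^ CARD('p)"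
        by (simp only: power_add)
      then have w: "GL.weight ?n B = ennreal (\<bar>det B\<bar> ^ (?n - CARD('p) - 1))"
        using True det by (simp add: GL.weight_def GL_density_def)
      have "?F B = (\<integral>\<^sup>+a. ?\<Phi> a B * ennreal (GL.null_weight ?n a B * \<bar>det B\<bar> ^ (?n - CARD('p) - 1)) \<partial>lborel)"
      proof -
        have "?F B = (\<integral>\<^sup>+a. GL.weight ?n B * (?\<Phi> a B * ennreal (GL.null_weight ?n a B)) \<partial>lborel)"
          by (rule nn_integral_cmult[symmetric]) measurable
        then show ?thesis
          by (simp add: w GL.null_weight_def ennreal_mult' mult_ac)
      qed
      also have "\<dots> \<le> (\<integral>\<^sup>+a. g_sup TYPE('n) f a B \<epsilon> ^ CARD('n) *
            ennreal (exp (- real CARD('n) / 2 * (norm a)\<^sup>2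
                          - real CARD('n) / 2 * trace (transpose B ** B)) *
                     \<bar>det B\<bar> ^ (CARD('n) - CARD('p) - 1)) \<partial>lborel)"
      proof (rule nn_integral_mono)
        fix a :: "(real, 'p) vec"
        have "GL.null_weight ?n a B = exp (- real CARD('n) / 2 * (norm a)\<^sup>2 - real CARD('n) / 2 * trace (transpose B ** B))"
          unfolding GL.null_weight_def exp_add[symmetric] by (rule arg_cong[where f=exp]) simp
        moreover have "?\<Phi> a B \<le> g_sup TYPE('n) f a B \<epsilon> ^ CARD('n)"
          using D[OF std_sample_norm_le[OF z]] by (rule power_mono) simp
        ultimately show "?\<Phi> a B * ennreal (GL.null_weight ?n a B * \<bar>det B\<bar> ^ (?n - CARD('p) - 1)) \<le>
            g_sup TYPE('n) f a B \<epsilon> ^ CARD('n) *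
            ennreal (exp (- real CARD('n) / 2 * (norm a)\<^sup>2
                          - real CARD('n) / 2 * trace (transpose B ** B)) *
                     \<bar>det B\<bar> ^ (CARD('n) - CARD('p) - 1))"
          by (simp only: mult_right_mono zero_le)
      qed
      finally show ?thesis using True by simp
    qed (simp add: GL.weight_def)
  qed
  finally show "GL.orbit_integral (\<lambda>x. D x ^ ?n * ennreal (gauss x)) z \<le> (\<integral>\<^sup>+B\<in>GLp. (\<integral>\<^sup>+a. g_sup TYPE('n) f a B \<epsilon> ^ CARD('n) *
            ennreal (exp (- real CARD('n) / 2 * (norm a)\<^sup>2
                          - real CARD('n) / 2 * trace (transpose B ** B)) *
                     \<bar>det B\<bar> ^ (CARD('n) - CARD('p) - 1)) \<partial>lborel) \<partial>lborel)" .
qed measurable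

text \<open>
  Along a sequence the supremum \<open>D\<close> of the difference quotients is a countable one, hence measurable, and
  dominated convergence applies.
\<close>

lemma power_fun_derivative_seq:
  fixes E :: "('n \<Rightarrow> (real, 'p) vec) set" and t :: "nat \<Rightarrow> real"
  assumes E [measurable]: "E \<in> sets samples" and t: "\<And>m. 0 < t m" "\<And>m. t m \<le> 1" "\<And>m. t m \<le> \<epsilon>" "t \<longlonglongrightarrow> 0"
  shows "(\<lambda>m. (power_fun f E (t m) - power_fun f E 0) / t m) \<longlonglongrightarrow> slope E"
proof -
  let ?S = "samples :: ('n \<Rightarrow> (real, 'p) vec) measure"
  let ?n = "CARD('n)"
  let ?l = "\<lambda>x \<theta>. \<Prod>i\<in>UNIV. f (x i) \<theta>"
  have [measurable]: "quot (t m) \<in> borel_measurable borel" for m by (rule quot_measurable) (simp add: t(1) less_imp_le)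
  have [measurable]: "(\<lambda>x. f x (t m)) \<in> borel_measurable borel" for m by (rule f_measurable) (simp add: t(1) less_imp_le)
  have [measurable]: "(\<lambda>x. f x 0) \<in> borel_measurable borel" by (rule f_measurable) simp
  define D :: "('n \<Rightarrow> (real, 'p) vec) \<Rightarrow> ennreal" where "D x = (SUP m. SUP i. ennreal \<bar>quot (t m) (x i)\<bar>)" for x
  have D_measurable [measurable]: "D \<in> borel_measurable ?S"
  proof -
    have "(\<lambda>x. SUP i. ennreal \<bar>quot (t m) (x i)\<bar>) \<in> borel_measurable ?S" for m
      by (intro borel_measurable_SUP countable_finite) auto
    then show ?thesis unfolding D_def by (intro borel_measurable_SUP) auto
  qed
  have fin: "(\<integral>\<^sup>+x. D x ^ ?n * ennreal (gauss x) \<partial>?S) < \<infinity>"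
  proof (rule dominating_integrable[OF D_measurable])
    fix a B and z :: "'n \<Rightarrow> (real, 'p) vec" assume "\<And>i. norm (z i) \<le> sqrt CARD('n)"
    then show "D (\<lambda>i. a + B *v z i) \<le> g_sup TYPE('n) f a B \<epsilon>"
      unfolding D_def using t by (intro SUP_least quot_le_g_sup) auto
  qed
  have D_finite: "AE x in ?S. D x < \<infinity>"
  proof -
    have "AE x in ?S. D x ^ ?n * ennreal (gauss x) \<noteq> \<infinity>"
      using fin by (intro nn_integral_noteq_infinite) auto
    then show ?thesis
    proof eventually_elim
      case (elim x)
      have "ennreal (gauss x) \<noteq> 0" using gauss_pos[of x] by (simp add: ennreal_eq_0_iff not_le)
      then show ?case using elim by (auto simp: ennreal_mult_eq_top_iff less_top power_eq_top_ennreal)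
    qed
  qed
  define d where "d x = enn2real (D x)" for x
  have d0: "0 \<le> d x" for x by (simp add: d_def)
  let ?w = "\<lambda>x. null_const * gauss x * (1 + d x) ^ ?n"
  let ?s = "\<lambda>m x. indicator E x * ((?l x (t m) - ?l x 0) / t m)"
  have w_int: "integrable ?S ?w"
  proof (rule integrableI_nonneg)
    show "?w \<in> borel_measurable ?S" unfolding d_def by measurable
    show "AE x in ?S. 0 \<le> ?w x" using d0 null_const_pos by (auto simp: less_imp_le gauss_pos)
    have "(\<integral>\<^sup>+x. ennreal (?w x) \<partial>?S) \<le> (\<integral>\<^sup>+x. ennreal (null_const * 2 ^ ?n) * (ennreal (gauss x) + D x ^ ?n * ennreal (gauss x)) \<partial>?S)"
    proof (rule nn_integral_mono)
      fix x :: "'n \<Rightarrow> (real, 'p) vec"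
      have "?w x \<le> null_const * gauss x * (2 ^ ?n * (1 + d x ^ ?n))"
        using one_plus_power_le[OF d0] null_const_pos gauss_pos[of x] by (intro mult_left_mono) auto
      then have "ennreal (?w x) \<le> ennreal (null_const * 2 ^ ?n * (gauss x + d x ^ ?n * gauss x))"
        by (intro ennreal_leI) (simp add: algebra_simps)
      also have "\<dots> = ennreal (null_const * 2 ^ ?n) * (ennreal (gauss x) + ennreal (d x) ^ ?n * ennreal (gauss x))"
        using null_const_pos gauss_pos[of x] d0[of x]
        by (simp add: ennreal_mult' ennreal_power less_imp_le)
      also have "\<dots> \<le> ennreal (null_const * 2 ^ ?n) * (ennreal (gauss x) + D x ^ ?n * ennreal (gauss x))"
        unfolding d_def by (intro mult_left_mono add_mono mult_right_mono power_mono ennreal_enn2real_if[THEN ord_eq_le_trans]) auto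
      finally show "ennreal (?w x) \<le> ennreal (null_const * 2 ^ ?n) * (ennreal (gauss x) + D x ^ ?n * ennreal (gauss x))" .
    qed
    also have "\<dots> = ennreal (null_const * 2 ^ ?n) * ((\<integral>\<^sup>+x. ennreal (gauss x) \<partial>?S) + (\<integral>\<^sup>+x. D x ^ ?n * ennreal (gauss x) \<partial>?S))"
      by (simp add: nn_integral_cmult nn_integral_add)
    also have "\<dots> < \<infinity>"
      using fin nn_integral_gauss(1)[where 'n='n and 'p='p] by (simp add: ennreal_mult_less_top)
    finally show "(\<integral>\<^sup>+x. ennreal (?w x) \<partial>?S) < \<infinity>" .
  qed
  have lim: "AE x in ?S. (\<lambda>m. ?s m x) \<longlonglongrightarrow> indicator E x * slope_density x"
  proof (rule AE_I2)
    fix x :: "'n \<Rightarrow> (real, 'p) vec"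
    have "filterlim t (at_right 0) sequentially"
      using t(1,4) by (auto simp: filterlim_at intro!: always_eventually dest: less_imp_neq[THEN not_sym])
    then show "(\<lambda>m. ?s m x) \<longlonglongrightarrow> indicator E x * slope_density x"
      by (intro tendsto_mult tendsto_const filterlim_compose[OF likelihood_quotient_tendsto])
  qed
  have bound: "AE x in ?S. norm (?s m x) \<le> ?w x" for m
    using D_finite
  proof eventually_elim
    case (elim x)
    have quot: "\<bar>quot (t m) (x i)\<bar> \<le> d x" for i
    proof -
      have "ennreal \<bar>quot (t m) (x i)\<bar> \<le> D x"
        unfolding D_def by (intro SUP_upper2[of m] SUP_upper2[of i]) auto
      also have "D x = ennreal (d x)" using elim by (simp add: d_def)
      finally show ?thesis using d0 by simp
    qed
    have "?l x (t m) = ?l x 0 * (\<Prod>i\<in>UNIV. 1 + t m * quot (t m) (x i))"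
      using f_eq_quot[OF t(1)] by (simp add: prod.distrib[symmetric])
    then have "?l x (t m) - ?l x 0 = ?l x 0 * ((\<Prod>i\<in>UNIV. 1 + t m * quot (t m) (x i)) - 1)"
      by (simp add: algebra_simps)
    then have "\<bar>(?l x (t m) - ?l x 0) / t m\<bar> = null_const * gauss x * \<bar>(\<Prod>i\<in>UNIV. 1 + t m * quot (t m) (x i)) - 1\<bar> / t m"
      using t(1)[of m] null_const_pos gauss_pos[of x] by (simp add: prod_null abs_mult)
    also have "\<dots> \<le> null_const * gauss x * (t m * ((1 + d x) ^ ?n - 1)) / t m"
      using t(1,2)[of m] d0[of x] null_const_pos gauss_pos[of x] quot
        abs_prod_one_plus_le[of UNIV "t m" "\<lambda>i. quot (t m) (x i)" "d x"]
      by (intro divide_right_mono mult_left_mono) auto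
    also have "\<dots> = null_const * gauss x * ((1 + d x) ^ ?n - 1)" using t(1)[of m] by simp
    also have "\<dots> \<le> ?w x"
      using null_const_pos gauss_pos[of x] by (intro mult_left_mono) auto
    finally have "\<bar>(?l x (t m) - ?l x 0) / t m\<bar> \<le> ?w x" .
    moreover have "0 \<le> ?w x" using null_const_pos gauss_pos[of x] d0[of x] by simp
    ultimately show ?case by (simp add: indicator_def)
  qed
  have sd [measurable]: "slope_density \<in> borel_measurable ?S" unfolding slope_density_def by measurable
  have meas: "(\<lambda>x. indicator E x * slope_density x) \<in> borel_measurable ?S" "\<And>m. ?s m \<in> borel_measurable ?S"
    by measurable
  have "(\<lambda>m. integral\<^sup>L ?S (?s m)) \<longlonglongrightarrow> slope E"
    unfolding slope_def by (rule integral_dominated_convergence[OF meas w_int lim bound])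
  moreover have "integral\<^sup>L ?S (?s m) = (power_fun f E (t m) - power_fun f E 0) / t m" for m
  proof -
    have int: "integrable ?S (\<lambda>x. indicator E x * ?l x \<theta>)" if "0 \<le> \<theta>" for \<theta>
      using integrable_mult_indicator[OF E prod_integrable[OF that]] by simp
    have "?s m = (\<lambda>x. (indicator E x * ?l x (t m) - indicator E x * ?l x 0) / t m)"
      by (auto simp: fun_eq_iff right_diff_distrib)
    then have "integral\<^sup>L ?S (?s m) = (\<integral>x. indicator E x * ?l x (t m) - indicator E x * ?l x 0 \<partial>?S) / t m"
      by simp
    also have "(\<integral>x. indicator E x * ?l x (t m) - indicator E x * ?l x 0 \<partial>?S) = power_fun f E (t m) - power_fun f E 0"
      unfolding power_fun_def using t(1)[of m] by (intro Bochner_Integration.integral_diff int) auto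
    finally show ?thesis .
  qed
  ultimately show "(\<lambda>m. (power_fun f E (t m) - power_fun f E 0) / t m) \<longlonglongrightarrow> slope E" by (simp only:)
qed

lemma power_fun_derivative:
  fixes E :: "('n \<Rightarrow> (real, 'p) vec) set"
  assumes E: "E \<in> sets samples"
  shows "((\<lambda>\<theta>. (power_fun f E \<theta> - power_fun f E 0) / \<theta>) \<longlongrightarrow> slope E) (at_right 0)"
proof (rule tendsto_at_right_sequentially)
  show "0 < min 1 \<epsilon>" using \<epsilon> by simp
  fix t :: "nat \<Rightarrow> real" assume "\<And>m. 0 < t m" "\<And>m. t m < min 1 \<epsilon>" "t \<longlonglongrightarrow> 0"
  then show "(\<lambda>m. (power_fun f E (t m) - power_fun f E 0) / t m) \<longlonglongrightarrow> slope E"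
    by (intro power_fun_derivative_seq[OF E]) (auto simp: less_imp_le)
qed

end

section \<open>Orthogonal transformations of the sample\<close>

lemma measurable_sample_map: "(\<lambda>x i. Q *v x i) \<in> samples \<rightarrow>\<^sub>M (samples :: ('n::finite \<Rightarrow> real^'p) measure)"
  by (rule measurable_samplesI) measurable

text \<open>
  The determinant of an orthogonal matrix has absolute value \<open>1\<close>.
\<close>

lemma distr_samples_orthogonal:
  fixes Q :: "real^'p^'p"
  assumes Q: "transpose Q ** Q = mat 1"
  shows "distr samples samples (\<lambda>x i. Q *v x i) = (samples :: ('n::finite \<Rightarrow> real^'p) measure)"
proof (rule measure_eqI)
  let ?S = "samples :: ('n \<Rightarrow> real^'p) measure"
  fix A assume "A \<in> sets (distr ?S ?S (\<lambda>x i. Q *v x i))"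
  then have A [measurable]: "A \<in> sets ?S" by simp
  have det: "\<bar>det Q\<bar> = 1" by (rule abs_det_orthogonal[OF Q])
  have "emeasure (distr ?S ?S (\<lambda>x i. Q *v x i)) A = (\<integral>\<^sup>+x. indicator A x \<partial>distr ?S ?S (\<lambda>x i. Q *v x i))"
    by simp
  also have "\<dots> = (\<integral>\<^sup>+x. indicator A (\<lambda>i. Q *v x i) \<partial>?S)"
    by (rule nn_integral_distr[OF measurable_sample_map]) simp
  also have "\<dots> = (\<integral>\<^sup>+x. indicator A x \<partial>?S)"
    using nn_integral_samples_affine[of Q "indicator A :: ('n \<Rightarrow> real^'p) \<Rightarrow> ennreal" "\<lambda>_. 0"] det by auto
  also have "\<dots> = emeasure ?S A" by simp
  finally show "emeasure (distr ?S ?S (\<lambda>x i. Q *v x i)) A = emeasure ?S A" .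
qed simp

lemma integral_samples_orthogonal:
  fixes Q :: "real^'p^'p" and h :: "('n::finite \<Rightarrow> real^'p) \<Rightarrow> real"
  assumes Q: "transpose Q ** Q = mat 1" and [measurable]: "h \<in> borel_measurable samples"
  shows "(\<integral>x. h (\<lambda>i. Q *v x i) \<partial>samples) = (\<integral>x. h x \<partial>samples)"
proof -
  let ?S = "samples :: ('n \<Rightarrow> real^'p) measure"
  have "(\<integral>x. h x \<partial>distr ?S ?S (\<lambda>x i. Q *v x i)) = (\<integral>x. h (\<lambda>i. Q *v x i) \<partial>?S)"
    by (rule integral_distr[OF measurable_sample_map assms(2)])
  then show ?thesis by (simp only: distr_samples_orthogonal[OF Q])
qed

text \<open>
  The Cholesky root of \<open>B B'\<close> is the lower triangular factor.
\<close>

lemma LTp_orthogonal_factorization: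
  fixes B :: "real^'p::{finite,linorder}^'p::{finite,linorder}"
  assumes B: "B \<in> GLp"
  obtains T Q where "T \<in> LTp" "transpose Q ** Q = mat 1" "B = T ** Q"
proof
  let ?T = "cholesky (B ** transpose B)"
  let ?Q = "matrix_inv ?T ** B"
  have pd: "positive_definite (B ** transpose B)"
    using B by (simp add: GLp_def positive_definite_mult_transpose)
  show T: "?T \<in> LTp" by (rule cholesky(1)[OF pd])
  have inv: "invertible ?T" by (rule LTp_invertible[OF T])
  show "B = ?T ** ?Q" by (simp add: matrix_mul_assoc matrix_inv_mult[OF inv])
  have "?Q ** transpose ?Q = matrix_inv ?T ** (B ** transpose B) ** transpose (matrix_inv ?T)"
    by (simp add: matrix_transpose_mul matrix_mul_assoc)
  also have "\<dots> = matrix_inv ?T ** (?T ** transpose ?T) ** transpose (matrix_inv ?T)"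
    by (simp only: cholesky(2)[OF pd])
  also have "\<dots> = (matrix_inv ?T ** ?T) ** transpose (matrix_inv ?T ** ?T)"
    by (simp only: matrix_transpose_mul matrix_mul_assoc)
  also have "\<dots> = mat 1" by (simp add: matrix_inv_mult[OF inv] transpose_mat)
  finally show "transpose ?Q ** ?Q = mat 1" using matrix_left_right_inverse by blast
qed

context normal_alternatives
begin

lemma power_fun_null:
  "power_fun f E 0 = null_const * (\<integral>x. indicator E x * gauss x \<partial>(samples :: ('n \<Rightarrow> (real, 'p) vec) measure))"
  by (simp add: power_fun_def prod_null mult.left_commute[of _ null_const])

lemma power_fun_tendsto:
  fixes E :: "('n \<Rightarrow> (real, 'p) vec) set"
  assumes "E \<in> sets samples"
  shows "(power_fun f E \<longlongrightarrow> power_fun f E 0) (at_right 0)"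
proof -
  have "((\<lambda>\<theta>. (power_fun f E \<theta> - power_fun f E 0) / \<theta> * \<theta> + power_fun f E 0) \<longlongrightarrow>
      slope E * 0 + power_fun f E 0) (at_right 0)"
    by (intro tendsto_intros power_fun_derivative[OF assms])
  then have "((\<lambda>\<theta>. (power_fun f E \<theta> - power_fun f E 0) / \<theta> * \<theta> + power_fun f E 0) \<longlongrightarrow> power_fun f E 0) (at_right 0)"
    by (simp only: mult_zero_right add_0)
  then show ?thesis
    by (rule Lim_transform_eventually) (auto simp: eventually_at_filter)
qed

text \<open>
  At \<open>\<theta> = 0\<close> both the likelihood and its derivative are functions of the norms of the observations;
  hence an orthogonal transformation of the sample changes neither.
\<close>

lemma orthogonal_null:
  fixes R :: "('n \<Rightarrow> (real, 'p) vec) set"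
  assumes Q: "transpose Q ** Q = mat 1" and R [measurable]: "R \<in> sets samples"
  shows "slope {x. (\<lambda>i. Q *v x i) \<in> R} = slope R"
    and "power_fun f {x. (\<lambda>i. Q *v x i) \<in> R} 0 = power_fun f R 0"
proof -
  let ?E = "{x. (\<lambda>i. Q *v x i) \<in> R}"
  have ind: "indicator ?E x = (indicator R (\<lambda>i. Q *v x i) :: real)" for x
    by (simp add: indicator_def)
  have norm: "gauss (\<lambda>i. Q *v x i) = gauss x" "sum_norm2 (\<lambda>i. Q *v x i) = sum_norm2 x"
      "sum_norm4 (\<lambda>i. Q *v x i) = sum_norm4 x" for x :: "'n \<Rightarrow> (real, 'p) vec"
    by (simp_all add: gauss_def sum_norm2_def sum_norm4_def norm_orthogonal_matrix[OF Q])
  have "slope ?E = (\<integral>x. indicator R (\<lambda>i. Q *v x i) * slope_density (\<lambda>i. Q *v x i) \<partial>samples)"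
    by (simp add: slope_def slope_density_def ind norm)
  also have "\<dots> = slope R"
    unfolding slope_def slope_density_def by (rule integral_samples_orthogonal[OF Q]) measurable
  finally show "slope ?E = slope R" .
  have "power_fun f ?E 0 = null_const * (\<integral>x. indicator R (\<lambda>i. Q *v x i) * gauss (\<lambda>i. Q *v x i) \<partial>samples)"
    by (simp add: power_fun_null ind norm)
  also have "\<dots> = power_fun f R 0"
    unfolding power_fun_null by (subst integral_samples_orthogonal[OF Q, of "\<lambda>x. indicator R x * gauss x"]) auto
  finally show "power_fun f ?E 0 = power_fun f R 0" .
qed

text \<open>
  Two invariant regions are compared through their null probabilities, then through their slopes;
  a tie in both must be resolved by equality almost everywhere.  The lower triangular factor of \<open>B\<close> is
  absorbed by invariance, and the orthogonal factor does not affect the comparison.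
\<close>

lemma power_dominates:
  fixes R R' :: "('n \<Rightarrow> (real, 'p) vec) set"
  assumes R: "invariant_set LTp R" and R': "invariant_set LTp R'" and B: "B \<in> GLp"
    and cases: "power_fun f R' 0 < power_fun f R 0 \<or>
      power_fun f R' 0 = power_fun f R 0 \<and> (slope R' < slope R \<or> (AE x in samples. x \<in> R' \<longleftrightarrow> x \<in> R))"
  shows "\<exists>\<theta>\<^sub>0>0. \<forall>\<theta>. 0 < \<theta> \<and> \<theta> < \<theta>\<^sub>0 \<longrightarrow>
    measure (sample_law f \<theta> a B) R' \<le> measure (sample_law f \<theta> a B) R"
proof -
  let ?S = "samples :: ('n \<Rightarrow> (real, 'p) vec) measure"
  obtain T Q where T: "T \<in> LTp" and Q: "transpose Q ** Q = mat 1" and BTQ: "B = T ** Q"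
    using LTp_orthogonal_factorization[OF B] by blast
  define E where "E A = {x :: 'n \<Rightarrow> (real, 'p) vec. (\<lambda>i. Q *v x i) \<in> A}" for A
  have sets [measurable]: "R \<in> sets ?S" "R' \<in> sets ?S" using R R' by (auto simp: invariant_set_def)
  have E_sets [measurable]: "E A \<in> sets ?S" if [measurable]: "A \<in> sets ?S" for A
  proof -
    have "(\<lambda>x i. Q *v x i) -` A \<inter> space ?S \<in> sets ?S"
      by (rule measurable_sets[OF measurable_sample_map that])
    then show ?thesis by (simp add: E_def space_PiM vimage_def)
  qed
  have law: "measure (sample_law f \<theta> a B) A = power_fun f (E A) \<theta>" if "invariant_set LTp A" "0 < \<theta>" for A \<theta>
  proof -
    have A: "A \<in> sets ?S" "\<And>y. (\<lambda>i. a + T *v y i) \<in> A \<longleftrightarrow> y \<in> A"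
      using that T by (auto simp: invariant_set_def)
    have "{x. (\<lambda>i. a + B *v x i) \<in> A} = E A"
      using A(2)[of "\<lambda>i. Q *v _ i"] by (auto simp: E_def BTQ matrix_vector_mul_assoc[symmetric])
    then show ?thesis
      using measure_sample_law[of f \<theta> B A a] dens[of \<theta>] that(2) B A(1) by simp
  qed
  note null_E = orthogonal_null(2)[OF Q sets(1), folded E_def] orthogonal_null(2)[OF Q sets(2), folded E_def]
  note slope_E = orthogonal_null(1)[OF Q sets(1), folded E_def] orthogonal_null(1)[OF Q sets(2), folded E_def]
  have ev: "\<forall>\<^sub>F \<theta> in at_right 0. power_fun f (E R') \<theta> \<le> power_fun f (E R) \<theta>"
    using cases
  proof (elim disjE conjE)
    assume "power_fun f R' 0 < power_fun f R 0"
    moreover have "((\<lambda>\<theta>. power_fun f (E R) \<theta> - power_fun f (E R') \<theta>) \<longlongrightarrow>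
        power_fun f (E R) 0 - power_fun f (E R') 0) (at_right 0)"
      by (intro tendsto_diff power_fun_tendsto E_sets sets)
    ultimately have "\<forall>\<^sub>F \<theta> in at_right 0. 0 < power_fun f (E R) \<theta> - power_fun f (E R') \<theta>"
      by (intro order_tendstoD(1)) (auto simp: null_E)
    then show ?thesis by eventually_elim simp
  next
    assume null: "power_fun f R' 0 = power_fun f R 0" and "slope R' < slope R"
    moreover have "((\<lambda>\<theta>. (power_fun f (E R) \<theta> - power_fun f (E R) 0) / \<theta> - (power_fun f (E R') \<theta> - power_fun f (E R') 0) / \<theta>)
        \<longlongrightarrow> slope (E R) - slope (E R')) (at_right 0)"
      by (intro tendsto_diff power_fun_derivative E_sets sets)
    ultimately have "\<forall>\<^sub>F \<theta> in at_right 0.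
        0 < (power_fun f (E R) \<theta> - power_fun f (E R) 0) / \<theta> - (power_fun f (E R') \<theta> - power_fun f (E R') 0) / \<theta>"
      by (intro order_tendstoD(1)) (auto simp: slope_E)
    moreover have "\<forall>\<^sub>F \<theta> in at_right (0::real). 0 < \<theta>" by (simp add: eventually_at_filter)
    ultimately show ?thesis
    proof eventually_elim
      case (elim \<theta>)
      then have "0 < (power_fun f (E R) \<theta> - power_fun f (E R') \<theta>) / \<theta>"
        by (simp add: null_E null diff_divide_distrib)
      then show ?case using elim(2) by (simp add: zero_less_divide_iff)
    qed
  next
    assume "AE x in ?S. x \<in> R' \<longleftrightarrow> x \<in> R"
    then have "AE x in distr ?S ?S (\<lambda>x i. Q *v x i). x \<in> R' \<longleftrightarrow> x \<in> R"
      by (simp only: distr_samples_orthogonal[OF Q])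
    then have AE: "AE x in ?S. (\<lambda>i. Q *v x i) \<in> R' \<longleftrightarrow> (\<lambda>i. Q *v x i) \<in> R"
      by (rule AE_distrD[OF measurable_sample_map])
    have "power_fun f (E R') \<theta> = power_fun f (E R) \<theta>" if "0 < \<theta>" for \<theta>
    proof -
      have [measurable]: "(\<lambda>x. f x \<theta>) \<in> borel_measurable borel" using f_measurable that by simp
      show ?thesis
        unfolding power_fun_def
      proof (rule integral_cong_AE)
        show "AE x in ?S. indicator (E R') x * (\<Prod>i\<in>UNIV. f (x i) \<theta>) = indicator (E R) x * (\<Prod>i\<in>UNIV. f (x i) \<theta>)"
          using AE by eventually_elim (simp add: E_def indicator_def)
      qed measurable
    qed
    then show ?thesis by (simp add: eventually_at_filter)
  qed
  then obtain \<theta>\<^sub>0 where "0 < \<theta>\<^sub>0" "\<And>\<theta>. 0 < \<theta> \<Longrightarrow> \<theta> < \<theta>\<^sub>0 \<Longrightarrow> power_fun f (E R') \<theta> \<le> power_fun f (E R) \<theta>"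
    unfolding eventually_at_right_field by auto
  then show ?thesis using law[OF R] law[OF R'] by (intro exI[of _ \<theta>\<^sub>0]) auto
qed

end

section \<open>The Neyman--Pearson argument\<close>

text \<open>
  A statistic of the standardized sample which is invariant under \<open>G\<close> and, up to an increasing affine
  transformation, the conditional mean of \<open>sum_norm4\<close>.
\<close>

locale invariant_statistic = normal_alternatives f p\<^sub>0 p\<^sub>1 p\<^sub>2 \<epsilon> N
  for f :: "(real, 'p::{finite,linorder}) vec \<Rightarrow> real \<Rightarrow> real" and p\<^sub>0 p\<^sub>1 p\<^sub>2 \<epsilon> :: real
    and N :: "'n::finite itself" +
  fixes G :: "'p::{finite,linorder} sqmat set" and T :: "('n \<Rightarrow> (real, 'p) vec) \<Rightarrow> real" and \<alpha> \<beta> \<gamma> :: real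
  assumes LTp_G: "LTp \<subseteq> G" and G_GLp: "G \<subseteq> GLp"
    and T_measurable: "(\<lambda>x. T (standardized x)) \<in> borel_measurable samples"
    and T_nonneg: "\<And>z. 0 \<le> T z"
    and T_invariant: "\<And>a B x. B \<in> G \<Longrightarrow> positive_definite (sample_cov x) \<Longrightarrow>
      T (standardized (\<lambda>i. a + B *v x i)) = T (standardized x)"
    and \<alpha>: "0 \<le> \<alpha>" and \<beta>: "0 < \<beta>" and \<gamma>: "0 \<le> \<gamma>"
    and mean4: "\<And>R :: ('n \<Rightarrow> (real, 'p) vec) set. invariant_set G R \<Longrightarrow>
      (\<integral>\<^sup>+x. indicator R x * (ennreal (sum_norm4 x) * ennreal (gauss x)) \<partial>samples) =
      (\<integral>\<^sup>+x. indicator R x * (ennreal (\<alpha> + \<beta> * T (standardized x)) * ennreal (gauss x)) \<partial>samples)"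
    and mean2: "\<And>R :: ('n \<Rightarrow> (real, 'p) vec) set. invariant_set G R \<Longrightarrow>
      (\<integral>\<^sup>+x. indicator R x * (ennreal (sum_norm2 x) * ennreal (gauss x)) \<partial>samples) =
      (\<integral>\<^sup>+x. indicator R x * (ennreal \<gamma> * ennreal (gauss x)) \<partial>samples)"
begin

abbreviation S :: "('n \<Rightarrow> (real, 'p) vec) measure" where
  "S \<equiv> samples"

abbreviation t :: "('n \<Rightarrow> (real, 'p) vec) \<Rightarrow> real" where
  "t x \<equiv> T (standardized x)"

lemma t_measurable [measurable]: "t \<in> borel_measurable S"
  by (rule T_measurable)

lemma gauss_nonneg [simp]: "0 \<le> gauss x"
  by (rule less_imp_le[OF gauss_pos])

lemma integrable_gauss: "integrable S gauss"
  using nn_integral_gauss(1)[where 'n='n and 'p='p] by (intro integrableI_nonneg) auto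

lemma integrable_sum_norm4: "integrable S (\<lambda>x. sum_norm4 x * gauss x)"
  using sum_norm4_gauss_finite[where 'n='n and 'p='p]
  by (intro integrableI_nonneg) (auto simp: sum_norm_nonneg)

lemma integrable_sum_norm2: "integrable S (\<lambda>x. sum_norm2 x * gauss x)"
proof (rule Bochner_Integration.integrable_bound)
  show "integrable S (\<lambda>x. CARD('n) * gauss x + sum_norm4 x * gauss x)"
    by (intro Bochner_Integration.integrable_add integrable_mult_right integrable_gauss integrable_sum_norm4)
  have "sum_norm2 x \<le> CARD('n) + sum_norm4 x" for x :: "'n \<Rightarrow> (real, 'p) vec"
  proof -
    have "(norm (x i))\<^sup>2 \<le> 1 + norm (x i) ^ 4" for i
      using sum_power2_ge_zero[of "(norm (x i))\<^sup>2 - 1" "norm (x i)"]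
      by (simp add: power2_diff power_mult[symmetric] power4_eq_xxxx power2_eq_square algebra_simps)
    then have "sum_norm2 x \<le> (\<Sum>i\<in>(UNIV :: 'n set). 1 + norm (x i) ^ 4)"
      unfolding sum_norm2_def by (rule sum_mono)
    then show ?thesis by (simp add: sum.distrib sum_norm4_def)
  qed
  then have "sum_norm2 x * gauss x \<le> (CARD('n) + sum_norm4 x) * gauss x" for x :: "'n \<Rightarrow> (real, 'p) vec"
    using gauss_pos[of x] by (intro mult_right_mono) auto
  moreover have "0 \<le> sum_norm2 x * gauss x" for x :: "'n \<Rightarrow> (real, 'p) vec"
    by (simp add: sum_norm_nonneg)
  ultimately show "AE x in S. norm (sum_norm2 x * gauss x) \<le> norm (CARD('n) * gauss x + sum_norm4 x * gauss x)"
    by (intro AE_I2) (simp add: distrib_right order_trans[OF _ abs_ge_self])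
qed measurable

lemma integrable_indicator:
  assumes "R \<in> sets S" "integrable S h"
  shows "integrable S (\<lambda>x. indicator R x * (h x :: real))"
  using integrable_mult_indicator[OF assms] by simp

lemma integral_invariant_eq:
  assumes h: "h \<in> borel_measurable S" "\<And>x. 0 \<le> h x" and h': "h' \<in> borel_measurable S" "\<And>x. 0 \<le> h' x"
    and R [measurable]: "R \<in> sets S"
    and eq: "(\<integral>\<^sup>+x. indicator R x * (ennreal (h x) * ennreal (gauss x)) \<partial>S) =
      (\<integral>\<^sup>+x. indicator R x * (ennreal (h' x) * ennreal (gauss x)) \<partial>S)"
  shows "(\<integral>x. indicator R x * (h x * gauss x) \<partial>S) = (\<integral>x. indicator R x * (h' x * gauss x) \<partial>S)"
proof -
  have "(\<integral>x. indicator R x * (h x * gauss x) \<partial>S) =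
      enn2real (\<integral>\<^sup>+x. indicator R x * (ennreal (h x) * ennreal (gauss x)) \<partial>S)"
    if [measurable]: "h \<in> borel_measurable S" and h0: "\<And>x. 0 \<le> h x" for h
  proof -
    have "(\<integral>x. indicator R x * (h x * gauss x) \<partial>S) = enn2real (\<integral>\<^sup>+x. ennreal (indicator R x * (h x * gauss x)) \<partial>S)"
      using h0 by (intro integral_eq_nn_integral) auto
    also have "(\<integral>\<^sup>+x. ennreal (indicator R x * (h x * gauss x)) \<partial>S) =
        (\<integral>\<^sup>+x. indicator R x * (ennreal (h x) * ennreal (gauss x)) \<partial>S)"
      using h0 by (intro nn_integral_cong) (simp add: indicator_def ennreal_mult)
    finally show ?thesis .
  qed
  from this[OF h] this[OF h'] eq show ?thesis by simp
qed

lemma integrable_t: "integrable S (\<lambda>x. t x * gauss x)"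
proof -
  have "invariant_set G (UNIV :: ('n \<Rightarrow> (real, 'p) vec) set)"
    using sets.top[of S] by (simp add: invariant_set_def space_PiM)
  from mean4[OF this] have "(\<integral>\<^sup>+x. ennreal (\<alpha> + \<beta> * t x) * ennreal (gauss x) \<partial>S) =
      (\<integral>\<^sup>+x. ennreal (sum_norm4 x * gauss x) \<partial>S)"
    by (simp add: ennreal_mult sum_norm_nonneg)
  then have fin: "(\<integral>\<^sup>+x. ennreal ((\<alpha> + \<beta> * t x) * gauss x) \<partial>S) < \<infinity>"
    using sum_norm4_gauss_finite[where 'n='n and 'p='p] by (simp add: ennreal_mult'')
  have "integrable S (\<lambda>x. (\<alpha> + \<beta> * t x) * gauss x)"
    using fin \<alpha> \<beta> T_nonneg by (intro integrableI_nonneg) auto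
  then have "integrable S (\<lambda>x. ((\<alpha> + \<beta> * t x) * gauss x - \<alpha> * gauss x) / \<beta>)"
    by (intro integrable_divide_zero Bochner_Integration.integrable_diff integrable_mult_right integrable_gauss)
  then show ?thesis using \<beta> by (simp add: algebra_simps)
qed

definition mass :: "('n \<Rightarrow> (real, 'p) vec) set \<Rightarrow> real" where
  "mass R = (\<integral>x. indicator R x * gauss x \<partial>S)"

text \<open>
  By the conditional means, the slope of an invariant region is that of a score which is affine and
  increasing in the statistic.
\<close>

lemma slope_invariant:
  assumes R: "invariant_set G R"
  shows "slope R = null_const * (p\<^sub>0 * \<alpha> + p\<^sub>1 * \<gamma> + CARD('n) * p\<^sub>2) * mass R +
    null_const * p\<^sub>0 * \<beta> * (\<integral>x. indicator R x * (t x * gauss x) \<partial>S)"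
proof -
  have sets [measurable]: "R \<in> sets S" using R by (simp add: invariant_set_def)
  note int = integrable_indicator[OF sets]
  have m4: "(\<integral>x. indicator R x * (sum_norm4 x * gauss x) \<partial>S) =
      \<alpha> * mass R + \<beta> * (\<integral>x. indicator R x * (t x * gauss x) \<partial>S)"
  proof -
    have "(\<integral>x. indicator R x * (sum_norm4 x * gauss x) \<partial>S) = (\<integral>x. indicator R x * ((\<alpha> + \<beta> * t x) * gauss x) \<partial>S)"
      by (rule integral_invariant_eq[OF _ _ _ _ sets mean4[OF R]]) (use \<alpha> \<beta> T_nonneg in \<open>auto simp: sum_norm_nonneg\<close>)
    also have "\<dots> = (\<integral>x. \<alpha> * (indicator R x * gauss x) + \<beta> * (indicator R x * (t x * gauss x)) \<partial>S)"
      by (simp add: algebra_simps)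
    also have "\<dots> = \<alpha> * mass R + \<beta> * (\<integral>x. indicator R x * (t x * gauss x) \<partial>S)"
      unfolding mass_def
      by (subst Bochner_Integration.integral_add) (intro integrable_mult_right int integrable_gauss integrable_t | simp)+
    finally show ?thesis .
  qed
  have m2: "(\<integral>x. indicator R x * (sum_norm2 x * gauss x) \<partial>S) = \<gamma> * mass R"
  proof -
    have "(\<integral>x. indicator R x * (sum_norm2 x * gauss x) \<partial>S) = (\<integral>x. indicator R x * (\<gamma> * gauss x) \<partial>S)"
      by (rule integral_invariant_eq[OF _ _ _ _ sets mean2[OF R]]) (use \<gamma> in \<open>auto simp: sum_norm_nonneg\<close>)
    also have "\<dots> = \<gamma> * mass R"
      unfolding mass_def by (simp only: mult.left_commute[of _ \<gamma>] integral_mult_right_zero)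
    finally show ?thesis .
  qed
  have "slope R = (\<integral>x. null_const * p\<^sub>0 * (indicator R x * (sum_norm4 x * gauss x)) +
      (null_const * p\<^sub>1 * (indicator R x * (sum_norm2 x * gauss x)) + null_const * (CARD('n) * p\<^sub>2) * (indicator R x * gauss x)) \<partial>S)"
    unfolding slope_def slope_density_def by (intro Bochner_Integration.integral_cong refl) (simp add: algebra_simps)
  also have "\<dots> = null_const * p\<^sub>0 * (\<integral>x. indicator R x * (sum_norm4 x * gauss x) \<partial>S) +
      (null_const * p\<^sub>1 * (\<integral>x. indicator R x * (sum_norm2 x * gauss x) \<partial>S) + null_const * (CARD('n) * p\<^sub>2) * mass R)"
  proof -
    have i: "integrable S (\<lambda>x. c * (indicator R x * (sum_norm4 x * gauss x)))"
      "integrable S (\<lambda>x. c * (indicator R x * (sum_norm2 x * gauss x)))"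
      "integrable S (\<lambda>x. c * (indicator R x * gauss x))" for c
      by (intro integrable_mult_right int integrable_sum_norm4 integrable_sum_norm2 integrable_gauss)+
    show ?thesis
      unfolding mass_def
      by (simp only: Bochner_Integration.integral_add[OF i(1) Bochner_Integration.integrable_add[OF i(2,3)]]
          Bochner_Integration.integral_add[OF i(2,3)] integral_mult_right_zero)
  qed
  finally show ?thesis unfolding m4 m2 by (simp add: algebra_simps)
qed

lemma invariant_region_rejection_region: "invariant_region G (rejection_region T k)"
  unfolding invariant_region_def
proof (intro conjI allI ballI)
  have "{x \<in> space S. det (sample_cov x) \<noteq> 0 \<and> k < t x} \<in> sets S" by measurable
  then show "rejection_region T k \<in> sets (\<Pi>\<^sub>M i\<in>UNIV. borel)"
    by (simp add: rejection_region_def positive_definite_sample_cov_iff sets_samples space_PiM)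
next
  fix a and B :: "'p sqmat" assume B: "B \<in> G"
  then have inv: "invertible B" using G_GLp by (auto simp: GLp_def)
  have iff: "(\<lambda>i. a + B *v x i) \<in> rejection_region T k \<longleftrightarrow> x \<in> rejection_region T k" for x
    using positive_definite_sample_cov_affine[OF inv, of a x] T_invariant[OF B, of x a]
    by (auto simp: rejection_region_def)
  show "(\<lambda>x i. a + B *v x i) ` rejection_region T k = rejection_region T k"
  proof (intro equalityI subsetI)
    fix y assume y: "y \<in> rejection_region T k"
    let ?x = "\<lambda>i. matrix_inv B *v (y i - a)"
    have x: "y = (\<lambda>i. a + B *v ?x i)"
      by (simp add: matrix_vector_mul_assoc matrix_inv_mult[OF inv])
    then have "?x \<in> rejection_region T k" using iff[of ?x] y by simp
    then show "y \<in> (\<lambda>x i. a + B *v x i) ` rejection_region T k" by (rule image_eqI[where f="\<lambda>x i. a + B *v x i", OF x])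
  qed (use iff in auto)
qed

text \<open>
  The Neyman--Pearson inequality: the difference of the slopes is, up to a positive factor, the null integral of
  \<open>(1\<^sub>R - 1\<^sub>R\<^sub>') (T - k)\<close>, whose integrand is nonnegative.  If it vanishes, then \<open>R\<close> is contained in \<open>R'\<close> up to a null set,
  and as both have the same mass they agree almost everywhere.
\<close>

lemma slope_rejection_region:
  assumes R': "invariant_set G R'" and eq: "mass R' = mass (rejection_region T k)"
  shows "slope R' < slope (rejection_region T k) \<or> (AE x in S. x \<in> R' \<longleftrightarrow> x \<in> rejection_region T k)"
proof -
  let ?R = "rejection_region T k"
  have R: "invariant_set G ?R"
    by (rule invariant_set_invariant_region[OF G_GLp invariant_region_rejection_region])
  have sets [measurable]: "?R \<in> sets S" "R' \<in> sets S" using R R' by (auto simp: invariant_set_def)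
  let ?i = "\<lambda>x. indicator ?R x - indicator R' x :: real"
  let ?h = "\<lambda>x. ?i x * ((t x - k) * gauss x)"
  note int_g = integrable_indicator[OF _ integrable_gauss] and int_t = integrable_indicator[OF _ integrable_t]
  have h_eq: "?h = (\<lambda>x. indicator ?R x * (t x * gauss x) - indicator R' x * (t x * gauss x) -
      k * (indicator ?R x * gauss x - indicator R' x * gauss x))"
    by (simp add: fun_eq_iff algebra_simps)
  have int_h: "integrable S ?h"
    unfolding h_eq by (intro Bochner_Integration.integrable_diff integrable_mult_right int_g int_t sets)
  have "integral\<^sup>L S ?h = (\<integral>x. indicator ?R x * (t x * gauss x) \<partial>S) - (\<integral>x. indicator R' x * (t x * gauss x) \<partial>S) -
      k * (mass ?R - mass R')"
    unfolding h_eq mass_def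
    by (simp only: Bochner_Integration.integral_diff Bochner_Integration.integrable_diff integrable_mult_right
        int_g int_t sets integral_mult_right_zero)
  then have slope: "slope ?R - slope R' = null_const * p\<^sub>0 * \<beta> * integral\<^sup>L S ?h"
    by (simp add: slope_invariant[OF R] slope_invariant[OF R'] eq right_diff_distrib)
  have pd: "AE x in S. positive_definite (sample_cov x)" by (rule AE_samples_positive_definite[OF n])
  have h0: "AE x in S. 0 \<le> ?h x"
    using pd
  proof eventually_elim
    case (elim x)
    have "0 \<le> ?i x * (t x - k)" using elim by (auto simp: rejection_region_def indicator_def)
    then have "0 \<le> ?i x * (t x - k) * gauss x" by (rule mult_nonneg_nonneg) simp
    then show ?case by (simp only: mult.assoc)
  qed
  show ?thesis
  proof (cases "integral\<^sup>L S ?h = 0")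
    case False
    then have "0 < integral\<^sup>L S ?h" using integral_nonneg_AE[OF h0] by linarith
    then have "0 < slope ?R - slope R'" using slope null_const_pos p\<^sub>0 \<beta> by simp
    then show ?thesis by simp
  next
    case True
    then have "AE x in S. ?h x = 0" using integral_nonneg_eq_0_iff_AE[OF int_h h0] by simp
    with pd have sub: "AE x in S. x \<in> ?R \<longrightarrow> x \<in> R'"
    proof eventually_elim
      case (elim x)
      then show ?case using gauss_pos[of x] by (auto simp: rejection_region_def indicator_def split: if_splits)
    qed
    let ?d = "\<lambda>x. indicator R' x * gauss x - indicator ?R x * gauss x"
    have d0: "AE x in S. 0 \<le> ?d x"
      using sub
    proof eventually_elim
      case (elim x)
      then show ?case using gauss_pos[of x] by (auto simp: indicator_def)
    qed
    have int_d: "integrable S ?d" by (intro Bochner_Integration.integrable_diff int_g sets)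
    have "integral\<^sup>L S ?d = mass R' - mass ?R"
      unfolding mass_def by (intro Bochner_Integration.integral_diff int_g sets)
    then have "AE x in S. ?d x = 0" using integral_nonneg_eq_0_iff_AE[OF int_d d0] eq by simp
    then have "AE x in S. x \<in> R' \<longleftrightarrow> x \<in> ?R"
    proof eventually_elim
      case (elim x)
      then show ?case using gauss_pos[of x] by (auto simp: indicator_def split: if_splits)
    qed
    then show ?thesis by simp
  qed
qed

lemma LBI_rejection_region: "LBI_region f G (rejection_region T k)"
  unfolding LBI_region_def
proof (intro conjI allI impI ballI)
  show "invariant_region G (rejection_region T k)" by (rule invariant_region_rejection_region)
  let ?R = "rejection_region T k"
  fix R' :: "('n \<Rightarrow> (real, 'p) vec) set" and a and B :: "'p sqmat"
  assume *: "invariant_region G R' \<and>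
    measure (sample_law f 0 0 (mat 1)) R' \<le> measure (sample_law f 0 0 (mat 1)) ?R" and B: "B \<in> GLp"
  have R: "invariant_set G ?R"
    by (rule invariant_set_invariant_region[OF G_GLp invariant_region_rejection_region])
  have R': "invariant_set G R'" using * by (intro invariant_set_invariant_region[OF G_GLp]) simp
  have size: "measure (sample_law f 0 0 (mat 1)) A = power_fun f A 0" if "invariant_set G A"
    for A :: "('n \<Rightarrow> (real, 'p) vec) set"
  proof -
    have "A \<in> sets S" using that by (simp add: invariant_set_def)
    moreover have "(mat 1 :: 'p sqmat) \<in> GLp" using mat_1_LTp LTp_subset_GLp by blast
    ultimately show ?thesis
      using measure_sample_law[of f 0 "mat 1" A 0] dens[of 0] by simp
  qed
  have null_mass: "power_fun f A 0 = null_const * mass A" for A :: "('n \<Rightarrow> (real, 'p) vec) set"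
    by (simp add: power_fun_null mass_def)
  have "power_fun f R' 0 < power_fun f ?R 0 \<or>
      power_fun f R' 0 = power_fun f ?R 0 \<and> (slope R' < slope ?R \<or> (AE x in S. x \<in> R' \<longleftrightarrow> x \<in> ?R))"
  proof (cases "mass R' = mass ?R")
    case True
    then show ?thesis using slope_rejection_region[OF R' True] by (simp add: null_mass)
  next
    case False
    then show ?thesis using * null_const_pos by (simp add: size[OF R] size[OF R'] null_mass)
  qed
  moreover have "invariant_set LTp ?R" "invariant_set LTp R'"
    using R R' LTp_G by (auto simp: invariant_set_def)
  ultimately show "\<exists>\<theta>\<^sub>0>0. \<forall>\<theta>. 0 < \<theta> \<and> \<theta> < \<theta>\<^sub>0 \<longrightarrow>
      measure (sample_law f \<theta> a B) R' \<le> measure (sample_law f \<theta> a B) ?R"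
    using power_dominates[OF _ _ B] by blast
qed

end

section \<open>The two locally best invariant tests\<close>

context normal_alternatives
begin

lemma GL_LBI: "LBI_region f GLp (rejection_region (GL_stat :: ('n \<Rightarrow> (real, 'p) vec) \<Rightarrow> real) k)"
proof (rule GL_conditional_means[OF n])
  fix \<alpha> \<beta> \<gamma> :: real
  assume *: "0 \<le> \<alpha>" "0 < \<beta>" "0 \<le> \<gamma>"
    "\<And>R :: ('n \<Rightarrow> (real, 'p) vec) set. invariant_set GLp R \<Longrightarrow>
      (\<integral>\<^sup>+x. indicator R x * (ennreal (sum_norm4 x) * ennreal (gauss x)) \<partial>samples) =
      (\<integral>\<^sup>+x. indicator R x * (ennreal (\<alpha> + \<beta> * GL_stat (standardized x)) * ennreal (gauss x)) \<partial>samples)"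
    "\<And>R :: ('n \<Rightarrow> (real, 'p) vec) set. invariant_set GLp R \<Longrightarrow>
      (\<integral>\<^sup>+x. indicator R x * (ennreal (sum_norm2 x) * ennreal (gauss x)) \<partial>samples) =
      (\<integral>\<^sup>+x. indicator R x * (ennreal \<gamma> * ennreal (gauss x)) \<partial>samples)"
  interpret invariant_statistic f p\<^sub>0 p\<^sub>1 p\<^sub>2 \<epsilon> N GLp GL_stat \<alpha> \<beta> \<gamma>
  proof
    show "(\<lambda>x :: 'n \<Rightarrow> (real, 'p) vec. GL_stat (standardized x)) \<in> borel_measurable samples"
      unfolding GL_stat_def by measurable
    show "0 \<le> GL_stat z" for z :: "'n \<Rightarrow> (real, 'p) vec"
      by (simp add: GL_stat_def sum_nonneg)
    show "GL_stat (standardized (\<lambda>i. a + B *v x i)) = GL_stat (standardized x)"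
      if "B \<in> GLp" "positive_definite (sample_cov x)" for a and B :: "'p sqmat" and x :: "'n \<Rightarrow> (real, 'p) vec"
      using that by (simp add: GL_stat_def norm_standardized_affine GLp_def)
  qed (fact * LTp_subset_GLp order_refl)+
  show "LBI_region f GLp (rejection_region (GL_stat :: ('n \<Rightarrow> (real, 'p) vec) \<Rightarrow> real) k)"
    by (rule LBI_rejection_region)
qed

lemma LT_LBI: "LBI_region f LTp (rejection_region (LT_stat :: ('n \<Rightarrow> (real, 'p) vec) \<Rightarrow> real) k)"
proof (rule LT_conditional_means[OF n])
  fix \<alpha> \<beta> \<gamma> :: real
  assume *: "0 \<le> \<alpha>" "0 < \<beta>" "0 \<le> \<gamma>"
    "\<And>R :: ('n \<Rightarrow> (real, 'p) vec) set. invariant_set LTp R \<Longrightarrow>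
      (\<integral>\<^sup>+x. indicator R x * (ennreal (sum_norm4 x) * ennreal (gauss x)) \<partial>samples) =
      (\<integral>\<^sup>+x. indicator R x * (ennreal (\<alpha> + \<beta> * LT_stat (standardized x)) * ennreal (gauss x)) \<partial>samples)"
    "\<And>R :: ('n \<Rightarrow> (real, 'p) vec) set. invariant_set LTp R \<Longrightarrow>
      (\<integral>\<^sup>+x. indicator R x * (ennreal (sum_norm2 x) * ennreal (gauss x)) \<partial>samples) =
      (\<integral>\<^sup>+x. indicator R x * (ennreal \<gamma> * ennreal (gauss x)) \<partial>samples)"
  interpret invariant_statistic f p\<^sub>0 p\<^sub>1 p\<^sub>2 \<epsilon> N LTp LT_stat \<alpha> \<beta> \<gamma>
  proof
    show "(\<lambda>x :: 'n \<Rightarrow> (real, 'p) vec. LT_stat (standardized x)) \<in> borel_measurable samples"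
      unfolding LT_stat_def Let_def by measurable
    show "0 \<le> LT_stat z" for z :: "'n \<Rightarrow> (real, 'p) vec"
      by (simp add: LT_stat_eq_sum sum_nonneg LT_form_nonneg[OF n])
    show "LT_stat (standardized (\<lambda>i. a + B *v x i)) = LT_stat (standardized x)"
      if "B \<in> LTp" "positive_definite (sample_cov x)" for a and B :: "'p sqmat" and x :: "'n \<Rightarrow> (real, 'p) vec"
      using that by (simp add: standardized_affine_LTp)
  qed (fact * LTp_subset_GLp order_refl)+
  show "LBI_region f LTp (rejection_region (LT_stat :: ('n \<Rightarrow> (real, 'p) vec) \<Rightarrow> real) k)"
    by (rule LBI_rejection_region)
qed

end

theorem theorem3:
  fixes f :: "real^'p::{finite,linorder} \<Rightarrow> real \<Rightarrow> real"
    and p\<^sub>0 p\<^sub>1 p\<^sub>2 \<epsilon> :: real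
  assumes "CARD('n::finite) > CARD('p)"
    and "\<And>\<theta>. \<theta> \<ge> 0 \<Longrightarrow> is_density (\<lambda>x. f x \<theta>)"
    and "\<And>x. f x 0 = (2 * pi) powr (- real CARD('p) / 2) * exp (- ((norm x)\<^sup>2 / 2))"
    and "log_C1 f"
    and "p\<^sub>0 > 0"
    and "\<And>x. d_theta f x 0 / f x 0 = p\<^sub>0 * norm x ^ 4 + p\<^sub>1 * (norm x)\<^sup>2 + p\<^sub>2"
    and "\<epsilon> > 0"
    and "(\<integral>\<^sup>+B\<in>GLp. (\<integral>\<^sup>+a. g_sup TYPE('n) f a B \<epsilon> ^ CARD('n) *
            ennreal (exp (- real CARD('n) / 2 * (norm a)\<^sup>2
                          - real CARD('n) / 2 * trace (transpose B ** B)) *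
                     \<bar>det B\<bar> ^ (CARD('n) - CARD('p) - 1)) \<partial>lborel) \<partial>lborel) < \<infinity>"
  shows "(\<forall>k. LBI_region f GLp (rejection_region (GL_stat :: ('n \<Rightarrow> real^'p::{finite,linorder}) \<Rightarrow> real) k)) \<and>
         (\<forall>k'. LBI_region f LTp (rejection_region (LT_stat :: ('n \<Rightarrow> real^'p::{finite,linorder}) \<Rightarrow> real) k'))"
proof -
  interpret normal_alternatives f p\<^sub>0 p\<^sub>1 p\<^sub>2 \<epsilon> "TYPE('n)"
    by unfold_locales (use assms in auto)
  show ?thesis using GL_LBI LT_LBI by blast
qed

end
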